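(* Let $\beta_1,\dots,\beta_n$ be distinct positive reals, let $C_{j,n}:=\prod_{k=1,\,k\neq j}^n\frac{\beta_k}{\beta_k-\beta_j}$, let $\nu=[a,R,M]$ be an infinitely divisible probability measure on $\mathbb{R}^d$, and write $$\mathcal{J}^{\{\beta_1,\dots,\beta_n\}}(\nu)=\big[a^{\{\beta_1,\dots,\beta_n\}},R^{\{\beta_1,\dots,\beta_n\}},M^{\{\beta_1,\dots,\beta_n\}}\big].$$ Then $$a^{\{\beta_1,\dots,\beta_n\}}=a\prod_{j=1}^n\frac{\beta_j}{\beta_j+1}+\sum_{j=1}^n\frac{\beta_j\,b_{M,\beta_j}}{\beta_j+1}\prod_{k=1,\,k\neq j}^n\frac{\beta_k}{\beta_k-\beta_j}=\sum_{j=1}^n C_{j,n}\,a^{\{\beta_j\}},$$ $$R^{\{\beta_1,\dots,\beta_n\}}=\Big(\prod_{j=1}^n\frac{\beta_j}{\beta_j+2}\Big)R=\sum_{j=1}^n C_{j,n}\,R^{\{\beta_j\}},$$ and, for Borel sets $A\subset\mathbb{R}^d\setminus\{0\}$, $$M^{\{\beta_1,\dots,\beta_n\}}(A)=\int_0^1\cdots\int_0^1 T_{t_1^{1/\beta_1}\cdots t_n^{1/\beta_n}}M(A)\,dt_1\cdots dt_n=\sum_{j=1}^n C_{j,n}\,M^{\{\beta_j\}}(A).$$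
   Context: Infinitely divisible measures and triples: the characteristic function of an infinitely divisible probability measure $\mu$ on $\mathbb{R}^d$ is $\hat\mu(y)=e^{\Phi(y)}$ with $$\Phi(y)=i\langle y,a\rangle-\tfrac12\langle y,Ry\rangle+\int_{\mathbb{R}^d\setminus\{0\}}\big[e^{i\langle y,x\rangle}-1-i\langle y,x\rangle 1_B(x)\big]M(dx),$$ where $B=\{x:\|x\|\le1\}$, $a\in\mathbb{R}^d$ is a shift vector, $R$ is a covariance operator (symmetric, nonnegative definite) and $M$ is a Lévy spectral measure, i.e. a Borel measure on $\mathbb{R}^d\setminus\{0\}$ with $\int\min(1,\|x\|^2)M(dx)<\infty$. The triple is unique and one writes $\mu=[a,R,M]$. For $c>0$, $T_cM(A):=M(c^{-1}A)$. $(Y_\nu(t))_{t\ge0}$ denotes an $\mathbb{R}^d$-valued Lévy process (stationary independent increments, starting from $0$, cadlag paths) with $\mathcal{L}(Y_\nu(1))=\nu$, where $\mathcal{L}(X)$ is the distribution of $X$. Random integrals are defined pathwise by formal integration by parts: for $h$ continuous of bounded variation and $r\ge 0$ monotone, $\int_{(a,b]}h(t)\,dY_\nu(r(t)):=h(b)Y_\nu(r(b))-h(a)Y_\nu(r(a))-\int_{(a,b]}Y_\nu(r(t))\,dh(t)$. For $\beta>0$ and $\nu$ infinitely divisible, $$\mathcal{J}^{\{\beta\}}(\nu)\equiv\mathcal{J}^{\beta}(\nu):=\mathcal{L}\Big(\int_{(0,1]}t^{1/\beta}\,dY_\nu(t)\Big)=\mathcal{L}\Big(\int_{(0,1]}t\,dY_\nu(t^\beta)\Big),$$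 which is again infinitely divisible, and for $m\ge 2$, $\mathcal{J}^{\{\beta_1,\dots,\beta_m\}}(\nu):=\mathcal{J}^{\beta_m}(\mathcal{J}^{\{\beta_1,\dots,\beta_{m-1}\}}(\nu))$. For $\nu=[a,R,M]$ and $\beta>0$ put $$b_{M,\beta}:=\int_{\{\|x\|>1\}}x\,\|x\|^{-1-\beta}M(dx)\in\mathbb{R}^d,$$ $$a^{\{\beta\}}:=\frac{\beta}{\beta+1}(a+b_{M,\beta}),\qquad R^{\{\beta\}}:=\frac{\beta}{\beta+2}R,$$ $$M^{\{\beta\}}(A):=\int_0^1T_{t^{1/\beta}}M(A)\,dt=\beta\int_0^1M(s^{-1}A)\,s^{\beta-1}ds$$ for Borel $A\subset\mathbb{R}^d\setminus\{0\}$; this is the triple of $\mathcal{J}^{\{\beta\}}(\nu)$, i.e. $\mathcal{J}^{\{\beta\}}(\nu)=[a^{\{\beta\}},R^{\{\beta\}},M^{\{\beta\}}]$. Empty products equal $1$.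
   Formalization: The last sum for M(A) can read infinity minus infinity when some M^{β_j}(A) are infinite; it is proved literally when all M^{β_j}(A) are finite, and for all Borel A with the terms having negative C_{j,n} moved to the other side. *)

theory Defs
  imports "HOL-Probability.Probability"
begin

section \<open>Infinitely divisible measures and their triples\<close>

text \<open>The space \<open>\<real>\<^sup>d\<close> is an arbitrary Euclidean space \<^typ>\<open>'a::euclidean_space\<close>.\<close>

definition infinitely_divisible :: "'a::euclidean_space measure \<Rightarrow> bool" where
  "infinitely_divisible \<mu> \<longleftrightarrow>
     prob_space \<mu> \<and> sets \<mu> = sets borel \<and>
     (\<forall>n\<ge>1. \<exists>\<rho>. prob_space \<rho> \<and> sets \<rho> = sets borel \<and>
        \<mu> = distr (\<Pi>\<^sub>M i\<in>{..<n::nat}. \<rho>) borel (\<lambda>x. \<Sum>i<n. x i))"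

definition char_fun :: "'a::euclidean_space measure \<Rightarrow> 'a \<Rightarrow> complex" where
  "char_fun \<mu> y = (CLINT x|\<mu>. iexp (y \<bullet> x))"

definition covariance_operator :: "('a::euclidean_space \<Rightarrow> 'a) \<Rightarrow> bool" where
  "covariance_operator R \<longleftrightarrow>
     linear R \<and> (\<forall>x y. R x \<bullet> y = x \<bullet> R y) \<and> (\<forall>x. 0 \<le> x \<bullet> R x)"

text \<open>A L\'evy spectral measure lives on the punctured space, which is the carrier of the measure.\<close>

definition levy_spectral_measure :: "'a::euclidean_space measure \<Rightarrow> bool" where
  "levy_spectral_measure M \<longleftrightarrow>
     sets M = sets (restrict_space borel (UNIV - {0})) \<and>
     (\<integral>\<^sup>+x. ennreal (min 1 ((norm x)\<^sup>2)) \<partial>M) < \<infinity>"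

definition levy_exponent ::
    "'a::euclidean_space \<Rightarrow> ('a \<Rightarrow> 'a) \<Rightarrow> 'a measure \<Rightarrow> 'a \<Rightarrow> complex" where
  "levy_exponent a R M y =
     \<i> * of_real (y \<bullet> a) - of_real (y \<bullet> R y) / 2 +
     (CLINT x|M. iexp (y \<bullet> x) - 1 - \<i> * of_real (y \<bullet> x) * indicator (cball 0 1) x)"

text \<open>The relation \<open>\<mu> = [a, R, M]\<close>.\<close>

definition has_triple ::
    "'a::euclidean_space measure \<Rightarrow> 'a \<Rightarrow> ('a \<Rightarrow> 'a) \<Rightarrow> 'a measure \<Rightarrow> bool" where
  "has_triple \<mu> a R M \<longleftrightarrow>
     infinitely_divisible \<mu> \<and> covariance_operator R \<and> levy_spectral_measure M \<and>
     (\<forall>y. char_fun \<mu> y = exp (levy_exponent a R M y))"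


section \<open>L\'evy processes and random integrals\<close>

definition levy_process ::
    "'w measure \<Rightarrow> (real \<Rightarrow> 'w \<Rightarrow> 'a::euclidean_space) \<Rightarrow> bool" where
  "levy_process \<Omega> Y \<longleftrightarrow>
     prob_space \<Omega> \<and>
     (\<forall>t\<ge>0. Y t \<in> borel_measurable \<Omega>) \<and>
     (\<forall>w\<in>space \<Omega>. Y 0 w = 0) \<and>
     (\<forall>s\<ge>0. \<forall>t\<ge>0. distr \<Omega> borel (\<lambda>w. Y (s + t) w - Y s w) = distr \<Omega> borel (Y t)) \<and>
     (\<forall>n. \<forall>t :: nat \<Rightarrow> real. 0 \<le> t 0 \<and> (\<forall>i<n. t i \<le> t (Suc i)) \<longrightarrow>
        prob_space.indep_vars \<Omega> (\<lambda>_. borel) (\<lambda>i w. Y (t (Suc i)) w - Y (t i) w) {..<n}) \<and>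
     (\<forall>w\<in>space \<Omega>. \<forall>t\<ge>0. continuous (at_right t) (\<lambda>s. Y s w) \<and>
        (t > 0 \<longrightarrow> (\<exists>l. ((\<lambda>s. Y s w) \<longlongrightarrow> l) (at_left t))))"

text \<open>
  The integral of \<open>h(t)\<close> over \<open>(u,v]\<close> against \<open>dy(r(t))\<close>, for a single path \<open>y\<close>, by formal
  integration by parts. The integrand \<open>h\<close> is supposed to be continuous and nondecreasing on
  \<open>[u,v]\<close>, so that \<open>dh\<close> is the positive Lebesgue--Stieltjes measure of \<open>h\<close>. As
  \<^const>\<open>interval_measure\<close> expects a nondecreasing function on the whole line, \<open>h\<close> is continued by
  constants outside \<open>[u,v]\<close>; this does not affect the measure on \<open>(u,v]\<close>.
\<close>

definition path_integral ::
    "real \<Rightarrow> real \<Rightarrow> (real \<Rightarrow> real) \<Rightarrow> (real \<Rightarrow> 'a::euclidean_space) \<Rightarrow> (real \<Rightarrow> real) \<Rightarrow> 'a" where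
  "path_integral u v h y r =
     h v *\<^sub>R y (r v) - h u *\<^sub>R y (r u) -
     (LINT t:{u<..v}|interval_measure (\<lambda>t. h (max u (min v t))). y (r t))"

text \<open>
  \<open>rand_int_law TYPE('w) \<beta> \<nu> \<mu>\<close> renders \<open>\<mu> = \<J>\<^sup>\<beta>(\<nu>)\<close>: the measure \<open>\<mu>\<close> is the law of the integral
  of \<open>t powr (1/\<beta>)\<close> over \<open>(0,1]\<close> against a L\'evy process with law \<open>\<nu>\<close> at time 1. As HOL does not
  quantify over types inside formulas, the type \<^typ>\<open>'w\<close> of the sample space is a parameter.
  Instantiating it with the path type \<^typ>\<open>real \<Rightarrow> 'a\<close> loses no law, because every L\'evy process
  can be realised on the space of its paths.
\<close>

definition rand_int_law ::
    "'w itself \<Rightarrow> real \<Rightarrow> 'a::euclidean_space measure \<Rightarrow> 'a measure \<Rightarrow> bool" where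
  "rand_int_law TYPE('w) \<beta> \<nu> \<mu> \<longleftrightarrow>
     (\<exists>(\<Omega> :: 'w measure) Y. levy_process \<Omega> Y \<and> distr \<Omega> borel (Y 1) = \<nu> \<and>
        \<mu> = distr \<Omega> borel
              (\<lambda>w. path_integral 0 1 (\<lambda>t. t powr (1 / \<beta>)) (\<lambda>t. Y t w) (\<lambda>t. t)))"

text \<open>
  \<open>iter_rand_int_law TYPE('w) \<beta> n \<nu> \<mu>\<close> renders \<open>\<mu>\<close> as the iterate of \<open>\<nu>\<close> for the parameters
  \<open>\<beta> 1, \<dots>, \<beta> n\<close>, applied in this order.
\<close>

primrec iter_rand_int_law ::
    "'w itself \<Rightarrow> (nat \<Rightarrow> real) \<Rightarrow> nat \<Rightarrow> 'a::euclidean_space measure \<Rightarrow> 'a measure \<Rightarrow> bool" where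
  "iter_rand_int_law W \<beta> 0 \<nu> \<mu> \<longleftrightarrow> \<mu> = \<nu>"
| "iter_rand_int_law W \<beta> (Suc m) \<nu> \<mu> \<longleftrightarrow>
     (\<exists>\<mu>'. iter_rand_int_law W \<beta> m \<nu> \<mu>' \<and> rand_int_law W (\<beta> (Suc m)) \<mu>' \<mu>)"


section \<open>The transformed triples\<close>

definition dilation :: "real \<Rightarrow> 'a::euclidean_space measure \<Rightarrow> 'a set \<Rightarrow> ennreal" where
  "dilation c M A = emeasure M ((\<lambda>x. inverse c *\<^sub>R x) ` A)"

definition b_vec :: "'a::euclidean_space measure \<Rightarrow> real \<Rightarrow> 'a" where
  "b_vec M \<beta> = (LINT x:{x. norm x > 1}|M. (norm x powr (- 1 - \<beta>)) *\<^sub>R x)"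

definition shift_trans :: "real \<Rightarrow> 'a::euclidean_space \<Rightarrow> 'a measure \<Rightarrow> 'a" where
  "shift_trans \<beta> a M = (\<beta> / (\<beta> + 1)) *\<^sub>R (a + b_vec M \<beta>)"

definition cov_trans :: "real \<Rightarrow> ('a::euclidean_space \<Rightarrow> 'a) \<Rightarrow> 'a \<Rightarrow> 'a" where
  "cov_trans \<beta> R = (\<lambda>x. (\<beta> / (\<beta> + 2)) *\<^sub>R R x)"

definition spec_trans :: "real \<Rightarrow> 'a::euclidean_space measure \<Rightarrow> 'a set \<Rightarrow> ennreal" where
  "spec_trans \<beta> M A = (\<integral>\<^sup>+t\<in>{0<..1}. dilation (t powr (1 / \<beta>)) M A \<partial>lborel)"

text \<open>
  The iterated integral \<open>\<integral>\<^sub>0\<^sup>1 \<dots> \<integral>\<^sub>0\<^sup>1 f(t\<^sub>1,\<dots>,t\<^sub>n) dt\<^sub>1 \<dots> dt\<^sub>n\<close> of a function depending on the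
  coordinates \<open>t 1, \<dots>, t n\<close> only (the remaining ones are set to 0).
\<close>

primrec iter_integral :: "nat \<Rightarrow> ((nat \<Rightarrow> real) \<Rightarrow> ennreal) \<Rightarrow> ennreal" where
  "iter_integral 0 f = f (\<lambda>_. 0)"
| "iter_integral (Suc n) f =
     (\<integral>\<^sup>+s\<in>{0<..1}. iter_integral n (\<lambda>t. f (t(Suc n := s))) \<partial>lborel)"

definition C_coeff :: "(nat \<Rightarrow> real) \<Rightarrow> nat \<Rightarrow> nat \<Rightarrow> real" where
  "C_coeff \<beta> j n = (\<Prod>k\<in>{1..n} - {j}. \<beta> k / (\<beta> k - \<beta> j))"

end

theory Submission
  imports Defs
begin

text \<open>
  Let \<open>U\<^sub>1, \<dots>, U\<^sub>n\<close> be independent and uniform on \<open>(0,1]\<close>, and let \<open>\<kappa>\<close> be the law of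
  \<open>S = U\<^sub>1 powr (1/\<beta>\<^sub>1) \<cdots> U\<^sub>n powr (1/\<beta>\<^sub>n)\<close>. The theorem rests on two facts: the iterated random
  integral averages the L\'evy exponent \<open>\<Phi>\<close> of \<open>\<nu>\<close> over the dilations by \<open>S\<close>, and the density of
  \<open>\<kappa>\<close> is the signed combination \<open>\<Sum>\<^sub>j C\<^sub>j\<^sub>,\<^sub>n \<beta>\<^sub>j s powr (\<beta>\<^sub>j - 1)\<close> of the densities of the powers
  \<open>U\<^sub>j powr (1/\<beta>\<^sub>j)\<close>. Everything in the conclusion is linear in \<open>\<kappa>\<close>.

  \<^emph>\<open>The averaged exponent.\<close> A path integral is the limit of Riemann sums over increments of the
  L\'evy process (summation by parts), and the increments over the intervals of length \<open>1/N\<close> are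
  independent with characteristic function \<open>exp (\<Phi>/N)\<close>. Hence one random integral replaces
  \<open>\<Phi> y\<close> by the integral of \<open>\<Phi> (t powr (1/\<beta>) y)\<close> over \<open>t\<close> in \<open>(0,1]\<close>
  (\<open>rand_int_law_char\<close>), and \<open>n\<close> of them produce the expectation of \<open>\<Phi> (S y)\<close>
  (\<open>iter_rand_int_law_char\<close>). By Fubini's theorem this is again a L\'evy exponent
  (\<open>levy_exponent_mixture\<close>): its Gaussian part is scaled by the second moment of \<open>S\<close>, its spectral
  measure is the image of \<open>\<kappa> \<otimes> M\<close> under \<open>(s,x) \<mapsto> s x\<close>, and its shift is the mean of \<open>S\<close> times \<open>a\<close>,
  corrected by the jumps \<open>x\<close> outside the unit ball that the dilation by \<open>S\<close> carries into it.

  \<^emph>\<open>The law of \<open>S\<close>.\<close> Its distribution function on \<open>(0,1)\<close> is \<open>\<Sum>\<^sub>j C\<^sub>j\<^sub>,\<^sub>n x powr \<beta>\<^sub>j\<close>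
  (\<open>cdf_mix_law\<close>); the induction on \<open>n\<close> is the partial fraction identity
  \<open>\<Prod>\<^sub>j \<beta>\<^sub>j/(\<beta>\<^sub>j - z) = 1 + \<Sum>\<^sub>j C\<^sub>j\<^sub>,\<^sub>n z/(\<beta>\<^sub>j - z)\<close>. The same identity turns the products in the
  formulas for the shift and the covariance into sums. Since the signed density is nonnegative, the
  relation for the spectral measures holds pointwise under the integral, so it survives infinite
  values.

  \<^emph>\<open>Uniqueness.\<close> The conclusion speaks of every triple of \<open>\<mu>\<close>, so the L\'evy--Khintchine representation
  must be unique (\<open>has_triple_unique\<close>), which in turn needs that the characteristic function
  determines a finite measure on a Euclidean space (\<open>char_fun_unique\<close>). The latter also shows that
  \<open>\<mu>\<close> is infinitely divisible: the integral against \<open>Y (t/N)\<close> has an \<open>N\<close>-th convolution root of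
  \<open>\<mu>\<close> as its law.
\<close>

section \<open>Characteristic functions determine finite measures\<close>

text \<open>
  The one-dimensional case of probability measures is L\'evy's uniqueness theorem. A finite measure is
  normalised by its total mass, which is the value at 0 of the transform.
\<close>

lemma finite_measure_char_unique:
  fixes M N :: "real measure"
  assumes "finite_measure M" "finite_measure N" and [measurable_cong]: "sets M = sets borel" "sets N = sets borel"
    and eq: "\<And>t. (CLINT x|M. iexp (t * x)) = (CLINT x|N. iexp (t * x))"
  shows "M = N"
proof -
  interpret M: finite_measure M by fact
  interpret N: finite_measure N by fact
  have sp: "space M = UNIV" "space N = UNIV"
    using assms by (auto dest: sets_eq_imp_space_eq)
  define m where "m = measure M UNIV"
  have mN: "m = measure N UNIV"
    using eq[of 0] by (simp add: sp m_def)
  show ?thesis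
  proof (cases "m = 0")
    case True
    have "emeasure M A = 0" "emeasure N A = 0" for A
      using emeasure_space[of M A] emeasure_space[of N A] True mN
      by (simp_all add: M.emeasure_eq_measure N.emeasure_eq_measure sp m_def measure_le_0_iff)
    then show ?thesis by (intro measure_eqI) (simp_all add: assms)
  next
    case False
    then have m: "m > 0" by (simp add: m_def less_le)
    define D where "D = (\<lambda>P::real measure. density P (\<lambda>_. ennreal (1 / m)))"
    have rd: "real_distribution (D P)" if "P = M \<or> P = N" for P
    proof -
      have "emeasure (D P) (space (D P)) = 1"
        using that m mN False
        by (auto simp: D_def emeasure_density nn_integral_cmult sp m_def M.emeasure_eq_measure
            N.emeasure_eq_measure simp flip: ennreal_mult)
      then show ?thesis
        using that assms(3,4) by (intro real_distribution.intro prob_spaceI real_distribution_axioms.intro)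
          (auto simp: D_def)
    qed
    have ch: "char (D P) t = (1 / m) *\<^sub>R (CLINT x|P. iexp (t * x))" if "P = M \<or> P = N" for P t
      using that m assms(3,4) unfolding char_def D_def
      by (subst integral_density) (auto simp: sp measurable_cong_sets[OF assms(3) refl]
          measurable_cong_sets[OF assms(4) refl])
    have "char (D M) = char (D N)"
      by (rule ext) (simp only: ch[of M] ch[of N] simp_thms eq)
    then have "D M = D N"
      by (intro Levy_uniqueness rd) auto
    moreover have "density (D P) (\<lambda>_. ennreal m) = P" for P
      using m by (simp add: D_def density_density_eq density_1 flip: ennreal_mult)
    ultimately show ?thesis by metis
  qed
qed

text \<open>
  A nonnegative weight \<open>f\<close> makes \<open>f \<cdot> M\<close> a finite measure; its projection to the line along
  \<open>b\<close> is covered by the one-dimensional theorem.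
\<close>

lemma weighted_projection_integral_eq:
  fixes M N :: "'a::euclidean_space measure" and f :: "'a \<Rightarrow> real"
  assumes "finite_measure M" "finite_measure N" and sets: "sets M = sets borel" "sets N = sets borel"
    and f [measurable]: "f \<in> borel_measurable borel" and f0: "\<And>x. 0 \<le> f x" and fK: "\<And>x. f x \<le> K"
    and eq: "\<And>y. (CLINT x|M. f x * iexp (y \<bullet> x)) = (CLINT x|N. f x * iexp (y \<bullet> x))"
    and B: "B \<in> sets borel"
  shows "(LINT x|M. f x * indicator B (x \<bullet> b)) = (LINT x|N. f x * indicator B (x \<bullet> b))"
proof -
  define Q where "Q = (\<lambda>P :: 'a measure. distr (density P (\<lambda>x. ennreal (f x))) borel (\<lambda>x. x \<bullet> b))"
  have *: "finite_measure (Q P)"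
    "(CLINT x|Q P. iexp (t * x)) = (CLINT x|P. f x * iexp ((t *\<^sub>R b) \<bullet> x))"
    "measure (Q P) B = (LINT x|P. f x * indicator B (x \<bullet> b))"
    if "finite_measure P" and sP[measurable_cong]: "sets P = sets borel" for P t
  proof -
    interpret P: finite_measure P by fact
    have i: "integrable P f"
      using f0 fK by (intro P.integrable_const_bound[where B = K]) auto
    have D: "finite_measure (density P f)"
      using i f0 by (intro finite_measureI) (simp add: emeasure_density nn_integral_eq_integral)
    then show fin: "finite_measure (Q P)"
      unfolding Q_def by (intro finite_measure.finite_measure_distr) auto
    show "(CLINT x|Q P. iexp (t * x)) = (CLINT x|P. f x * iexp ((t *\<^sub>R b) \<bullet> x))"
      unfolding Q_def using f0
      by (subst integral_distr) (auto simp: integral_density scaleR_conv_of_real inner_commute)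
    interpret Q: finite_measure "Q P" by fact
    have "(LINT x|Q P. indicator B x) = (LINT x|P. f x * indicator B (x \<bullet> b))"
      unfolding Q_def using f0 B
      by (subst integral_distr) (auto simp: integral_density)
    then show "measure (Q P) B = (LINT x|P. f x * indicator B (x \<bullet> b))"
      using B by (simp add: Q_def)
  qed
  have "Q M = Q N"
  proof (rule finite_measure_char_unique)
    show "(CLINT x|Q M. iexp (t * x)) = (CLINT x|Q N. iexp (t * x))" for t
      by (simp only: *(2)[OF assms(1) sets(1)] *(2)[OF assms(2) sets(2)] eq)
  qed (use *(1) assms in \<open>auto simp: Q_def\<close>)
  then show ?thesis
    using *(3)[OF assms(1) sets(1)] *(3)[OF assms(2) sets(2)] by simp
qed

text \<open>
  The passage to several dimensions treats one coordinate at a time. After the coordinates in \<open>S\<close>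
  have been localised to the sets \<open>A b\<close>, one more coordinate is localised by applying the
  one-dimensional theorem to measures weighted with the oscillating factor \<open>iexp (y \<bullet> x)\<close>. That
  factor stays in the statement for the coordinates still to come.
\<close>

lemma cylinder_char_integral_eq:
  fixes M N :: "'a::euclidean_space measure"
  assumes fin: "finite_measure M" "finite_measure N" and sets: "sets M = sets borel" "sets N = sets borel"
    and eq: "\<And>y. char_fun M y = char_fun N y"
    and S: "finite S" and A: "\<And>b. b \<in> S \<Longrightarrow> A b \<in> sets borel"
  shows "(CLINT x|M. indicator {x. \<forall>b\<in>S. x \<bullet> b \<in> A b} x * iexp (y \<bullet> x)) =
         (CLINT x|N. indicator {x. \<forall>b\<in>S. x \<bullet> b \<in> A b} x * iexp (y \<bullet> x))"
  using S A
proof (induction S arbitrary: y rule: finite_induct)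
  case empty
  then show ?case using eq[of y] by (simp add: char_fun_def)
next
  case (insert b S)
  note [measurable] = insert.prems[OF insertI2]
  have Ab: "A b \<in> sets borel" using insert.prems by auto
  define E where "E = {x. \<forall>c\<in>S. x \<bullet> c \<in> A c}"
  have [measurable]: "E \<in> sets borel"
    unfolding E_def using insert by measurable
  interpret M: finite_measure M by fact
  interpret N: finite_measure N by fact
  have meas: "g \<in> borel_measurable M" "g \<in> borel_measurable N"
    if "g \<in> borel_measurable borel" for g :: "'a \<Rightarrow> 'z::topological_space"
    using that by (simp_all cong: measurable_cong_sets add: sets)
  have int: "integrable M g" "integrable N g"
    if "g \<in> borel_measurable borel" "\<And>x. norm (g x) \<le> K" for g :: "'a \<Rightarrow> 'z::{banach,second_countable_topology}" and K
    using that by (auto intro!: M.integrable_const_bound[where B=K] N.integrable_const_bound[where B=K] meas)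
  have IH: "(CLINT x|M. indicator E x * iexp (z \<bullet> x)) = (CLINT x|N. indicator E x * iexp (z \<bullet> x))" for z
    using insert by (simp add: E_def)
  have nE: "cmod (indicator E x * iexp t) \<le> 1" for x and t :: real
    by (simp add: norm_mult indicator_def)
  have iE: "integrable M (\<lambda>x. indicator E x * iexp (z \<bullet> x))" "integrable N (\<lambda>x. indicator E x * iexp (z \<bullet> x))" for z
    using nE by (auto intro!: int[of _ 1])
  \<comment> \<open>The weights \<open>1 + cos\<close> and \<open>1 + sin\<close> are nonnegative, which makes the weighted measures genuine measures.\<close>
  define w1 w2 w3 where w: "w1 = (\<lambda>x. indicat_real E x)"
    "w2 = (\<lambda>x. indicat_real E x * (1 + cos (y \<bullet> x)))" "w3 = (\<lambda>x. indicat_real E x * (1 + sin (y \<bullet> x)))"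
  have w_bound: "0 \<le> w1 x" "w1 x \<le> 2" "0 \<le> w2 x" "w2 x \<le> 2" "0 \<le> w3 x" "w3 x \<le> 2" for x
    using cos_ge_minus_one[of "y \<bullet> x"] cos_le_one[of "y \<bullet> x"] sin_ge_minus_one[of "y \<bullet> x"] sin_le_one[of "y \<bullet> x"]
    by (cases "x \<in> E"; simp add: w del: cos_le_one sin_le_one cos_ge_minus_one sin_ge_minus_one; linarith)+
  have [measurable]: "w1 \<in> borel_measurable borel" "w2 \<in> borel_measurable borel" "w3 \<in> borel_measurable borel"
    unfolding w by measurable
  have e1: "w1 x * iexp (z \<bullet> x) = indicator E x * iexp (z \<bullet> x)" for z x
    by (simp add: w indicator_def)
  have e2: "w2 x * iexp (z \<bullet> x) = indicator E x * iexp (z \<bullet> x) +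
      (indicator E x * iexp ((z + y) \<bullet> x) + indicator E x * iexp ((z - y) \<bullet> x)) / 2" for z x
    by (cases "x \<in> E")
      (simp_all add: w inner_diff_left inner_add_left cos_of_real[symmetric] cos_exp_eq field_simps
        exp_diff exp_add exp_minus del: cos_of_real)
  have e3: "w3 x * iexp (z \<bullet> x) = indicator E x * iexp (z \<bullet> x) +
      (indicator E x * iexp ((z + y) \<bullet> x) - indicator E x * iexp ((z - y) \<bullet> x)) / (2 * \<i>)" for z x
    by (cases "x \<in> E")
      (simp_all add: w inner_diff_left inner_add_left sin_of_real[symmetric] sin_exp_eq field_simps
        exp_diff exp_add exp_minus del: sin_of_real)
  note half = weighted_projection_integral_eq[OF fin sets _ _ _ _ Ab, where b = b and K = 2]
  have h1: "(LINT x|M. w1 x * indicator (A b) (x \<bullet> b)) = (LINT x|N. w1 x * indicator (A b) (x \<bullet> b))"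
    by (rule half) (auto simp: w_bound e1 IH)
  have h2: "(LINT x|M. w2 x * indicator (A b) (x \<bullet> b)) = (LINT x|N. w2 x * indicator (A b) (x \<bullet> b))"
    by (rule half) (auto simp only: w_bound e2 IH iE Bochner_Integration.integral_add integral_divide_zero
          Bochner_Integration.integrable_add Bochner_Integration.integrable_divide \<open>w2 \<in> borel_measurable borel\<close>)
  have h3: "(LINT x|M. w3 x * indicator (A b) (x \<bullet> b)) = (LINT x|N. w3 x * indicator (A b) (x \<bullet> b))"
    by (rule half) (auto simp only: w_bound e3 IH iE Bochner_Integration.integral_add integral_divide_zero
          Bochner_Integration.integrable_add Bochner_Integration.integral_diff Bochner_Integration.integrable_diff
          Bochner_Integration.integrable_divide \<open>w3 \<in> borel_measurable borel\<close>)
  have iw: "integrable P (\<lambda>x. w x * indicator (A b) (x \<bullet> b))" if "P = M \<or> P = N" "w = w1 \<or> w = w2 \<or> w = w3" for w P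
  proof -
    have [measurable]: "w \<in> borel_measurable borel" using that by auto
    have "norm (w x * indicator (A b) (x \<bullet> b)) \<le> 2" for x
      using w_bound[of x] that by (auto simp: indicator_def)
    then show ?thesis using that(1) Ab by (auto intro!: int[of _ 2])
  qed
  have split: "indicator {x. \<forall>c\<in>insert b S. x \<bullet> c \<in> A c} x * iexp (y \<bullet> x) =
      of_real (w2 x * indicator (A b) (x \<bullet> b) - w1 x * indicator (A b) (x \<bullet> b)) +
      \<i> * of_real (w3 x * indicator (A b) (x \<bullet> b) - w1 x * indicator (A b) (x \<bullet> b))" for x
    by (auto simp: w E_def indicator_def iexp_eq1 cis_conv_exp[symmetric] complex_eq_iff)
  have parts: "(CLINT x|P. of_real (w2 x * indicator (A b) (x \<bullet> b) - w1 x * indicator (A b) (x \<bullet> b)) +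
      \<i> * of_real (w3 x * indicator (A b) (x \<bullet> b) - w1 x * indicator (A b) (x \<bullet> b))) =
     of_real ((LINT x|P. w2 x * indicator (A b) (x \<bullet> b)) - (LINT x|P. w1 x * indicator (A b) (x \<bullet> b))) +
     \<i> * of_real ((LINT x|P. w3 x * indicator (A b) (x \<bullet> b)) - (LINT x|P. w1 x * indicator (A b) (x \<bullet> b)))"
    if P: "P = M \<or> P = N" for P
  proof -
    have i: "integrable P (\<lambda>x. w x * indicator (A b) (x \<bullet> b) - w1 x * indicator (A b) (x \<bullet> b))"
      if "w = w2 \<or> w = w3" for w
      using iw[OF P, of w] iw[OF P, of w1] that by auto
    show ?thesis
      by (subst Bochner_Integration.integral_add, intro integrable_of_real i, simp,
          intro integrable_mult_right integrable_of_real i, simp,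
          subst integral_mult_right_zero, unfold integral_complex_of_real,
          subst (1 2) Bochner_Integration.integral_diff, auto intro: iw[OF P])
  qed
  \<comment> \<open>The plain indicator \<open>w1\<close> removes the constant 1 that was added to the cosine and the sine.\<close>
  show ?case
    unfolding split parts[of M, OF disjI1[OF refl]] parts[of N, OF disjI2[OF refl]] h1 h2 h3 ..
qed

lemma char_fun_unique:
  fixes M N :: "'a::euclidean_space measure"
  assumes fin: "finite_measure M" "finite_measure N" and sets: "sets M = sets borel" "sets N = sets borel"
    and eq: "\<And>y. char_fun M y = char_fun N y"
  shows "M = N"
proof -
  interpret M: finite_measure M by fact
  interpret N: finite_measure N by fact
  have sp: "space M = UNIV" "space N = UNIV"
    using sets by (auto dest: sets_eq_imp_space_eq)
  have box: "measure M (box u v) = measure N (box u v)" for u v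
  proof -
    have b: "box u v = {x. \<forall>b\<in>Basis. x \<bullet> b \<in> {u \<bullet> b<..<v \<bullet> b}}"
      by (auto simp: box_def)
    have "(CLINT x|M. indicator (box u v) x) = (CLINT x|N. indicator (box u v) x)"
      using cylinder_char_integral_eq[OF assms finite_Basis, of "\<lambda>b. {u \<bullet> b<..<v \<bullet> b}" 0]
      unfolding b[symmetric] by simp
    moreover have "(CLINT x|P. indicator (box u v) x) = of_real (measure P (box u v))"
      if "P = M \<or> P = N" for P
    proof -
      have "(CLINT x|P. indicator (box u v) x) = (CLINT x|P. of_real (indicator (box u v) x))"
        by (simp only: of_real_indicator)
      then show ?thesis
        unfolding integral_complex_of_real using that sp by auto
    qed
    ultimately show ?thesis by simp
  qed
  show ?thesis
  proof (rule measure_eqI_generator_eq[where \<Omega> = UNIV and E = "range (\<lambda>(a, b). box a b)"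
        and A = "\<lambda>n::nat. box (- (real n *\<^sub>R One)) (real n *\<^sub>R One)"])
    show "Int_stable (range (\<lambda>(a, b). box a b :: 'a set))"
      by (auto simp: Int_stable_def box_Int_box)
    show "sets M = sigma_sets UNIV (range (\<lambda>(a, b). box a b))"
      "sets N = sigma_sets UNIV (range (\<lambda>(a, b). box a b))"
      by (simp_all add: sets borel_eq_box)
    show "(\<Union>n. box (- (real n *\<^sub>R One)) (real n *\<^sub>R One)) = (UNIV :: 'a set)"
      by (rule UN_box_eq_UNIV)
  qed (auto simp: M.emeasure_eq_measure N.emeasure_eq_measure box)
qed

section \<open>Uniqueness of the triple\<close>

definition levy_integrand :: "'a::euclidean_space \<Rightarrow> 'a \<Rightarrow> complex" where
  "levy_integrand y x = iexp (y \<bullet> x) - 1 - \<i> * of_real (y \<bullet> x) * indicator (cball 0 1) x"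

lemma borel_measurable_levy_integrand [measurable (raw)]:
  assumes [measurable]: "f \<in> borel_measurable N" "g \<in> borel_measurable N"
  shows "(\<lambda>w. levy_integrand (f w) (g w)) \<in> borel_measurable N"
  unfolding levy_integrand_def indicator_def mem_cball dist_0_norm by measurable

text \<open>
  Second-order Taylor expansion inside the unit ball, the trivial bound outside. The form of the bound
  is the integrability condition on L\'evy spectral measures; every limit and every use of Fubini's
  theorem below is dominated by it.
\<close>

lemma norm_levy_integrand_le:
  "cmod (levy_integrand y x) \<le> (2 + (norm y)\<^sup>2) * min 1 ((norm x)\<^sup>2)"
proof (cases "norm x \<le> 1")
  case True
  have "cmod (levy_integrand y x) \<le> (\<bar>y \<bullet> x\<bar>)\<^sup>2"
    using True iexp_approx1[of "y \<bullet> x" 1] norm_ge_zero[of "levy_integrand y x"]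
    by (simp add: levy_integrand_def power2_eq_square diff_diff_eq del: norm_ge_zero)
  also have "\<dots> \<le> (norm y * norm x)\<^sup>2"
    using Cauchy_Schwarz_ineq2[of y x] by (intro power_mono) auto
  also have "\<dots> \<le> (2 + (norm y)\<^sup>2) * (norm x)\<^sup>2"
    by (simp add: power_mult_distrib mult_right_mono)
  finally show ?thesis using power_le_one[OF norm_ge_zero True, of 2] by (simp add: min_absorb2)
next
  case False
  then have "1 < (norm x)\<^sup>2" by (simp add: one_less_power)
  moreover have "cmod (levy_integrand y x) \<le> 2"
    using False norm_triangle_ineq4[of "iexp (y \<bullet> x)" 1] by (simp add: levy_integrand_def)
  ultimately show ?thesis by (simp add: min_def) (smt (verit) zero_le_power2)
qed

lemma levy_exponent_alt:
  "levy_exponent a R M y =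
     \<i> * of_real (y \<bullet> a) - of_real (y \<bullet> R y) / 2 + (CLINT x|M. levy_integrand y x)"
  by (simp add: levy_exponent_def levy_integrand_def)

lemma levy_exponent_zero [simp]: "levy_exponent a R M 0 = 0"
  by (simp add: levy_exponent_alt levy_integrand_def)

lemma
  assumes "levy_spectral_measure M"
  shows sets_levy_spectral_measure: "sets M = sets (restrict_space borel (UNIV - {0}))"
    and space_levy_spectral_measure: "space M = UNIV - {0}"
    and measurable_levy_spectral_measure: "f \<in> borel_measurable borel \<Longrightarrow> f \<in> borel_measurable M"
    and integrable_min_levy_spectral_measure: "integrable M (\<lambda>x. min 1 ((norm x)\<^sup>2))"
proof -
  show s: "sets M = sets (restrict_space borel (UNIV - {0}))"
    using assms by (simp add: levy_spectral_measure_def)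
  then show "space M = UNIV - {0}"
    by (auto dest: sets_eq_imp_space_eq simp: space_restrict_space)
  show m: "f \<in> borel_measurable M" if "f \<in> borel_measurable borel" for f :: "'a \<Rightarrow> 'z::topological_space"
    using measurable_restrict_space1[OF that] measurable_cong_sets[OF s refl] by blast
  show "integrable M (\<lambda>x. min 1 ((norm x)\<^sup>2))"
    using assms by (intro integrableI_nonneg m) (auto simp: levy_spectral_measure_def)
qed

lemma integrable_dominated_levy:
  fixes f :: "'a::euclidean_space \<Rightarrow> 'z::{banach, second_countable_topology}"
  assumes "levy_spectral_measure M" "f \<in> borel_measurable borel"
    and "\<And>x. norm (f x) \<le> K * min 1 ((norm x)\<^sup>2)"
  shows "integrable M f"
proof (rule Bochner_Integration.integrable_bound)
  show "integrable M (\<lambda>x. K * min 1 ((norm x)\<^sup>2))"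
    using integrable_min_levy_spectral_measure[OF assms(1)] by simp
  show "AE x in M. norm (f x) \<le> norm (K * min 1 ((norm x)\<^sup>2))"
    using assms(3) by (intro AE_I2) (smt (verit) real_norm_def)
qed (use assms measurable_levy_spectral_measure in blast)

lemma integrable_levy_integrand:
  "levy_spectral_measure M \<Longrightarrow> integrable M (levy_integrand y)"
  by (rule integrable_dominated_levy[OF _ _ norm_levy_integrand_le]) auto

lemma continuous_on_levy_exponent:
  assumes M: "levy_spectral_measure M" and R: "linear R"
  shows "continuous_on UNIV (levy_exponent a R M)"
proof -
  have "continuous_on UNIV R"
    using R by (simp add: linear_continuous_on linear_linear)
  moreover have "continuous_on UNIV (\<lambda>y. CLINT x|M. levy_integrand y x)"
    unfolding continuous_on_sequentially comp_def
  proof (intro ballI allI impI, elim conjE)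
    fix y and Y :: "nat \<Rightarrow> 'a" assume Y: "Y \<longlonglongrightarrow> y"
    then obtain B where B: "\<And>n. norm (Y n) \<le> B"
      using convergent_imp_bounded by (force simp: bounded_iff)
    have B2: "(norm (Y n))\<^sup>2 \<le> B\<^sup>2" for n
      using B by (simp add: power_mono)
    show "(\<lambda>n. CLINT x|M. levy_integrand (Y n) x) \<longlonglongrightarrow> (CLINT x|M. levy_integrand y x)"
    proof (rule integral_dominated_convergence)
      show "integrable M (\<lambda>x. (2 + B\<^sup>2) * min 1 ((norm x)\<^sup>2))"
        using integrable_min_levy_spectral_measure[OF M] by simp
      show "AE x in M. cmod (levy_integrand (Y n) x) \<le> (2 + B\<^sup>2) * min 1 ((norm x)\<^sup>2)" for n
        using B2[of n] by (intro AE_I2 order_trans[OF norm_levy_integrand_le] mult_right_mono) auto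
      show "AE x in M. (\<lambda>n. levy_integrand (Y n) x) \<longlonglongrightarrow> levy_integrand y x"
        unfolding levy_integrand_def by (intro AE_I2 tendsto_intros Y)
    qed (intro measurable_levy_spectral_measure[OF M], measurable)+
  qed
  ultimately show ?thesis
    unfolding levy_exponent_alt by (intro continuous_intros) auto
qed

text \<open>
  Two continuous logarithms differ by a continuous function with values in \<open>2 \<pi> \<i> \<int>\<close>, which is
  constant on a connected space.
\<close>

lemma continuous_log_unique:
  fixes \<Phi> \<Psi> :: "'a::euclidean_space \<Rightarrow> complex"
  assumes "continuous_on UNIV \<Phi>" "continuous_on UNIV \<Psi>" "\<And>y. exp (\<Phi> y) = exp (\<Psi> y)" "\<Phi> 0 = \<Psi> 0"
  shows "\<Phi> = \<Psi>"
proof -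
  have *: "\<exists>n::int. \<Phi> y - \<Psi> y = of_int n * (of_real (2 * pi) * \<i>)" for y
    using exp_eq[of "\<Phi> y" "\<Psi> y"] assms(3)[of y] by (auto simp: algebra_simps)
  have "(\<lambda>y. \<Phi> y - \<Psi> y) constant_on UNIV"
  proof (rule continuous_discrete_range_constant)
    fix x
    have "1 \<le> norm ((\<Phi> y - \<Psi> y) - (\<Phi> x - \<Psi> x))" if "\<Phi> y - \<Psi> y \<noteq> \<Phi> x - \<Psi> x" for y
    proof -
      obtain m n :: int where mn: "\<Phi> y - \<Psi> y = of_int m * (of_real (2 * pi) * \<i>)"
        "\<Phi> x - \<Psi> x = of_int n * (of_real (2 * pi) * \<i>)"
        using *[of x] *[of y] by metis
      with that have "m \<noteq> n" by auto
      then have "1 \<le> \<bar>real_of_int (m - n)\<bar>" by linarith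
      moreover have "1 \<le> 2 * pi" using pi_gt3 by simp
      ultimately have "1 * 1 \<le> \<bar>real_of_int (m - n)\<bar> * (2 * pi)" by (intro mult_mono) auto
      also have "\<dots> = norm (of_int (m - n) * (of_real (2 * pi) * \<i>))"
        by (simp add: norm_mult flip: of_int_diff)
      finally show ?thesis by (simp add: mn algebra_simps)
    qed
    then show "\<exists>e>0. \<forall>y. y \<in> UNIV \<and> \<Phi> y - \<Psi> y \<noteq> \<Phi> x - \<Psi> x \<longrightarrow> e \<le> norm ((\<Phi> y - \<Psi> y) - (\<Phi> x - \<Psi> x))"
      by (intro exI[of _ 1]) auto
  qed (auto intro!: continuous_intros assms)
  then have "\<Phi> y - \<Psi> y = \<Phi> 0 - \<Psi> 0" for y
    by (auto simp: constant_on_def)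
  then show ?thesis using assms(4) by auto
qed

text \<open>
  Under quadratic rescaling the shift and the jumps vanish in the limit, so that the Gaussian part can
  be read off from the exponent.
\<close>

lemma levy_exponent_scaled_limit:
  assumes M: "levy_spectral_measure M" and R: "linear R"
  shows "(\<lambda>n. levy_exponent a R M (real (Suc n) *\<^sub>R y) / of_real ((real (Suc n))\<^sup>2)) \<longlonglongrightarrow> - of_real (y \<bullet> R y) / 2"
proof -
  let ?s = "\<lambda>n. real (Suc n)"
  have inv: "(\<lambda>n. 1 / ?s n) \<longlonglongrightarrow> 0" "(\<lambda>n. 1 / (?s n)\<^sup>2) \<longlonglongrightarrow> 0"
    by real_asymp+
  have bound: "cmod (levy_integrand (?s n *\<^sub>R y) x / of_real ((?s n)\<^sup>2)) \<le> (2 + (norm y)\<^sup>2) * min 1 ((norm x)\<^sup>2)"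
    for n x
  proof -
    have s: "1 \<le> (?s n)\<^sup>2" by (simp add: one_le_power)
    have "cmod (levy_integrand (?s n *\<^sub>R y) x / of_real ((?s n)\<^sup>2)) \<le>
        (2 + (norm (?s n *\<^sub>R y))\<^sup>2) * min 1 ((norm x)\<^sup>2) / (?s n)\<^sup>2"
      using norm_levy_integrand_le[of "?s n *\<^sub>R y" x] s
      by (simp only: norm_divide norm_of_real) (simp add: divide_right_mono)
    also have "\<dots> = (2 / (?s n)\<^sup>2 + (norm y)\<^sup>2) * min 1 ((norm x)\<^sup>2)"
      by (simp add: power_mult_distrib field_simps del: of_nat_Suc)
    also have "\<dots> \<le> (2 + (norm y)\<^sup>2) * min 1 ((norm x)\<^sup>2)"
      using s by (intro mult_right_mono add_right_mono) (auto simp: divide_simps)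
    finally show ?thesis .
  qed
  have "(\<lambda>n. CLINT x|M. levy_integrand (?s n *\<^sub>R y) x / of_real ((?s n)\<^sup>2)) \<longlonglongrightarrow> (CLINT x|M. 0)"
  proof (rule integral_dominated_convergence)
    show "integrable M (\<lambda>x. (2 + (norm y)\<^sup>2) * min 1 ((norm x)\<^sup>2))"
      using integrable_min_levy_spectral_measure[OF M] by simp
    show "AE x in M. (\<lambda>n. levy_integrand (?s n *\<^sub>R y) x / of_real ((?s n)\<^sup>2)) \<longlonglongrightarrow> 0"
    proof (intro AE_I2)
      fix x
      have "(\<lambda>n. 2 * (1 / (?s n)\<^sup>2) + \<bar>y \<bullet> x\<bar> * (1 / ?s n)) \<longlonglongrightarrow> 2 * 0 + \<bar>y \<bullet> x\<bar> * 0"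
        by (intro tendsto_intros inv)
      then have lim: "(\<lambda>n. 2 * (1 / (?s n)\<^sup>2) + \<bar>y \<bullet> x\<bar> * (1 / ?s n)) \<longlonglongrightarrow> 0"
        unfolding mult_zero_right add_0_right .
      have bd: "cmod (levy_integrand (?s n *\<^sub>R y) x / of_real ((?s n)\<^sup>2)) \<le>
          2 * (1 / (?s n)\<^sup>2) + \<bar>y \<bullet> x\<bar> * (1 / ?s n)" for n
      proof -
        have "cmod (levy_integrand (?s n *\<^sub>R y) x) \<le> cmod (iexp ((?s n *\<^sub>R y) \<bullet> x) - 1) +
            cmod (\<i> * of_real ((?s n *\<^sub>R y) \<bullet> x) * indicator (cball 0 1) x)"
          unfolding levy_integrand_def by (rule norm_triangle_ineq4)
        also have "\<dots> \<le> 2 + ?s n * \<bar>y \<bullet> x\<bar>"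
          using norm_triangle_ineq4[of "iexp ((?s n *\<^sub>R y) \<bullet> x)" 1]
          by (intro add_mono) (simp_all add: norm_mult indicator_def abs_mult del: of_nat_Suc)
        finally have "cmod (levy_integrand (?s n *\<^sub>R y) x) / (?s n)\<^sup>2 \<le> (2 + ?s n * \<bar>y \<bullet> x\<bar>) / (?s n)\<^sup>2"
          by (rule divide_right_mono) simp
        also have "\<dots> = 2 * (1 / (?s n)\<^sup>2) + \<bar>y \<bullet> x\<bar> * (1 / ?s n)"
          by (simp add: power2_eq_square add_divide_distrib)
        finally show ?thesis by (simp only: norm_divide norm_of_real abs_power2 abs_of_nonneg zero_le_power2)
      qed
      show "(\<lambda>n. levy_integrand (?s n *\<^sub>R y) x / of_real ((?s n)\<^sup>2)) \<longlonglongrightarrow> 0"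
        by (rule Lim_null_comparison[OF always_eventually[OF allI[OF bd]] lim])
    qed
    show "AE x in M. cmod (levy_integrand (?s n *\<^sub>R y) x / of_real ((?s n)\<^sup>2)) \<le> (2 + (norm y)\<^sup>2) * min 1 ((norm x)\<^sup>2)" for n
      using bound by (intro AE_I2)
  qed (intro measurable_levy_spectral_measure[OF M], measurable)+
  then have lim2: "(\<lambda>n. CLINT x|M. levy_integrand (?s n *\<^sub>R y) x / of_real ((?s n)\<^sup>2)) \<longlonglongrightarrow> 0"
    by simp
  have lim1: "(\<lambda>n. \<i> * of_real (y \<bullet> a) * of_real (1 / ?s n)) \<longlonglongrightarrow> \<i> * of_real (y \<bullet> a) * of_real 0"
    by (intro tendsto_intros inv)
  have eqn: "levy_exponent a R M (?s n *\<^sub>R y) / of_real ((?s n)\<^sup>2) =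
      \<i> * of_real (y \<bullet> a) * of_real (1 / ?s n) + - of_real (y \<bullet> R y) / 2 +
      (CLINT x|M. levy_integrand (?s n *\<^sub>R y) x / of_real ((?s n)\<^sup>2))" for n
  proof -
    have "of_real (?s n) \<noteq> (0::complex)" by (simp only: of_real_eq_0_iff)
    then show ?thesis
      unfolding levy_exponent_alt integral_divide_zero linear_scale[OF R] inner_scaleR_left inner_scaleR_right
      by (simp add: field_simps power2_eq_square del: of_nat_Suc)
  qed
  have "(\<lambda>n. levy_exponent a R M (?s n *\<^sub>R y) / of_real ((?s n)\<^sup>2)) \<longlonglongrightarrow>
      \<i> * of_real (y \<bullet> a) * of_real 0 + - of_real (y \<bullet> R y) / 2 + 0"
    unfolding eqn by (intro tendsto_add tendsto_const lim1 lim2)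
  then show ?thesis by simp
qed

lemma covariance_operator_eqI:
  assumes "covariance_operator R" "covariance_operator S" "\<And>y. y \<bullet> R y = y \<bullet> S y"
  shows "R = S"
proof -
  interpret R: linear R using assms by (simp add: covariance_operator_def)
  interpret S: linear S using assms by (simp add: covariance_operator_def)
  have sym: "x \<bullet> R y = y \<bullet> R x" if "covariance_operator R" for x y and R :: "'a \<Rightarrow> 'a"
  proof -
    have "x \<bullet> R y = R x \<bullet> y" using that unfolding covariance_operator_def by simp
    also have "\<dots> = y \<bullet> R x" by (rule inner_commute)
    finally show ?thesis .
  qed
  have "x \<bullet> R y = x \<bullet> S y" for x y
    using assms(3)[of "x + y"] assms(3)[of x] assms(3)[of y] sym[OF assms(1), of y x] sym[OF assms(2), of y x]
    by (simp add: R.add S.add inner_add_left inner_add_right)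
  then have "R y = S y" for y
    using vector_eq_ldot by blast
  then show ?thesis by blast
qed

text \<open>
  The hypothesis says that the finite measures \<open>(1 - cos (z \<bullet> x)) M(dx)\<close> have the same characteristic
  functions, hence agree for each \<open>z\<close>. A finite sum over suitable \<open>z\<close> has a density with respect to
  \<open>M\<close> that is strictly positive off the origin, and dividing by it recovers \<open>M\<close>.
\<close>

lemma levy_measure_eqI:
  fixes M N :: "'a::euclidean_space measure"
  assumes M: "levy_spectral_measure M" and N: "levy_spectral_measure N"
    and eq: "\<And>y z. (CLINT x|M. (1 - cos (z \<bullet> x)) *\<^sub>R iexp (y \<bullet> x)) = (CLINT x|N. (1 - cos (z \<bullet> x)) *\<^sub>R iexp (y \<bullet> x))"
  shows "M = N"
proof -
  define p where "p = (\<lambda>z x :: 'a. 1 - cos (z \<bullet> x))"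
  have p0: "0 \<le> p z x" for z x by (simp add: p_def)
  have [measurable]: "p z \<in> borel_measurable borel" for z unfolding p_def by measurable
  have pb: "norm (p z x) \<le> (2 + (norm z)\<^sup>2) * min 1 ((norm x)\<^sup>2)" for z x
  proof -
    have "p z x = - Re (levy_integrand z x)"
      by (simp add: p_def levy_integrand_def Re_exp indicator_def)
    then have "norm (p z x) \<le> cmod (levy_integrand z x)"
      using abs_Re_le_cmod[of "levy_integrand z x"] by simp
    also note norm_levy_integrand_le
    finally show ?thesis .
  qed
  define Q where "Q = (\<lambda>P z. distr (density P (\<lambda>x. ennreal (p z x))) borel (\<lambda>x::'a. x))"
  have Q: "finite_measure (Q P z)" "char_fun (Q P z) y = (CLINT x|P. p z x *\<^sub>R iexp (y \<bullet> x))"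
    "\<And>A. A \<in> sets P \<Longrightarrow> emeasure (Q P z) A = (\<integral>\<^sup>+x. ennreal (p z x) * indicator A x \<partial>P)"
    if P: "levy_spectral_measure P" for P z y
  proof -
    note [measurable (raw)] = measurable_levy_spectral_measure[OF P]
    have [measurable]: "(\<lambda>x. x) \<in> borel_measurable P" by (rule measurable_levy_spectral_measure[OF P]) simp
    have i: "integrable P (p z)"
      by (rule integrable_dominated_levy[OF P _ pb]) simp
    have "finite_measure (density P (p z))"
      using i p0 by (intro finite_measureI) (simp add: emeasure_density nn_integral_eq_integral)
    then show "finite_measure (Q P z)"
      unfolding Q_def by (intro finite_measure.finite_measure_distr) auto
    show "char_fun (Q P z) y = (CLINT x|P. p z x *\<^sub>R iexp (y \<bullet> x))"
      unfolding Q_def char_fun_def using p0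
      by (subst integral_distr) (auto simp: integral_density)
    fix A assume A: "A \<in> sets P"
    then have A': "A \<in> sets borel" "A \<inter> space P = A"
      using sets.sets_into_space[OF A]
      by (auto simp: sets_levy_spectral_measure[OF P] sets_restrict_space_iff)
    then show "emeasure (Q P z) A = (\<integral>\<^sup>+x. ennreal (p z x) * indicator A x \<partial>P)"
      unfolding Q_def using A by (simp add: emeasure_distr emeasure_density)
  qed
  have QQ: "Q M z = Q N z" for z
    by (rule char_fun_unique) (use Q(1)[OF M] Q(1)[OF N] Q(2)[OF M] Q(2)[OF N] eq in \<open>auto simp: p_def Q_def\<close>)
  have sets_eq: "sets M = sets N"
    using M N by (simp add: levy_spectral_measure_def)
  obtain r :: real where r: "r \<notin> \<rat>"
    using countable_rat uncountable_UNIV_real by (metis UNIV_eq_I)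
  \<comment> \<open>As \<open>r\<close> is irrational, \<open>cos t\<close> and \<open>cos (r * t)\<close> are both 1 for \<open>t = 0\<close> only.\<close>
  define W where "W = (\<lambda>x :: 'a. \<Sum>z\<in>Basis \<union> (\<lambda>b. r *\<^sub>R b) ` Basis. p z x)"
  have W0: "0 \<le> W x" for x by (simp add: W_def p0 sum_nonneg)
  have Wpos: "0 < W x" if "x \<noteq> 0" for x
  proof (rule ccontr)
    assume "\<not> 0 < W x"
    then have "W x = 0" using W0[of x] by simp
    then have 0: "p z x = 0" if "z \<in> Basis \<union> (\<lambda>b. r *\<^sub>R b) ` Basis" for z
      using that unfolding W_def by (subst (asm) sum_nonneg_eq_0_iff) (auto simp: p0)
    have "b \<bullet> x = 0" if b: "b \<in> Basis" for b
    proof (rule ccontr)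
      assume nz: "b \<bullet> x \<noteq> 0"
      have "cos (b \<bullet> x) = 1" "cos (r * (b \<bullet> x)) = 1"
        using 0[of b] 0[of "r *\<^sub>R b"] b by (auto simp: p_def)
      then obtain m n :: int where "b \<bullet> x = real_of_int m * 2 * pi" "r * (b \<bullet> x) = real_of_int n * 2 * pi"
        by (auto simp: cos_one_2pi_int)
      then have "r = real_of_int n / real_of_int m"
        using nz by (auto simp: field_simps)
      then show False using r by simp
    qed
    then have "x \<bullet> b = 0 \<bullet> b" if "b \<in> Basis" for b
      using that by (subst inner_commute) simp
    then have "x = 0" by (rule euclidean_eqI)
    with that show False by simp
  qed
  have [measurable]: "W \<in> borel_measurable borel" unfolding W_def by measurable
  have dens: "density M (\<lambda>x. ennreal (W x)) = density N (\<lambda>x. ennreal (W x))"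
  proof (rule measure_eqI)
    fix A assume "A \<in> sets (density M (\<lambda>x. ennreal (W x)))"
    then have A: "A \<in> sets M" "A \<in> sets N" using sets_eq by auto
    have "emeasure (density P (\<lambda>x. ennreal (W x))) A =
        (\<Sum>z\<in>Basis \<union> (\<lambda>b. r *\<^sub>R b) ` Basis. emeasure (Q P z) A)"
      if P: "levy_spectral_measure P" and AP: "A \<in> sets P" for P
    proof -
      note [measurable (raw)] = measurable_levy_spectral_measure[OF P]
      have "emeasure (density P (\<lambda>x. ennreal (W x))) A =
          (\<integral>\<^sup>+x. (\<Sum>z\<in>Basis \<union> (\<lambda>b. r *\<^sub>R b) ` Basis. ennreal (p z x) * indicator A x) \<partial>P)"
        using AP by (simp add: emeasure_density W_def p0 flip: sum_ennreal sum_distrib_right)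
      also have "\<dots> = (\<Sum>z\<in>Basis \<union> (\<lambda>b. r *\<^sub>R b) ` Basis. \<integral>\<^sup>+x. ennreal (p z x) * indicator A x \<partial>P)"
        using AP by (intro nn_integral_sum) simp
      also have "\<dots> = (\<Sum>z\<in>Basis \<union> (\<lambda>b. r *\<^sub>R b) ` Basis. emeasure (Q P z) A)"
        by (intro sum.cong refl Q(3)[symmetric] P AP)
      finally show ?thesis .
    qed
    then show "emeasure (density M (\<lambda>x. ennreal (W x))) A = emeasure (density N (\<lambda>x. ennreal (W x))) A"
      using A M N QQ by simp
  qed (simp add: sets_eq)
  have "density (density P (\<lambda>x. ennreal (W x))) (\<lambda>x. ennreal (1 / W x)) = P"
    if P: "levy_spectral_measure P" for P
  proof -
    note [measurable (raw)] = measurable_levy_spectral_measure[OF P]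
    have "density (density P (\<lambda>x. ennreal (W x))) (\<lambda>x. ennreal (1 / W x)) =
        density P (\<lambda>x. ennreal (W x) * ennreal (1 / W x))"
      by (intro density_density_eq) auto
    also have "\<dots> = density P (\<lambda>_. 1)"
      by (intro density_cong measurable_levy_spectral_measure[OF P] AE_I2)
        (auto simp: space_levy_spectral_measure[OF P] W0 less_imp_neq[OF Wpos, symmetric] simp flip: ennreal_mult)
    finally show ?thesis by (simp add: density_1)
  qed
  then show ?thesis using M N dens by metis
qed

text \<open>
  The second difference \<open>2 \<Phi> y - \<Phi> (y + z) - \<Phi> (y - z)\<close> annihilates the linear terms of the exponent,
  compensator included. What remains of the jump part is, as a function of \<open>y\<close>, the characteristic
  function of a multiple of \<open>(1 - cos (z \<bullet> x)) M(dx)\<close>. This gives the spectral measure once the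
  Gaussian part is known, and then only the shift is left.
\<close>

lemma has_triple_unique:
  assumes t1: "has_triple \<mu> a R M" and t2: "has_triple \<mu> b S N"
  shows "a = b" "R = S" "M = N"
proof -
  have R: "linear R" "covariance_operator R" and S: "linear S" "covariance_operator S"
    and M: "levy_spectral_measure M" and N: "levy_spectral_measure N"
    using t1 t2 by (auto simp: has_triple_def covariance_operator_def)
  have eq: "levy_exponent a R M = levy_exponent b S N"
    using t1 t2 by (intro continuous_log_unique continuous_on_levy_exponent M N R S)
      (auto simp: has_triple_def)
  have "- complex_of_real (y \<bullet> R y) / 2 = - of_real (y \<bullet> S y) / 2" for y
    by (rule LIMSEQ_unique[OF levy_exponent_scaled_limit[OF M R(1), of a y, unfolded eq]
          levy_exponent_scaled_limit[OF N S(1)]])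
  then have "y \<bullet> R y = y \<bullet> S y" for y by simp
  then show RS: "R = S" by (intro covariance_operator_eqI R S)
  have sd: "2 * levy_exponent c R P y - levy_exponent c R P (y + z) - levy_exponent c R P (y - z) =
      of_real (z \<bullet> R z) + 2 * (CLINT x|P. (1 - cos (z \<bullet> x)) *\<^sub>R iexp (y \<bullet> x))"
    if P: "levy_spectral_measure P" for c P y z
  proof -
    define I where "I = (CLINT x|P. (1 - cos (z \<bullet> x)) *\<^sub>R iexp (y \<bullet> x))"
    have e: "iexp ((y + z) \<bullet> x) = iexp (y \<bullet> x) * iexp (z \<bullet> x)"
      "iexp ((y - z) \<bullet> x) = iexp (y \<bullet> x) * iexp (- (z \<bullet> x))"
      "complex_of_real (cos (z \<bullet> x)) = (iexp (z \<bullet> x) + iexp (- (z \<bullet> x))) / 2" for x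
      by (simp_all add: inner_add_left inner_diff_left distrib_left right_diff_distrib cos_exp_eq
          cos_of_real[symmetric] flip: exp_add del: cos_of_real)
    have "(CLINT x|P. 2 * ((1 - cos (z \<bullet> x)) *\<^sub>R iexp (y \<bullet> x))) =
        (CLINT x|P. 2 * levy_integrand y x - levy_integrand (y + z) x - levy_integrand (y - z) x)"
      by (intro Bochner_Integration.integral_cong refl)
        (simp only: levy_integrand_def e scaleR_conv_of_real of_real_diff of_real_1, simp add: inner_add_left
          inner_diff_left algebra_simps)
    also have "\<dots> = 2 * (CLINT x|P. levy_integrand y x) - (CLINT x|P. levy_integrand (y + z) x) -
        (CLINT x|P. levy_integrand (y - z) x)"
      using integrable_levy_integrand[OF P] by simp
    also have "(CLINT x|P. 2 * ((1 - cos (z \<bullet> x)) *\<^sub>R iexp (y \<bullet> x))) = 2 * I"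
      unfolding I_def by (rule integral_mult_right_zero)
    finally show ?thesis
      unfolding I_def[symmetric]
      by (simp add: levy_exponent_alt linear_add[OF R(1)] linear_diff[OF R(1)] inner_add_left
          inner_add_right inner_diff_left inner_diff_right algebra_simps add_divide_distrib diff_divide_distrib)
  qed
  show MN: "M = N"
  proof (rule levy_measure_eqI[OF M N])
    fix y z
    show "(CLINT x|M. (1 - cos (z \<bullet> x)) *\<^sub>R iexp (y \<bullet> x)) = (CLINT x|N. (1 - cos (z \<bullet> x)) *\<^sub>R iexp (y \<bullet> x))"
      using sd[OF M, of a y z] sd[OF N, of b y z] eq RS by simp
  qed
  have "y \<bullet> a = y \<bullet> b" for y
    using fun_cong[OF eq, of y] unfolding levy_exponent_alt RS MN by simp
  then show "a = b" using vector_eq_ldot by blast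
qed

section \<open>Random integrals with respect to L\'evy processes\<close>

text \<open>
  One-sided limits bound the path near each point, and compactness of the interval does the rest. This
  is what makes the integrand of the pathwise integral integrable.
\<close>

lemma cadlag_bounded:
  fixes y :: "real \<Rightarrow> 'a::real_normed_vector"
  assumes right: "\<And>t. 0 \<le> t \<Longrightarrow> continuous (at_right t) y"
    and left: "\<And>t. 0 < t \<Longrightarrow> \<exists>l. (y \<longlongrightarrow> l) (at_left t)"
  shows "bounded (y ` {0..c})"
proof -
  have loc: "\<exists>U. open U \<and> t \<in> U \<and> bounded (y ` (U \<inter> {0..c}))" if t: "t \<in> {0..c}" for t
  proof -
    have "(y \<longlongrightarrow> y t) (at_right t)"
      using right t by (simp add: continuous_within)
    then have "\<forall>\<^sub>F s in at_right t. dist (y s) (y t) < 1"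
      by (rule tendstoD) simp
    then obtain v where v: "v > t" "\<And>s. t < s \<Longrightarrow> s < v \<Longrightarrow> dist (y s) (y t) < 1"
      unfolding eventually_at_right_field by blast
    obtain u l where u: "u < t" "\<And>s. 0 \<le> s \<Longrightarrow> u < s \<Longrightarrow> s < t \<Longrightarrow> dist (y s) l < 1"
    proof (cases "t = 0")
      case True
      then show ?thesis using that[of "-1"] by force
    next
      case False
      then have "0 < t" using t by simp
      from left[OF this] obtain l where "(y \<longlongrightarrow> l) (at_left t)" ..
      then have "\<forall>\<^sub>F s in at_left t. dist (y s) l < 1"
        by (rule tendstoD) simp
      then show ?thesis
        using that unfolding eventually_at_left_field by blast
    qed
    have "y ` ({u<..<v} \<inter> {0..c}) \<subseteq> ball l 1 \<union> {y t} \<union> ball (y t) 1"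
    proof (intro image_subsetI)
      fix s assume "s \<in> {u<..<v} \<inter> {0..c}"
      then show "y s \<in> ball l 1 \<union> {y t} \<union> ball (y t) 1"
        using u(2)[of s] v(2)[of s] by (cases s t rule: linorder_cases) (auto simp: dist_commute)
    qed
    then have "bounded (y ` ({u<..<v} \<inter> {0..c}))"
      by (rule bounded_subset[rotated]) simp
    then show ?thesis
      using u(1) v(1) by (intro exI[of _ "{u<..<v}"]) auto
  qed
  then obtain U where U: "\<And>t. t \<in> {0..c} \<Longrightarrow> open (U t)" "\<And>t. t \<in> {0..c} \<Longrightarrow> t \<in> U t"
    "\<And>t. t \<in> {0..c} \<Longrightarrow> bounded (y ` (U t \<inter> {0..c}))"
    by metis
  obtain D where D: "D \<subseteq> {0..c}" "finite D" "{0..c} \<subseteq> (\<Union>t\<in>D. U t)"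
    using compactE_image[of "{0..c}" "{0..c}" U] U by (metis UN_I compact_Icc subsetI)
  have "y ` {0..c} \<subseteq> (\<Union>t\<in>D. y ` (U t \<inter> {0..c}))"
    using D(3) by blast
  moreover have "bounded (\<Union>t\<in>D. y ` (U t \<inter> {0..c}))"
    by (rule bounded_UN[OF D(2)]) (use D(1) U(3) in blast)
  ultimately show ?thesis by (rule bounded_subset[rotated])
qed

text \<open>
  The sums are integrals of the step functions that take at \<open>t\<close> the value of \<open>f\<close> at the right end
  \<open>c n t\<close> of the cell of \<open>t\<close>. As \<open>c n t\<close> approaches \<open>t\<close> from the right, right continuity suffices for
  pointwise convergence. The lemma serves twice: for the pathwise integrals, and with \<open>F t = t\<close> for
  the exponents.
\<close>

lemma right_sums_tendsto:
  fixes f :: "real \<Rightarrow> 'b::euclidean_space"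
  assumes F_mono: "\<And>x y. x \<le> y \<Longrightarrow> F x \<le> F y" and F_cont: "\<And>t. continuous (at_right t) F"
    and f_right: "\<And>t. 0 < t \<Longrightarrow> t \<le> 1 \<Longrightarrow> continuous (at_right t) f" and f_bounded: "bounded (f ` {0..1})"
  shows "(\<lambda>n. \<Sum>i<Suc n. (F (real (Suc i) / real (Suc n)) - F (real i / real (Suc n))) *\<^sub>R f (real (Suc i) / real (Suc n)))
    \<longlonglongrightarrow> (LINT t:{0<..1}|interval_measure F. f t)"
proof -
  let ?p = "\<lambda>n i. real i / real (Suc n)"
  let ?I = "\<lambda>n i. {?p n i<..?p n (Suc i)}"
  define S where "S = (\<lambda>n t. \<Sum>i<Suc n. indicator (?I n i) t *\<^sub>R f (?p n (Suc i)))"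
  obtain B where "\<forall>x\<in>f ` {0..1}. norm x \<le> B"
    using f_bounded unfolding bounded_iff by blast
  then have B: "norm (f t) \<le> B" if "0 \<le> t" "t \<le> 1" for t
    using that by auto
  define c where "c = (\<lambda>n t. real_of_int \<lceil>t * real (Suc n)\<rceil> / real (Suc n))"
  have S_in: "S n t = f (c n t)" "0 \<le> c n t" "c n t \<le> 1" "t \<le> c n t" "c n t \<le> t + 1 / real (Suc n)"
    if t: "0 < t" "t \<le> 1" for n t
  proof -
    define k where "k = nat (\<lceil>t * real (Suc n)\<rceil> - 1)"
    have pos: "0 < t * real (Suc n)" using t by simp
    then have ceil1: "1 \<le> \<lceil>t * real (Suc n)\<rceil>" by linarith
    have "t * real (Suc n) \<le> 1 * real (Suc n)" using t by (intro mult_right_mono) auto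
    then have le: "\<lceil>t * real (Suc n)\<rceil> \<le> int (Suc n)" by (simp add: ceiling_le_iff)
    have k: "k < Suc n" "real (Suc k) = real_of_int \<lceil>t * real (Suc n)\<rceil>"
      using ceil1 le unfolding k_def by linarith+
    \<comment> \<open>The cells \<open>(i/(n+1), (i+1)/(n+1)]\<close> partition \<open>(0,1]\<close>; the cell of \<open>t\<close> is found by rounding up.\<close>
    have iff: "t \<in> ?I n i \<longleftrightarrow> i = k" for i
    proof -
      have "t \<in> ?I n i \<longleftrightarrow> real i < t * real (Suc n) \<and> t * real (Suc n) \<le> real (Suc i)"
        by (simp add: pos_divide_less_eq pos_le_divide_eq del: of_nat_Suc)
      also have "\<dots> \<longleftrightarrow> \<lceil>t * real (Suc n)\<rceil> = int (Suc i)"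
        by (auto simp: ceiling_eq_iff)
      also have "\<dots> \<longleftrightarrow> i = k" using ceil1 unfolding k_def by linarith
      finally show ?thesis .
    qed
    have "S n t = (\<Sum>i<Suc n. if i = k then f (?p n (Suc i)) else 0)"
      unfolding S_def by (intro sum.cong refl) (simp add: indicator_def iff del: greaterThanAtMost_iff of_nat_Suc)
    also have "\<dots> = f (c n t)"
      using k by (simp add: c_def del: of_nat_Suc sum.lessThan_Suc)
    finally show "S n t = f (c n t)" .
    show "0 \<le> c n t" using ceil1 by (simp add: c_def)
    show "c n t \<le> 1" using le unfolding c_def by (simp add: divide_le_eq_1)
    show "t \<le> c n t" unfolding c_def by (simp add: pos_le_divide_eq del: of_nat_Suc)
    have "real_of_int \<lceil>t * real (Suc n)\<rceil> \<le> t * real (Suc n) + 1" by linarith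
    then have "c n t \<le> (t * real (Suc n) + 1) / real (Suc n)"
      unfolding c_def by (intro divide_right_mono) auto
    then show "c n t \<le> t + 1 / real (Suc n)"
      by (simp add: add_divide_distrib del: of_nat_Suc)
  qed
  have S_out: "S n t = 0" if "\<not> (0 < t \<and> t \<le> 1)" for n t
  proof -
    have "t \<notin> ?I n i" if "i < Suc n" for i
    proof -
      have "?p n (Suc i) \<le> 1" "0 \<le> ?p n i" using that by (simp_all add: divide_le_eq_1)
      then have "0 < t \<and> t \<le> 1" if "?p n i < t" "t \<le> ?p n (Suc i)"
        using that by linarith
      then show ?thesis using \<open>\<not> (0 < t \<and> t \<le> 1)\<close> unfolding greaterThanAtMost_iff by blast
    qed
    then show ?thesis unfolding S_def by (intro sum.neutral) (simp add: indicator_def del: of_nat_Suc)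
  qed
  have lim: "(\<lambda>n. S n t) \<longlonglongrightarrow> indicator {0<..1} t *\<^sub>R f t" for t
  proof (cases "0 < t \<and> t \<le> 1")
    case True
    have "(\<lambda>n. t + 1 / real (Suc n)) \<longlonglongrightarrow> t + 0"
      by (intro tendsto_intros LIMSEQ_Suc[OF lim_1_over_n])
    then have ub: "(\<lambda>n. t + 1 / real (Suc n)) \<longlonglongrightarrow> t"
      unfolding add_0_right .
    have c_lim: "(\<lambda>n. c n t) \<longlonglongrightarrow> t"
      by (rule tendsto_sandwich[OF always_eventually always_eventually tendsto_const ub])
        (use True S_in(4,5) in blast)+
    have cont: "continuous (at t within {t..t + 1}) f"
      using f_right[of t] True by (simp add: at_within_Icc_at_right)
    have c_in: "c n t \<in> {t..t + 1}" for n
      using S_in(4,5)[of t n] True by (auto intro: order_trans)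
    have "(\<lambda>n. f (c n t)) \<longlonglongrightarrow> f t"
      using cont[unfolded continuous_within_sequentially comp_def, rule_format, of "\<lambda>n. c n t"] c_lim c_in
      by blast
    then show ?thesis using True S_in(1)[of t] by simp
  qed (auto simp: S_out)
  have S_meas [measurable]: "S n \<in> borel_measurable (interval_measure F)" for n
    unfolding S_def by measurable
  have "(\<lambda>n. LINT t|interval_measure F. S n t) \<longlonglongrightarrow> (LINT t|interval_measure F. indicator {0<..1} t *\<^sub>R f t)"
  proof (rule integral_dominated_convergence)
    show "(\<lambda>t. indicator {0<..1} t *\<^sub>R f t) \<in> borel_measurable (interval_measure F)"
      by (rule borel_measurable_LIMSEQ_metric[OF S_meas]) (rule lim)
    show "integrable (interval_measure F) (\<lambda>t. B * indicator {0<..1} t)"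
      by (intro integrable_mult_right integrable_real_indicator)
        (simp_all add: emeasure_interval_measure_Ioc[OF _ F_mono F_cont])
    show "AE t in interval_measure F. norm (S n t) \<le> B * indicator {0<..1} t" for n
    proof (intro AE_I2)
      fix t
      show "norm (S n t) \<le> B * indicator {0<..1} t"
        using B[of "c n t"] S_in(1,2,3)[of t n] S_out[of t n] by (cases "0 < t \<and> t \<le> 1") auto
    qed
  qed (simp_all add: lim)
  moreover have "(LINT t|interval_measure F. S n t) =
     (\<Sum>i<Suc n. (F (?p n (Suc i)) - F (?p n i)) *\<^sub>R f (?p n (Suc i)))" for n
  proof -
    have le: "?p n i \<le> ?p n (Suc i)" for i by (simp add: divide_right_mono)
    have fin: "emeasure (interval_measure F) (?I n i) < \<infinity>" for i
      by (subst emeasure_interval_measure_Ioc[OF le F_mono F_cont]) simp_all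
    have "(LINT t|interval_measure F. S n t) =
        (\<Sum>i<Suc n. LINT t|interval_measure F. indicator (?I n i) t *\<^sub>R f (?p n (Suc i)))"
      unfolding S_def by (intro Bochner_Integration.integral_sum integrable_scaleR_left
          integrable_real_indicator fin) simp_all
    also have "\<dots> = (\<Sum>i<Suc n. measure (interval_measure F) (?I n i) *\<^sub>R f (?p n (Suc i)))"
      using fin by (intro sum.cong refl) (simp del: of_nat_Suc)
    also have "\<dots> = (\<Sum>i<Suc n. (F (?p n (Suc i)) - F (?p n i)) *\<^sub>R f (?p n (Suc i)))"
      by (intro sum.cong refl) (simp only: measure_interval_measure_Ioc[OF le F_mono F_cont])
    finally show ?thesis .
  qed
  ultimately show ?thesis by (simp only: set_lebesgue_integral_def)
qed

lemma abel_summation: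
  fixes h :: "nat \<Rightarrow> real" and y :: "nat \<Rightarrow> 'a::real_vector"
  shows "(\<Sum>i<n. h i *\<^sub>R (y (Suc i) - y i)) = h n *\<^sub>R y n - h 0 *\<^sub>R y 0 - (\<Sum>i<n. (h (Suc i) - h i) *\<^sub>R y (Suc i))"
  by (induction n) (simp_all add: algebra_simps)

text \<open>
  Formal integration by parts is the limit of summation by parts. The integrand \<open>h\<close> is evaluated at
  left end points here, which makes the sums linear in the increments of the path.
\<close>

lemma path_integral_riemann_sums:
  fixes y :: "real \<Rightarrow> 'a::euclidean_space"
  assumes h_mono: "\<And>s t. 0 \<le> s \<Longrightarrow> s \<le> t \<Longrightarrow> t \<le> 1 \<Longrightarrow> h s \<le> h t" and h_cont: "continuous_on {0..1} h"
    and right: "\<And>t. 0 \<le> t \<Longrightarrow> continuous (at_right t) y"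
    and left: "\<And>t. 0 < t \<Longrightarrow> \<exists>l. (y \<longlongrightarrow> l) (at_left t)"
  shows "(\<lambda>n. \<Sum>i<Suc n. h (real i / real (Suc n)) *\<^sub>R (y (real (Suc i) / real (Suc n)) - y (real i / real (Suc n))))
    \<longlonglongrightarrow> path_integral 0 1 h y (\<lambda>t. t)"
proof -
  let ?F = "\<lambda>t. h (max 0 (min 1 t))"
  have F_cont: "continuous_on UNIV ?F"
    by (rule continuous_on_compose2[OF h_cont]) (auto intro!: continuous_intros)
  have F_right: "continuous (at_right t) ?F" for t
    using F_cont by (auto simp: continuous_on_eq_continuous_at intro: continuous_at_imp_continuous_within)
  have "(\<lambda>n. \<Sum>i<Suc n. (?F (real (Suc i) / real (Suc n)) - ?F (real i / real (Suc n))) *\<^sub>R y (real (Suc i) / real (Suc n)))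
    \<longlonglongrightarrow> (LINT t:{0<..1}|interval_measure ?F. y t)"
    by (rule right_sums_tendsto) (use F_right right in \<open>auto intro!: h_mono cadlag_bounded left\<close>)
  then have "(\<lambda>n. h 1 *\<^sub>R y 1 - h 0 *\<^sub>R y 0 -
      (\<Sum>i<Suc n. (?F (real (Suc i) / real (Suc n)) - ?F (real i / real (Suc n))) *\<^sub>R y (real (Suc i) / real (Suc n))))
    \<longlonglongrightarrow> path_integral 0 1 h y (\<lambda>t. t)"
    unfolding path_integral_def by (intro tendsto_intros)
  moreover have "(\<Sum>i<Suc n. h (real i / real (Suc n)) *\<^sub>R (y (real (Suc i) / real (Suc n)) - y (real i / real (Suc n)))) =
      h 1 *\<^sub>R y 1 - h 0 *\<^sub>R y 0 -
      (\<Sum>i<Suc n. (?F (real (Suc i) / real (Suc n)) - ?F (real i / real (Suc n))) *\<^sub>R y (real (Suc i) / real (Suc n)))" for n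
  proof -
    have "?F (real i / real (Suc n)) = h (real i / real (Suc n))" if "i \<le> Suc n" for i
    proof -
      have "real i / real (Suc n) \<le> 1" using that by (simp add: divide_le_eq_1)
      then show ?thesis by (simp add: max_def min_def)
    qed
    then have "(\<Sum>i<Suc n. (?F (real (Suc i) / real (Suc n)) - ?F (real i / real (Suc n))) *\<^sub>R y (real (Suc i) / real (Suc n))) =
      (\<Sum>i<Suc n. (h (real (Suc i) / real (Suc n)) - h (real i / real (Suc n))) *\<^sub>R y (real (Suc i) / real (Suc n)))"
      by (intro sum.cong refl) (simp del: of_nat_Suc)
    then show ?thesis
      using abel_summation[of "\<lambda>i. h (real i / real (Suc n))" "\<lambda>i. y (real i / real (Suc n))" "Suc n"]
      by (simp del: sum.lessThan_Suc of_nat_Suc)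
  qed
  ultimately show ?thesis by (simp only:)
qed

lemma char_fun_distr:
  assumes "X \<in> borel_measurable \<Omega>"
  shows "char_fun (distr \<Omega> borel X) y = (CLINT w|\<Omega>. iexp (y \<bullet> X w))"
  unfolding char_fun_def using assms by (intro integral_distr) simp_all

lemma continuous_on_char_fun:
  assumes "finite_measure \<mu>" and sets: "sets \<mu> = sets borel"
  shows "continuous_on UNIV (char_fun \<mu>)"
  unfolding continuous_on_sequentially comp_def char_fun_def
proof (intro ballI allI impI, elim conjE)
  interpret finite_measure \<mu> by fact
  fix y and Y :: "nat \<Rightarrow> 'a" assume Y: "Y \<longlonglongrightarrow> y"
  show "(\<lambda>n. CLINT x|\<mu>. iexp (Y n \<bullet> x)) \<longlonglongrightarrow> (CLINT x|\<mu>. iexp (y \<bullet> x))"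
  proof (rule integral_dominated_convergence)
    show "AE x in \<mu>. (\<lambda>n. iexp (Y n \<bullet> x)) \<longlonglongrightarrow> iexp (y \<bullet> x)"
      by (intro AE_I2 tendsto_intros Y)
    show "integrable \<mu> (\<lambda>x. 1::real)" by simp
  qed (auto simp: measurable_cong_sets[OF sets refl])
qed

text \<open>
  The quotient of \<open>f\<close> and \<open>exp (\<Phi>/n)\<close> is continuous with values in the finite set of \<open>n\<close>-th
  roots of unity, hence constant.
\<close>

lemma continuous_root_of_exp:
  fixes f \<Phi> :: "'a::euclidean_space \<Rightarrow> complex"
  assumes "continuous_on UNIV f" "continuous_on UNIV \<Phi>" "f 0 = 1" "\<Phi> 0 = 0" "n > 0"
    and eq: "\<And>y. f y ^ n = exp (\<Phi> y)"
  shows "f y = exp (\<Phi> y / of_nat n)"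
proof -
  let ?g = "\<lambda>y. f y * exp (- \<Phi> y / of_nat n)"
  have "exp (- \<Phi> y / of_nat n) ^ n = exp (- \<Phi> y)" for y
    using \<open>n > 0\<close> by (simp flip: exp_of_nat_mult)
  then have "?g y ^ n = 1" for y
    by (simp only: power_mult_distrib eq) (simp flip: exp_add)
  then have "range ?g \<subseteq> {z. z ^ n = 1}" by auto
  then have "finite (range ?g)"
    using finite_roots_unity[of n] \<open>n > 0\<close> by (auto intro: finite_subset)
  then have "?g constant_on UNIV"
    using assms by (intro continuous_finite_range_constant) (auto intro!: continuous_intros)
  then have "?g y = ?g 0" by (auto simp: constant_on_def)
  then show ?thesis using assms by (simp add: exp_minus field_simps)
qed

lemma char_fun_convolution_power:
  assumes "prob_space \<rho>" and sets: "sets \<rho> = sets borel"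
  shows "char_fun (distr (\<Pi>\<^sub>M i\<in>{..<n::nat}. \<rho>) borel (\<lambda>x. \<Sum>i<n. x i)) y = char_fun \<rho> y ^ n"
proof -
  interpret prob_space \<rho> by fact
  interpret product_sigma_finite "\<lambda>_::nat. \<rho>" by unfold_locales
  note [measurable_cong] = sets
  have "char_fun (distr (\<Pi>\<^sub>M i\<in>{..<n::nat}. \<rho>) borel (\<lambda>x. \<Sum>i<n. x i)) y =
      (CLINT x|(\<Pi>\<^sub>M i\<in>{..<n}. \<rho>). (\<Prod>i<n. iexp (y \<bullet> x i)))"
    by (subst char_fun_distr) (measurable, simp_all add: inner_sum_right sum_distrib_left exp_sum)
  also have "\<dots> = (\<Prod>i<n. CLINT x|\<rho>. iexp (y \<bullet> x))"
    by (intro product_integral_prod) (auto intro!: integrable_const_bound[where B = 1])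
  finally show ?thesis by (simp add: char_fun_def)
qed

context
  fixes \<Omega> :: "'w measure" and Y :: "real \<Rightarrow> 'w \<Rightarrow> 'a::euclidean_space"
  assumes L: "levy_process \<Omega> Y"
begin

interpretation prob_space \<Omega>
  using L by (simp add: levy_process_def)

lemma levy_process_measurable: "0 \<le> t \<Longrightarrow> Y t \<in> borel_measurable \<Omega>"
  using L by (simp add: levy_process_def)

lemma levy_process_right_continuous:
  "w \<in> space \<Omega> \<Longrightarrow> 0 \<le> t \<Longrightarrow> continuous (at_right t) (\<lambda>s. Y s w)"
  using L by (simp add: levy_process_def)

lemma levy_process_left_limit:
  "w \<in> space \<Omega> \<Longrightarrow> 0 < t \<Longrightarrow> \<exists>l. ((\<lambda>s. Y s w) \<longlongrightarrow> l) (at_left t)"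
  using L by (simp add: levy_process_def)

lemma levy_process_increment_distr:
  "0 \<le> s \<Longrightarrow> 0 \<le> t \<Longrightarrow> distr \<Omega> borel (\<lambda>w. Y (s + t) w - Y s w) = distr \<Omega> borel (Y t)"
  using L by (simp add: levy_process_def)

lemma levy_process_increments_indep:
  assumes "0 \<le> t 0" "\<And>i. i < n \<Longrightarrow> t i \<le> t (Suc i)"
  shows "indep_vars (\<lambda>_. borel) (\<lambda>i w. Y (t (Suc i)) w - Y (t i) w) {..<n}"
proof -
  have "\<forall>n. \<forall>t :: nat \<Rightarrow> real. 0 \<le> t 0 \<and> (\<forall>i<n. t i \<le> t (Suc i)) \<longrightarrow>
      indep_vars (\<lambda>_. borel) (\<lambda>i w. Y (t (Suc i)) w - Y (t i) w) {..<n}"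
    using L unfolding levy_process_def by (elim conjE)
  from this[rule_format, of t n] show ?thesis using assms by blast
qed

text \<open>
  Slowing the process down by \<open>c = 1/N\<close> divides its exponent by \<open>N\<close>; this is the source of the
  convolution roots in \<open>rand_int_law_char\<close>.
\<close>

lemma levy_process_rescale:
  assumes "0 < c"
  shows "levy_process \<Omega> (\<lambda>t. Y (c * t))"
  unfolding levy_process_def
proof (intro conjI allI impI ballI)
  show "prob_space \<Omega>" by (rule prob_space_axioms)
  show "Y (c * t) \<in> borel_measurable \<Omega>" if "0 \<le> t" for t
    using that assms by (intro levy_process_measurable) simp
  show "Y (c * 0) w = 0" if "w \<in> space \<Omega>" for w
    using L that by (simp add: levy_process_def)
  show "distr \<Omega> borel (\<lambda>w. Y (c * (s + t)) w - Y (c * s) w) = distr \<Omega> borel (Y (c * t))"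
    if "0 \<le> s" "0 \<le> t" for s t
    using L that assms by (simp add: levy_process_def distrib_left)
  show "indep_vars (\<lambda>_. borel) (\<lambda>i w. Y (c * t (Suc i)) w - Y (c * t i) w) {..<n}"
    if "0 \<le> t 0 \<and> (\<forall>i<n. t i \<le> t (Suc i))" for n t
    using that assms by (intro levy_process_increments_indep[of "\<lambda>i. c * t i"]) auto
  fix w and t :: real assume w: "w \<in> space \<Omega>" and t: "0 \<le> t"
  have ct: "0 \<le> c * t" using assms t by simp
  have r: "filterlim (\<lambda>s. c * s) (at_right (c * t)) (at_right t)"
    using assms unfolding filterlim_at by (auto intro!: tendsto_intros simp: eventually_at_filter)
  have "((\<lambda>s. Y s w) \<longlongrightarrow> Y (c * t) w) (at_right (c * t))"
    using levy_process_right_continuous[OF w ct] by (simp add: continuous_within)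
  then show "continuous (at_right t) (\<lambda>s. Y (c * s) w)"
    unfolding continuous_within using r by (rule filterlim_compose)
  assume "0 < t"
  then have "0 < c * t" using assms by simp
  from levy_process_left_limit[OF w this] obtain l where l: "((\<lambda>s. Y s w) \<longlongrightarrow> l) (at_left (c * t))" ..
  have "filterlim (\<lambda>s. c * s) (at_left (c * t)) (at_left t)"
    using assms unfolding filterlim_at by (auto intro!: tendsto_intros simp: eventually_at_filter)
  from filterlim_compose[OF l this] show "\<exists>l. ((\<lambda>s. Y (c * s) w) \<longlongrightarrow> l) (at_left t)"
    by (rule exI)
qed

lemma char_levy_increments:
  "(CLINT w|\<Omega>. iexp (y \<bullet> (\<Sum>i<Suc n. h i *\<^sub>R (Y (real (Suc i) / real (Suc n)) w - Y (real i / real (Suc n)) w)))) =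
    (\<Prod>i<Suc n. char_fun (distr \<Omega> borel (Y (1 / real (Suc n)))) (h i *\<^sub>R y))"
proof -
  let ?t = "\<lambda>i. real i / real (Suc n)"
  let ?D = "\<lambda>i w. Y (?t (Suc i)) w - Y (?t i) w"
  have [measurable]: "Y (?t i) \<in> borel_measurable \<Omega>" for i
    by (rule levy_process_measurable) simp
  have "indep_vars (\<lambda>_. borel) ?D {..<Suc n}"
    by (rule levy_process_increments_indep) (simp_all add: divide_right_mono)
  then have ind: "indep_vars (\<lambda>_. borel) (\<lambda>i w. iexp (y \<bullet> (h i *\<^sub>R ?D i w))) {..<Suc n}"
    by (rule indep_vars_compose2[where Y = "\<lambda>i x. iexp (y \<bullet> (h i *\<^sub>R x))"]) simp
  have dist: "distr \<Omega> borel (?D i) = distr \<Omega> borel (Y (1 / real (Suc n)))" for i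
  proof -
    have "?t (Suc i) = ?t i + 1 / real (Suc n)" by (simp add: field_simps)
    moreover have "0 \<le> ?t i" "0 \<le> 1 / real (Suc n)" by simp_all
    ultimately show ?thesis by (simp only: levy_process_increment_distr)
  qed
  have "(CLINT w|\<Omega>. iexp (y \<bullet> (\<Sum>i<Suc n. h i *\<^sub>R ?D i w))) = (CLINT w|\<Omega>. (\<Prod>i<Suc n. iexp (y \<bullet> (h i *\<^sub>R ?D i w))))"
    by (simp only: inner_sum_right of_real_sum sum_distrib_left exp_sum finite_lessThan)
  also have "\<dots> = (\<Prod>i<Suc n. CLINT w|\<Omega>. iexp (y \<bullet> (h i *\<^sub>R ?D i w)))"
    by (rule indep_vars_lebesgue_integral[OF _ ind]) (auto intro!: integrable_const_bound[where B = 1] simp del: of_nat_Suc)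
  also have "\<dots> = (\<Prod>i<Suc n. char_fun (distr \<Omega> borel (?D i)) (h i *\<^sub>R y))"
    by (intro prod.cong refl, subst char_fun_distr) (simp_all del: of_nat_Suc)
  finally show ?thesis by (simp only: dist)
qed

lemma
  fixes h :: "real \<Rightarrow> real"
  assumes h_mono: "\<And>s t. 0 \<le> s \<Longrightarrow> s \<le> t \<Longrightarrow> t \<le> 1 \<Longrightarrow> h s \<le> h t" and h_cont: "continuous_on {0..1} h"
  defines "X \<equiv> (\<lambda>w. path_integral 0 1 h (\<lambda>t. Y t w) (\<lambda>t. t))"
  shows path_integral_levy_riemann_sums: "w \<in> space \<Omega> \<Longrightarrow>
      (\<lambda>n. \<Sum>i<Suc n. h (real i / real (Suc n)) *\<^sub>R
        (Y (real (Suc i) / real (Suc n)) w - Y (real i / real (Suc n)) w)) \<longlonglongrightarrow> X w"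
    and measurable_path_integral: "X \<in> borel_measurable \<Omega>"
proof -
  show lim: "(\<lambda>n. \<Sum>i<Suc n. h (real i / real (Suc n)) *\<^sub>R
      (Y (real (Suc i) / real (Suc n)) w - Y (real i / real (Suc n)) w)) \<longlonglongrightarrow> X w"
    if "w \<in> space \<Omega>" for w
    unfolding X_def
    by (rule path_integral_riemann_sums[OF h_mono h_cont levy_process_right_continuous[OF that]
          levy_process_left_limit[OF that]])
  have [measurable]: "Y (real i / real (Suc n)) \<in> borel_measurable \<Omega>" for i n
    by (rule levy_process_measurable) simp
  show "X \<in> borel_measurable \<Omega>"
    by (rule borel_measurable_LIMSEQ_metric[OF _ lim]) measurable
qed

context
  fixes \<Phi> :: "'a \<Rightarrow> complex"
  assumes \<Phi>_cont: "continuous_on UNIV \<Phi>" and \<Phi>_0: "\<Phi> 0 = 0"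
    and \<Phi>: "\<And>y. char_fun (distr \<Omega> borel (Y 1)) y = exp (\<Phi> y)"
begin

text \<open>
  As \<open>Y 1\<close> is a sum of \<open>N = n + 1\<close> independent copies of \<open>Y (1/N)\<close>, the characteristic function of
  \<open>Y (1/N)\<close> is an \<open>N\<close>-th root of \<open>exp \<Phi>\<close>; continuity and the value 1 at the origin select the root.
\<close>

lemma char_levy_fraction:
  "char_fun (distr \<Omega> borel (Y (1 / real (Suc n)))) y = exp (\<Phi> y / of_nat (Suc n))"
proof (rule continuous_root_of_exp[OF _ \<Phi>_cont _ \<Phi>_0])
  let ?\<rho> = "distr \<Omega> borel (Y (1 / real (Suc n)))"
  have m: "Y (1 / real (Suc n)) \<in> borel_measurable \<Omega>"
    by (rule levy_process_measurable) simp
  interpret \<rho>: prob_space ?\<rho> by (rule prob_space_distr[OF m])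
  show "continuous_on UNIV (char_fun ?\<rho>)"
    by (rule continuous_on_char_fun[OF \<rho>.finite_measure_axioms]) simp
  show "char_fun ?\<rho> 0 = 1"
    using \<rho>.prob_space by (simp add: char_fun_def)
  show "char_fun ?\<rho> y ^ Suc n = exp (\<Phi> y)" for y
  proof -
    have "char_fun ?\<rho> y ^ Suc n =
      (CLINT w|\<Omega>. iexp (y \<bullet> (\<Sum>i<Suc n. 1 *\<^sub>R (Y (real (Suc i) / real (Suc n)) w - Y (real i / real (Suc n)) w))))"
      unfolding char_levy_increments by (simp del: of_nat_Suc prod.lessThan_Suc)
    also have "\<dots> = (CLINT w|\<Omega>. iexp (y \<bullet> Y 1 w))"
    proof (rule Bochner_Integration.integral_cong[OF refl])
      fix w assume "w \<in> space \<Omega>"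
      then have "Y 0 w = 0" using L by (simp add: levy_process_def)
      then show "iexp (y \<bullet> (\<Sum>i<Suc n. 1 *\<^sub>R (Y (real (Suc i) / real (Suc n)) w - Y (real i / real (Suc n)) w))) =
          iexp (y \<bullet> Y 1 w)"
        using sum_lessThan_telescope[of "\<lambda>i. Y (real i / real (Suc n)) w" "Suc n"]
        by (simp del: of_nat_Suc sum.lessThan_Suc)
    qed
    also have "\<dots> = exp (\<Phi> y)"
      using char_fun_distr[OF levy_process_measurable[of 1]] \<Phi> by simp
    finally show ?thesis .
  qed
qed simp

text \<open>
  The characteristic function of a Riemann sum of the random integral is the exponential of a Riemann
  sum of \<open>\<Phi> (h t y)\<close>.
\<close>

lemma char_path_integral:
  fixes h :: "real \<Rightarrow> real"
  assumes h_mono: "\<And>s t. 0 \<le> s \<Longrightarrow> s \<le> t \<Longrightarrow> t \<le> 1 \<Longrightarrow> h s \<le> h t" and h_cont: "continuous_on {0..1} h"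
  defines "X \<equiv> (\<lambda>w. path_integral 0 1 h (\<lambda>t. Y t w) (\<lambda>t. t))"
  shows "char_fun (distr \<Omega> borel X) y = exp (LINT t:{0<..1}|lborel. \<Phi> (h t *\<^sub>R y))"
proof -
  define S where "S = (\<lambda>n w. \<Sum>i<Suc n. h (real i / real (Suc n)) *\<^sub>R
      (Y (real (Suc i) / real (Suc n)) w - Y (real i / real (Suc n)) w))"
  have lim: "(\<lambda>n. S n w) \<longlonglongrightarrow> X w" if "w \<in> space \<Omega>" for w
    unfolding S_def X_def by (rule path_integral_levy_riemann_sums[OF h_mono h_cont that])
  have [measurable]: "Y (real i / real (Suc n)) \<in> borel_measurable \<Omega>" for i n
    by (rule levy_process_measurable) simp
  have S_meas [measurable]: "S n \<in> borel_measurable \<Omega>" for n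
    unfolding S_def by measurable
  have X_meas [measurable]: "X \<in> borel_measurable \<Omega>"
    unfolding X_def by (rule measurable_path_integral[OF h_mono h_cont])
  have lim1: "(\<lambda>n. CLINT w|\<Omega>. iexp (y \<bullet> S n w)) \<longlonglongrightarrow> (CLINT w|\<Omega>. iexp (y \<bullet> X w))"
  proof (rule integral_dominated_convergence)
    show "AE w in \<Omega>. (\<lambda>n. iexp (y \<bullet> S n w)) \<longlonglongrightarrow> iexp (y \<bullet> X w)"
      by (intro AE_I2 tendsto_intros lim)
    show "integrable \<Omega> (\<lambda>_. 1::real)" by simp
  qed auto
  have eq: "(CLINT w|\<Omega>. iexp (y \<bullet> S n w)) = exp (\<Sum>i<Suc n. \<Phi> (h (real i / real (Suc n)) *\<^sub>R y) / of_nat (Suc n))" for n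
    unfolding S_def char_levy_increments char_levy_fraction by (simp only: exp_sum finite_lessThan)
  have lim2: "(\<lambda>n. exp (\<Sum>i<Suc n. \<Phi> (h (real i / real (Suc n)) *\<^sub>R y) / of_nat (Suc n))) \<longlonglongrightarrow>
      exp (LINT t:{0<..1}|lborel. \<Phi> (h t *\<^sub>R y))"
  proof (rule tendsto_exp)
    let ?f = "\<lambda>t. \<Phi> (h (max 0 (min 1 t)) *\<^sub>R y)"
    have "continuous_on UNIV (\<lambda>t. h (max 0 (min 1 t)))"
      by (rule continuous_on_compose2[OF h_cont]) (auto intro!: continuous_intros)
    then have f: "continuous_on UNIV ?f"
      by (intro continuous_on_compose2[OF \<Phi>_cont] continuous_intros) auto
    have "(\<lambda>n. \<Sum>i<Suc n. (real (Suc i) / real (Suc n) - real i / real (Suc n)) *\<^sub>R ?f (real (Suc i) / real (Suc n)))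
        \<longlonglongrightarrow> (LINT t:{0<..1}|interval_measure (\<lambda>x. x). ?f t)"
    proof (rule right_sums_tendsto)
      show "continuous (at_right t) ?f" for t
        using f by (auto simp: continuous_on_eq_continuous_at intro: continuous_at_imp_continuous_within)
      show "bounded (?f ` {0..1})"
        by (intro compact_imp_bounded compact_continuous_image continuous_on_subset[OF f]) auto
    qed (auto intro: continuous_intros)
    moreover have "(LINT t:{0<..1}|interval_measure (\<lambda>x. x). ?f t) = (LINT t:{0<..1}|lborel. \<Phi> (h t *\<^sub>R y))"
      unfolding lborel_eq_real by (intro set_lebesgue_integral_cong) auto
    moreover have "(\<lambda>n. (1 / real (Suc n)) *\<^sub>R (?f 1 - ?f 0)) \<longlonglongrightarrow> 0 *\<^sub>R (?f 1 - ?f 0)"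
      by (intro tendsto_intros LIMSEQ_Suc[OF lim_1_over_n])
    \<comment> \<open>Left and right endpoint sums differ by a telescoping sum divided by the number of intervals.\<close>
    moreover have "(\<Sum>i<Suc n. \<Phi> (h (real i / real (Suc n)) *\<^sub>R y) / of_nat (Suc n)) =
      (\<Sum>i<Suc n. (real (Suc i) / real (Suc n) - real i / real (Suc n)) *\<^sub>R ?f (real (Suc i) / real (Suc n))) -
      (1 / real (Suc n)) *\<^sub>R (?f 1 - ?f 0)" for n
    proof -
      have "\<Phi> (h (real i / real (Suc n)) *\<^sub>R y) = ?f (real i / real (Suc n))" if "i < Suc n" for i
      proof -
        have "real i / real (Suc n) \<le> 1" using that by (simp add: divide_le_eq_1)
        then show ?thesis by (simp add: max_def min_def)
      qed
      then have 1: "(\<Sum>i<Suc n. \<Phi> (h (real i / real (Suc n)) *\<^sub>R y) / of_nat (Suc n)) =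
          (\<Sum>i<Suc n. (1 / real (Suc n)) *\<^sub>R ?f (real i / real (Suc n)))"
        by (intro sum.cong refl) (simp add: scaleR_conv_of_real del: of_nat_Suc)
      have 2: "real (Suc i) / real (Suc n) - real i / real (Suc n) = 1 / real (Suc n)" for i
        by (simp add: field_simps)
      have 3: "?f 1 - ?f 0 = (\<Sum>i<Suc n. ?f (real (Suc i) / real (Suc n)) - ?f (real i / real (Suc n)))"
        by (subst sum_lessThan_telescope[of "\<lambda>i. ?f (real i / real (Suc n))" "Suc n"]) (simp del: of_nat_Suc)
      show ?thesis unfolding 1 2 3 by (simp only: scaleR_sum_right[symmetric] scaleR_diff_right[symmetric] sum_subtractf) simp
    qed
    ultimately show "(\<lambda>n. \<Sum>i<Suc n. \<Phi> (h (real i / real (Suc n)) *\<^sub>R y) / of_nat (Suc n)) \<longlonglongrightarrow>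
        (LINT t:{0<..1}|lborel. \<Phi> (h t *\<^sub>R y))"
      by (simp only: scaleR_zero_left) (auto dest: tendsto_diff)
  qed
  show "char_fun (distr \<Omega> borel X) y = exp (LINT t:{0<..1}|lborel. \<Phi> (h t *\<^sub>R y))"
    unfolding char_fun_distr[OF X_meas] by (rule LIMSEQ_unique[OF lim1[unfolded eq] lim2])
qed

end

end

text \<open>
  The exponent is transformed by averaging. Infinite divisibility is obtained from the slowed-down
  processes: the law of the integral against \<open>Y (t/n)\<close> has the transformed exponent divided by \<open>n\<close>, so its
  \<open>n\<close>-fold convolution has the characteristic function of \<open>\<mu>\<close>.
\<close>

lemma rand_int_law_char:
  fixes \<nu> \<mu> :: "'a::euclidean_space measure"
  assumes law: "rand_int_law TYPE('w) \<beta> \<nu> \<mu>" and \<beta>: "0 < \<beta>"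
    and \<Phi>: "continuous_on UNIV \<Phi>" "\<Phi> 0 = 0" "\<And>y. char_fun \<nu> y = exp (\<Phi> y)"
  shows "infinitely_divisible \<mu>"
    and "char_fun \<mu> y = exp (LINT t:{0<..1}|lborel. \<Phi> (t powr (1 / \<beta>) *\<^sub>R y))"
proof -
  let ?h = "\<lambda>t::real. t powr (1 / \<beta>)"
  obtain \<Omega> :: "'w measure" and Y where L: "levy_process \<Omega> Y" and \<nu>: "distr \<Omega> borel (Y 1) = \<nu>"
    and \<mu>: "\<mu> = distr \<Omega> borel (\<lambda>w. path_integral 0 1 ?h (\<lambda>t. Y t w) (\<lambda>t. t))"
    using law by (auto simp: rand_int_law_def)
  interpret prob_space \<Omega> using L by (simp add: levy_process_def)
  have h_mono: "?h s \<le> ?h t" if "0 \<le> s" "s \<le> t" for s t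
    using that \<beta> by (intro powr_mono2) auto
  have h_cont: "continuous_on {0..1} ?h"
    using \<beta> by (intro continuous_on_powr' continuous_intros) auto
  have char1: "char_fun (distr \<Omega> borel (Y 1)) y = exp (\<Phi> y)" for y
    using \<nu> \<Phi> by simp
  note meas = measurable_path_integral[OF L h_mono h_cont]
  show ch: "char_fun \<mu> y = exp (LINT t:{0<..1}|lborel. \<Phi> (t powr (1 / \<beta>) *\<^sub>R y))" for y
    unfolding \<mu> by (rule char_path_integral[OF L \<Phi>(1,2) char1 h_mono h_cont])
  show "infinitely_divisible \<mu>"
    unfolding infinitely_divisible_def
  proof (intro conjI allI impI)
    show "prob_space \<mu>" unfolding \<mu> by (rule prob_space_distr) (rule meas)
    then interpret \<mu>: prob_space \<mu> .
    show "sets \<mu> = sets borel" by (simp add: \<mu>)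
    fix n :: nat assume "1 \<le> n"
    then obtain m where n: "n = Suc m" by (cases n) auto
    let ?Z = "\<lambda>t. Y ((1 / real (Suc m)) * t)"
    have LZ: "levy_process \<Omega> ?Z" by (rule levy_process_rescale[OF L]) simp
    have chZ: "char_fun (distr \<Omega> borel (?Z 1)) y = exp (\<Phi> y / of_nat n)" for y
      using char_levy_fraction[OF L \<Phi>(1,2) char1, of m y] by (simp add: n del: of_nat_Suc)
    have \<Phi>n: "continuous_on UNIV (\<lambda>y. \<Phi> y / of_nat n)" "\<Phi> 0 / of_nat n = 0"
      using \<Phi> n by (auto intro!: continuous_intros simp del: of_nat_Suc)
    define \<rho> where "\<rho> = distr \<Omega> borel (\<lambda>w. path_integral 0 1 ?h (\<lambda>t. ?Z t w) (\<lambda>t. t))"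
    have \<rho>: "prob_space \<rho>" "sets \<rho> = sets borel"
      unfolding \<rho>_def by (intro prob_space_distr measurable_path_integral[OF LZ h_mono h_cont]) simp_all
    let ?\<rho>n = "distr (\<Pi>\<^sub>M i\<in>{..<n}. \<rho>) borel (\<lambda>x. \<Sum>i<n. x i)"
    interpret P: product_prob_space "\<lambda>_::nat. \<rho>" "{..<n}"
      using \<rho>(1) by (simp add: product_prob_space_def product_sigma_finite_def product_prob_space_axioms_def
          prob_space_imp_sigma_finite)
    have "\<mu> = ?\<rho>n"
    proof (rule char_fun_unique)
      note [measurable_cong] = \<rho>(2)
      show "finite_measure \<mu>" by (rule \<mu>.finite_measure_axioms)
      have "prob_space ?\<rho>n" by (rule P.prob_space_distr) measurable
      then show "finite_measure ?\<rho>n" by (rule prob_space.finite_measure)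
      fix y
      have "char_fun ?\<rho>n y = exp (LINT t:{0<..1}|lborel. \<Phi> (?h t *\<^sub>R y) / of_nat n) ^ n"
        unfolding char_fun_convolution_power[OF \<rho>] unfolding \<rho>_def
        by (subst char_path_integral[OF LZ \<Phi>n chZ h_mono h_cont]) simp_all
      also have "\<dots> = exp ((LINT t:{0<..1}|lborel. \<Phi> (?h t *\<^sub>R y)) / of_nat n) ^ n"
        by simp
      also have "\<dots> = char_fun \<mu> y"
        using \<open>1 \<le> n\<close> by (simp add: ch flip: exp_of_nat_mult)
      finally show "char_fun \<mu> y = char_fun ?\<rho>n y" ..
    qed (simp_all add: \<mu>)
    then show "\<exists>\<rho>. prob_space \<rho> \<and> sets \<rho> = sets borel \<and> \<mu> = distr (\<Pi>\<^sub>M i\<in>{..<n}. \<rho>) borel (\<lambda>x. \<Sum>i<n. x i)"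
      using \<rho> by blast
  qed
qed

section \<open>Partial fractions and products of powers of uniform variables\<close>

lemma C_coeff_Suc_old:
  assumes "j \<in> {1..n}"
  shows "C_coeff \<beta> j (Suc n) = C_coeff \<beta> j n * (\<beta> (Suc n) / (\<beta> (Suc n) - \<beta> j))"
proof -
  have "{1..Suc n} - {j} = insert (Suc n) ({1..n} - {j})" using assms by auto
  then show ?thesis by (simp add: C_coeff_def)
qed

lemma C_coeff_Suc_new: "C_coeff \<beta> (Suc n) (Suc n) = (\<Prod>k=1..n. \<beta> k / (\<beta> k - \<beta> (Suc n)))"
proof -
  have "{1..Suc n} - {Suc n} = {1..n}" by auto
  then show ?thesis by (simp add: C_coeff_def)
qed

text \<open>
  The recursion in \<open>n\<close> through which all identities for the coefficients are proved: the old
  coefficients acquire a factor, and one new term appears.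
\<close>

lemma sum_C_coeff_Suc:
  "(\<Sum>j=1..Suc n. C_coeff \<beta> j (Suc n) * f (\<beta> j)) =
    (\<Sum>j=1..n. C_coeff \<beta> j n * (\<beta> (Suc n) / (\<beta> (Suc n) - \<beta> j) * f (\<beta> j))) +
    (\<Prod>k=1..n. \<beta> k / (\<beta> k - \<beta> (Suc n))) * f (\<beta> (Suc n))"
proof -
  have "(\<Sum>j=1..n. C_coeff \<beta> j (Suc n) * f (\<beta> j)) =
      (\<Sum>j=1..n. C_coeff \<beta> j n * (\<beta> (Suc n) / (\<beta> (Suc n) - \<beta> j) * f (\<beta> j)))"
    by (intro sum.cong refl) (simp add: C_coeff_Suc_old)
  then show ?thesis by (simp add: C_coeff_Suc_new)
qed

text \<open>
  This form of the partial fraction expansion, with the leading 1, holds for \<open>n = 0\<close> as well, and so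
  does its use in \<open>cdf_mix_law\<close>. The recursion needs the induction hypothesis at two points: at \<open>x\<close>,
  and at \<open>\<beta> (Suc n)\<close> to expand the new coefficient.
\<close>

lemma prod_partial_fractions:
  assumes "inj_on \<beta> {1..n}" "\<forall>j\<in>{1..n}. \<beta> j \<noteq> x"
  shows "(\<Prod>j=1..n. \<beta> j / (\<beta> j - x)) = 1 + (\<Sum>j=1..n. C_coeff \<beta> j n * (x / (\<beta> j - x)))"
  using assms
proof (induction n arbitrary: x)
  case 0
  then show ?case by simp
next
  case (Suc n)
  let ?c = "\<beta> (Suc n)"
  have inj: "inj_on \<beta> {1..n}" by (rule inj_on_subset[OF Suc.prems(1)]) auto
  have c: "\<beta> j \<noteq> ?c" if "j \<in> {1..n}" for j
    using inj_onD[OF Suc.prems(1), of j "Suc n"] that by auto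
  have x: "\<beta> j \<noteq> x" if "j \<in> {1..n}" for j using Suc.prems(2) that by simp
  have cx: "?c \<noteq> x" using Suc.prems(2) by simp
  have pf: "(\<Prod>j=1..n. \<beta> j / (\<beta> j - z)) = 1 + (\<Sum>j=1..n. C_coeff \<beta> j n * (z / (\<beta> j - z)))"
    if "z = x \<or> z = ?c" for z
    by (rule Suc.IH[OF inj]) (use c x that in blast)
  have "1 + (\<Sum>j=1..Suc n. C_coeff \<beta> j (Suc n) * (x / (\<beta> j - x))) =
      1 + (\<Sum>j=1..n. C_coeff \<beta> j n * (?c / (?c - \<beta> j) * (x / (\<beta> j - x)))) +
      (1 + (\<Sum>j=1..n. C_coeff \<beta> j n * (?c / (\<beta> j - ?c)))) * (x / (?c - x))"
    unfolding sum_C_coeff_Suc[of \<beta> n "\<lambda>b. x / (b - x)"] pf[OF disjI2[OF refl]] by simp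
  also have "\<dots> = (1 + x / (?c - x)) +
      (\<Sum>j=1..n. C_coeff \<beta> j n * (?c / (?c - \<beta> j) * (x / (\<beta> j - x)) + ?c / (\<beta> j - ?c) * (x / (?c - x))))"
    by (simp add: distrib_left distrib_right sum.distrib sum_distrib_left sum_distrib_right mult_ac)
  also have "(\<Sum>j=1..n. C_coeff \<beta> j n * (?c / (?c - \<beta> j) * (x / (\<beta> j - x)) + ?c / (\<beta> j - ?c) * (x / (?c - x)))) =
      (\<Sum>j=1..n. ?c / (?c - x) * (C_coeff \<beta> j n * (x / (\<beta> j - x))))"
  proof (intro sum.cong refl)
    fix j assume j: "j \<in> {1..n}"
    have "?c / (?c - \<beta> j) * (x / (\<beta> j - x)) + ?c / (\<beta> j - ?c) * (x / (?c - x)) = ?c / (?c - x) * (x / (\<beta> j - x))"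
      using c[OF j] x[OF j] cx by (simp add: divide_simps) (simp add: algebra_simps)
    then show "C_coeff \<beta> j n * (?c / (?c - \<beta> j) * (x / (\<beta> j - x)) + ?c / (\<beta> j - ?c) * (x / (?c - x))) =
        ?c / (?c - x) * (C_coeff \<beta> j n * (x / (\<beta> j - x)))"
      by (metis mult.left_commute)
  qed
  also have "1 + x / (?c - x) = ?c / (?c - x)" using cx by (simp add: field_simps)
  also have "?c / (?c - x) + (\<Sum>j=1..n. ?c / (?c - x) * (C_coeff \<beta> j n * (x / (\<beta> j - x)))) =
      ?c / (?c - x) * (1 + (\<Sum>j=1..n. C_coeff \<beta> j n * (x / (\<beta> j - x))))"
    by (simp only: distrib_left sum_distrib_left mult_1_right)
  also have "\<dots> = ?c / (?c - x) * (\<Prod>j=1..n. \<beta> j / (\<beta> j - x))"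
    unfolding pf[OF disjI1[OF refl]] ..
  finally show ?case by (simp add: mult.commute)
qed

lemma sum_C_coeff:
  assumes "inj_on \<beta> {1..n}"
  shows "(\<Sum>j=1..n. C_coeff \<beta> j n) = (if n = 0 then 0 else 1)"
proof (cases n)
  case (Suc m)
  let ?c = "\<beta> (Suc m)"
  have inj: "inj_on \<beta> {1..m}" using assms by (rule inj_on_subset) (auto simp: Suc)
  have c: "\<beta> j \<noteq> ?c" if "j \<in> {1..m}" for j
    using inj_onD[OF assms, of j "Suc m"] that Suc by auto
  have pf: "(\<Prod>j=1..m. \<beta> j / (\<beta> j - ?c)) = 1 + (\<Sum>j=1..m. C_coeff \<beta> j m * (?c / (\<beta> j - ?c)))"
    by (rule prod_partial_fractions[OF inj]) (use c in blast)
  have "(\<Sum>j=1..Suc m. C_coeff \<beta> j (Suc m)) =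
      (\<Sum>j=1..m. C_coeff \<beta> j m * (?c / (?c - \<beta> j))) + (1 + (\<Sum>j=1..m. C_coeff \<beta> j m * (?c / (\<beta> j - ?c))))"
    using sum_C_coeff_Suc[of \<beta> m "\<lambda>_. 1", unfolded pf]
    by (simp only: mult_1_right)
  also have "\<dots> = 1 + (\<Sum>j=1..m. C_coeff \<beta> j m * (?c / (?c - \<beta> j) + ?c / (\<beta> j - ?c)))"
    by (simp add: distrib_left sum.distrib)
  also have "(\<Sum>j=1..m. C_coeff \<beta> j m * (?c / (?c - \<beta> j) + ?c / (\<beta> j - ?c))) = 0"
  proof (intro sum.neutral ballI)
    fix j
    have "?c / (\<beta> j - ?c) = - (?c / (?c - \<beta> j))" by (metis minus_diff_eq minus_divide_right)
    then show "C_coeff \<beta> j m * (?c / (?c - \<beta> j) + ?c / (\<beta> j - ?c)) = 0" by simp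
  qed
  finally show ?thesis by (simp add: Suc)
qed simp

text \<open>
  The expansion at \<open>x = - p\<close>. The cases \<open>p = 1\<close> and \<open>p = 2\<close> convert the products for the shift and
  the covariance into sums.
\<close>

lemma sum_C_coeff_moment:
  assumes "inj_on \<beta> {1..n}" "1 \<le> n" "\<forall>j\<in>{1..n}. 0 < \<beta> j" "0 \<le> p"
  shows "(\<Sum>j=1..n. C_coeff \<beta> j n * (\<beta> j / (\<beta> j + p))) = (\<Prod>j=1..n. \<beta> j / (\<beta> j + p))"
proof -
  have pos: "\<beta> j + p \<noteq> 0" if "j \<in> {1..n}" for j using bspec[OF assms(3) that] \<open>0 \<le> p\<close> by simp
  have "(\<Prod>j=1..n. \<beta> j / (\<beta> j + p)) = 1 + (\<Sum>j=1..n. C_coeff \<beta> j n * ((- p) / (\<beta> j + p)))"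
    using prod_partial_fractions[OF assms(1), of "- p"] pos by (simp add: eq_neg_iff_add_eq_0)
  also have "\<dots> = (\<Sum>j=1..n. C_coeff \<beta> j n) + (\<Sum>j=1..n. C_coeff \<beta> j n * ((- p) / (\<beta> j + p)))"
    unfolding sum_C_coeff[OF assms(1)] using assms(2) by simp
  also have "\<dots> = (\<Sum>j=1..n. C_coeff \<beta> j n * (\<beta> j / (\<beta> j + p)))"
    unfolding sum.distrib[symmetric] using pos by (intro sum.cong refl) (simp add: field_simps)
  finally show ?thesis ..
qed

abbreviation unit_law :: "real measure" where
  "unit_law \<equiv> density lborel (indicator {0<..1})"

text \<open>
  The law of the product \<open>U\<^sub>1 powr (1/\<beta>\<^sub>1) \<cdots> U\<^sub>n powr (1/\<beta>\<^sub>n)\<close> of powers of independent uniform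
  variables, with the factors multiplied in one at a time, as in \<^const>\<open>iter_rand_int_law\<close> and
  \<^const>\<open>iter_integral\<close>.
\<close>

primrec mix_law :: "(nat \<Rightarrow> real) \<Rightarrow> nat \<Rightarrow> real measure" where
  "mix_law \<beta> 0 = return borel 1"
| "mix_law \<beta> (Suc n) = distr (unit_law \<Otimes>\<^sub>M mix_law \<beta> n) borel (\<lambda>(t, s). t powr (1 / \<beta> (Suc n)) * s)"

lemma sets_mix_law [simp, measurable_cong]: "sets (mix_law \<beta> n) = sets borel"
  by (cases n) simp_all

lemma space_mix_law [simp]: "space (mix_law \<beta> n) = UNIV"
  by (cases n) simp_all

lemma nn_integral_unit_law:
  "f \<in> borel_measurable borel \<Longrightarrow> (\<integral>\<^sup>+t. f t \<partial>unit_law) = (\<integral>\<^sup>+t\<in>{0<..1}. f t \<partial>lborel)"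
  by (subst nn_integral_density) (simp_all add: mult.commute)

lemma prob_space_unit_law: "prob_space unit_law"
  by (rule prob_spaceI) (simp add: emeasure_density)

lemma prob_space_mix_law: "prob_space (mix_law \<beta> n)"
proof (induction n)
  case 0
  then show ?case by (simp add: prob_space_return)
next
  case (Suc n)
  interpret pair_prob_space unit_law "mix_law \<beta> n"
    using Suc prob_space_unit_law by (simp add: pair_prob_space_def pair_sigma_finite_def prob_space_imp_sigma_finite)
  show ?case unfolding mix_law.simps by (rule prob_space_distr) measurable
qed

lemma nn_integral_mix_law_Suc:
  assumes [measurable]: "g \<in> borel_measurable borel"
  shows "(\<integral>\<^sup>+s. g s \<partial>mix_law \<beta> (Suc n)) =
    (\<integral>\<^sup>+t\<in>{0<..1}. (\<integral>\<^sup>+s. g (t powr (1 / \<beta> (Suc n)) * s) \<partial>mix_law \<beta> n) \<partial>lborel)"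
proof -
  interpret prob_space "mix_law \<beta> n" by (rule prob_space_mix_law)
  have "(\<integral>\<^sup>+s. g s \<partial>mix_law \<beta> (Suc n)) =
      (\<integral>\<^sup>+t. (\<integral>\<^sup>+s. g (t powr (1 / \<beta> (Suc n)) * s) \<partial>mix_law \<beta> n) \<partial>unit_law)"
  proof -
    have [measurable]: "(\<lambda>(t, s). t powr (1 / \<beta> (Suc n)) * s) \<in> borel_measurable (unit_law \<Otimes>\<^sub>M mix_law \<beta> n)"
      by measurable
    have "(\<integral>\<^sup>+s. g s \<partial>mix_law \<beta> (Suc n)) =
        (\<integral>\<^sup>+p. g (case p of (t, s) \<Rightarrow> t powr (1 / \<beta> (Suc n)) * s) \<partial>(unit_law \<Otimes>\<^sub>M mix_law \<beta> n))"
      unfolding mix_law.simps by (rule nn_integral_distr) measurable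
    also have "\<dots> = (\<integral>\<^sup>+t. (\<integral>\<^sup>+s. g (case (t, s) of (t, s) \<Rightarrow> t powr (1 / \<beta> (Suc n)) * s) \<partial>mix_law \<beta> n) \<partial>unit_law)"
      by (rule nn_integral_fst[symmetric]) measurable
    finally show ?thesis by simp
  qed
  also have "\<dots> = (\<integral>\<^sup>+t\<in>{0<..1}. (\<integral>\<^sup>+s. g (t powr (1 / \<beta> (Suc n)) * s) \<partial>mix_law \<beta> n) \<partial>lborel)"
    by (rule nn_integral_unit_law) measurable
  finally show ?thesis .
qed

lemma AE_mix_law:
  assumes "\<forall>j\<in>{1..n}. 0 < \<beta> j"
  shows "AE s in mix_law \<beta> n. 0 < s \<and> s \<le> 1"
  using assms
proof (induction n)
  case 0
  show ?case unfolding mix_law.simps by (subst AE_return) simp_all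
next
  case (Suc n)
  interpret prob_space "mix_law \<beta> n" by (rule prob_space_mix_law)
  have IH: "AE s in mix_law \<beta> n. 0 < s \<and> s \<le> 1" using Suc by simp
  have b: "0 < \<beta> (Suc n)" using Suc by simp
  let ?g = "\<lambda>s. indicator (- {0<..1}) s :: ennreal"
  have "(\<integral>\<^sup>+s. ?g s \<partial>mix_law \<beta> (Suc n)) =
      (\<integral>\<^sup>+t\<in>{0<..1}. (\<integral>\<^sup>+s. ?g (t powr (1 / \<beta> (Suc n)) * s) \<partial>mix_law \<beta> n) \<partial>lborel)"
    by (rule nn_integral_mix_law_Suc) simp
  also have "\<dots> = (\<integral>\<^sup>+t. 0 \<partial>(lborel :: real measure))"
  proof (intro nn_integral_cong)
    fix t :: real
    show "(\<integral>\<^sup>+s. ?g (t powr (1 / \<beta> (Suc n)) * s) \<partial>mix_law \<beta> n) * indicator {0<..1} t = 0"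
    proof (cases "0 < t \<and> t \<le> 1")
      case True
      then have t: "0 < t powr (1 / \<beta> (Suc n))" "t powr (1 / \<beta> (Suc n)) \<le> 1"
        using b by (auto intro!: powr_le1)
      have "(\<integral>\<^sup>+s. ?g (t powr (1 / \<beta> (Suc n)) * s) \<partial>mix_law \<beta> n) = (\<integral>\<^sup>+s. 0 \<partial>mix_law \<beta> n)"
      proof (rule nn_integral_cong_AE, rule eventually_mono[OF IH])
        fix s :: real assume s: "0 < s \<and> s \<le> 1"
        then have "t powr (1 / \<beta> (Suc n)) * s \<le> 1" using t by (intro mult_le_one) auto
        then show "?g (t powr (1 / \<beta> (Suc n)) * s) = 0" using s t(1) by (simp add: indicator_def)
      qed
      then show ?thesis by simp
    qed auto
  qed
  finally have "(\<integral>\<^sup>+s. ?g s \<partial>mix_law \<beta> (Suc n)) = 0" by simp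
  then have "AE s in mix_law \<beta> (Suc n). ?g s = 0"
    by (subst (asm) nn_integral_0_iff_AE) simp_all
  then show ?case by (auto elim!: eventually_mono simp: indicator_def split: if_splits)
qed

lemma integral_mix_law_Suc:
  fixes g :: "real \<Rightarrow> 'b::{banach, second_countable_topology}"
  assumes [measurable]: "g \<in> borel_measurable borel"
    and bound: "\<And>s. 0 < s \<Longrightarrow> s \<le> 1 \<Longrightarrow> norm (g s) \<le> K"
    and \<beta>: "\<forall>j\<in>{1..Suc n}. 0 < \<beta> j"
  shows "(LINT s|mix_law \<beta> (Suc n). g s) =
    (LINT t:{0<..1}|lborel. (LINT s|mix_law \<beta> n. g (t powr (1 / \<beta> (Suc n)) * s)))"
proof -
  interpret U: prob_space unit_law by (rule prob_space_unit_law)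
  interpret N: prob_space "mix_law \<beta> n" by (rule prob_space_mix_law)
  interpret S: prob_space "mix_law \<beta> (Suc n)" by (rule prob_space_mix_law)
  interpret P: pair_sigma_finite unit_law "mix_law \<beta> n"
    by (simp add: pair_sigma_finite_def U.sigma_finite_measure_axioms N.sigma_finite_measure_axioms)
  have "integrable (mix_law \<beta> (Suc n)) g"
    using AE_mix_law[OF \<beta>] bound
    by (intro S.integrable_const_bound[where B = K]) (auto elim!: eventually_mono simp del: mix_law.simps AE_conj_iff)
  then have int: "integrable (unit_law \<Otimes>\<^sub>M mix_law \<beta> n) (\<lambda>(t, s). g (t powr (1 / \<beta> (Suc n)) * s))"
    unfolding mix_law.simps by (subst (asm) integrable_distr_eq) (measurable, simp add: case_prod_beta')
  have "(LINT s|mix_law \<beta> (Suc n). g s) = (LINT p|(unit_law \<Otimes>\<^sub>M mix_law \<beta> n). (\<lambda>(t, s). g (t powr (1 / \<beta> (Suc n)) * s)) p)"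
    unfolding mix_law.simps by (subst integral_distr) (measurable, simp add: case_prod_beta')
  also have "\<dots> = (LINT t|unit_law. (LINT s|mix_law \<beta> n. g (t powr (1 / \<beta> (Suc n)) * s)))"
    by (rule P.integral_fst[OF int, symmetric])
  also have "\<dots> = (LINT t:{0<..1}|lborel. (LINT s|mix_law \<beta> n. g (t powr (1 / \<beta> (Suc n)) * s)))"
  proof -
    have "(LINT t|density lborel (\<lambda>t. ennreal (indicator {0<..1} t)). (LINT s|mix_law \<beta> n. g (t powr (1 / \<beta> (Suc n)) * s))) =
      (LINT t:{0<..1}|lborel. (LINT s|mix_law \<beta> n. g (t powr (1 / \<beta> (Suc n)) * s)))"
      unfolding set_lebesgue_integral_def 
    proof (rule integral_density)
      show "(\<lambda>t. LINT s|mix_law \<beta> n. g (t powr (1 / \<beta> (Suc n)) * s)) \<in> borel_measurable lborel"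
        by measurable
    qed simp_all
    then show ?thesis by (simp add: ennreal_indicator)
  qed
  finally show ?thesis .
qed

lemma iter_integral_mix_law:
  assumes "g \<in> borel_measurable borel"
  shows "iter_integral n (\<lambda>t. g (\<Prod>j=1..n. t j powr (1 / \<beta> j))) = (\<integral>\<^sup>+s. g s \<partial>mix_law \<beta> n)"
  using assms
proof (induction n arbitrary: g)
  case 0
  then show ?case by (simp add: nn_integral_return)
next
  case (Suc n)
  note [measurable] = Suc.prems
  have "(\<Prod>j=1..Suc n. (t(Suc n := s)) j powr (1 / \<beta> j)) = s powr (1 / \<beta> (Suc n)) * (\<Prod>j=1..n. t j powr (1 / \<beta> j))"
    for t :: "nat \<Rightarrow> real" and s
  proof -
    have "(\<Prod>j=1..n. (t(Suc n := s)) j powr (1 / \<beta> j)) = (\<Prod>j=1..n. t j powr (1 / \<beta> j))"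
      by (intro prod.cong) auto
    then show ?thesis by simp
  qed
  then have "iter_integral (Suc n) (\<lambda>t. g (\<Prod>j=1..Suc n. t j powr (1 / \<beta> j))) =
      (\<integral>\<^sup>+s\<in>{0<..1}. iter_integral n (\<lambda>t. g (s powr (1 / \<beta> (Suc n)) * (\<Prod>j=1..n. t j powr (1 / \<beta> j)))) \<partial>lborel)"
    by (simp only: iter_integral.simps)
  also have "\<dots> = (\<integral>\<^sup>+s\<in>{0<..1}. (\<integral>\<^sup>+u. g (s powr (1 / \<beta> (Suc n)) * u) \<partial>mix_law \<beta> n) \<partial>lborel)"
    by (subst Suc.IH) simp_all
  also have "\<dots> = (\<integral>\<^sup>+s. g s \<partial>mix_law \<beta> (Suc n))"
    by (rule nn_integral_mix_law_Suc[symmetric]) (rule Suc.prems)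
  finally show ?case .
qed

section \<open>The density of the mixing law\<close>

text \<open>
  Condition on the new factor \<open>T = t powr (1/c)\<close>, where \<open>c = \<beta> (Suc n)\<close>. The product is at most \<open>x\<close>
  for certain if \<open>T \<le> x\<close>, that is if \<open>t \<le> q = x powr c\<close>; otherwise the old factors must be at most
  \<open>x/T < 1\<close>, and the induction hypothesis gives an integrand with the antiderivative \<open>F\<close>. For
  \<open>n = 0\<close> the old law is the point mass at 1, whose distribution function vanishes below 1, like the
  empty sum. The terms of order \<open>x powr c\<close> are collected by partial fractions.
\<close>

lemma cdf_mix_law:
  assumes "inj_on \<beta> {1..n}" "\<forall>j\<in>{1..n}. 0 < \<beta> j" "0 < x" "x < 1"
  shows "measure (mix_law \<beta> n) {..x} = (\<Sum>j=1..n. C_coeff \<beta> j n * x powr \<beta> j)"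
  using assms
proof (induction n arbitrary: x)
  case 0
  then show ?case by (simp add: measure_return indicator_def)
next
  case (Suc n)
  define c where "c = \<beta> (Suc n)"
  have c0: "0 < c" using Suc.prems by (simp add: c_def)
  have inj: "inj_on \<beta> {1..n}" by (rule inj_on_subset[OF Suc.prems(1)]) auto
  have cne: "\<beta> j \<noteq> c" if "j \<in> {1..n}" for j
    using inj_onD[OF Suc.prems(1), of j "Suc n"] that by (auto simp: c_def)
  have pos: "\<forall>j\<in>{1..n}. 0 < \<beta> j" using Suc.prems(2) by simp
  note x = \<open>0 < x\<close> \<open>x < 1\<close>
  define q where "q = x powr c"
  have q: "0 < q" "q < 1" "q powr (1 / c) = x"
    using x c0 powr_less_mono2[of c x 1] by (simp_all add: q_def powr_powr)
  interpret N: prob_space "mix_law \<beta> n" by (rule prob_space_mix_law)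
  define f where "f = (\<lambda>t. \<Sum>j=1..n. C_coeff \<beta> j n * (x powr \<beta> j * t powr (- (\<beta> j / c))))"
  define F where "F = (\<lambda>t. \<Sum>j=1..n. C_coeff \<beta> j n * (x powr \<beta> j * (c / (c - \<beta> j) * t powr ((c - \<beta> j) / c))))"
  have inner1: "(\<integral>\<^sup>+s. indicator {..x} (t powr (1 / c) * s) \<partial>mix_law \<beta> n) = 1" if t: "0 < t" "t \<le> q" for t
  proof -
    have "t powr (1 / c) \<le> x"
      using powr_mono2[of "1 / c" t q] t c0 q by simp
    have "(\<integral>\<^sup>+s. indicator {..x} (t powr (1 / c) * s) \<partial>mix_law \<beta> n) = (\<integral>\<^sup>+s. 1 \<partial>mix_law \<beta> n)"
    proof (rule nn_integral_cong_AE, rule eventually_mono[OF AE_mix_law[OF pos]])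
      fix s :: real assume "0 < s \<and> s \<le> 1"
      then have "t powr (1 / c) * s \<le> x * 1"
        using \<open>t powr (1 / c) \<le> x\<close> x by (intro mult_mono) auto
      then show "indicator {..x} (t powr (1 / c) * s) = (1 :: ennreal)" by simp
    qed
    then show ?thesis using N.emeasure_space_1 by simp
  qed
  have inner2: "(\<integral>\<^sup>+s. indicator {..x} (t powr (1 / c) * s) \<partial>mix_law \<beta> n) = ennreal (f t)" "0 \<le> f t"
    if t: "q < t" "t \<le> 1" for t
  proof -
    have t0: "0 < t" using t q by simp
    define y where "y = x / t powr (1 / c)"
    have "x < t powr (1 / c)"
      using powr_less_mono2[of "1 / c" q t] t c0 q by simp
    then have y: "0 < y" "y < 1" using x t0 by (simp_all add: y_def)
    have "y powr \<beta> j = x powr \<beta> j * t powr (- (\<beta> j / c))" for j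
      using x t0 by (simp add: y_def powr_divide powr_powr powr_minus_divide)
    then have fy: "f t = measure (mix_law \<beta> n) {..y}"
      using Suc.IH[OF inj pos y] by (simp add: f_def)
    then show "0 \<le> f t" by simp
    have "(\<integral>\<^sup>+s. indicator {..x} (t powr (1 / c) * s) \<partial>mix_law \<beta> n) = (\<integral>\<^sup>+s. indicator {..y} s \<partial>mix_law \<beta> n)"
      using t0 by (intro nn_integral_cong) (simp add: indicator_def y_def field_simps)
    also have "\<dots> = ennreal (f t)" by (simp add: fy N.emeasure_eq_measure)
    finally show "(\<integral>\<^sup>+s. indicator {..x} (t powr (1 / c) * s) \<partial>mix_law \<beta> n) = ennreal (f t)" .
  qed
  have fq: "f q = (\<Sum>j=1..n. C_coeff \<beta> j n)"
    unfolding f_def q_def using x c0 by (intro sum.cong refl) (simp add: powr_powr flip: powr_add)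
  have f_nonneg: "0 \<le> f t" if "q \<le> t" "t \<le> 1" for t
    using inner2(2)[of t] fq sum_C_coeff[OF inj] that by (cases "t = q") auto
  have deriv: "(F has_real_derivative f t) (at t)" if "q \<le> t" "t \<le> 1" for t
    unfolding F_def f_def
  proof (intro DERIV_sum DERIV_cmult)
    fix j assume j: "j \<in> {1..n}"
    have t0: "0 < t" using that q by simp
    have "((\<lambda>t. t powr ((c - \<beta> j) / c)) has_real_derivative (c - \<beta> j) / c * t powr ((c - \<beta> j) / c - 1)) (at t)"
      by (rule has_real_derivative_powr[OF t0])
    then have "((\<lambda>t. c / (c - \<beta> j) * t powr ((c - \<beta> j) / c)) has_real_derivative
        c / (c - \<beta> j) * ((c - \<beta> j) / c * t powr ((c - \<beta> j) / c - 1))) (at t)"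
      by (rule DERIV_cmult)
    moreover have "(c - \<beta> j) / c - 1 = - (\<beta> j / c)" using c0 by (simp add: field_simps)
    ultimately show "((\<lambda>t. c / (c - \<beta> j) * t powr ((c - \<beta> j) / c)) has_real_derivative t powr (- (\<beta> j / c))) (at t)"
      using cne[OF j] c0 by simp
  qed
  have F_mono: "F q \<le> F 1"
    using q f_nonneg deriv by (intro DERIV_nonneg_imp_nondecreasing[of q 1 F]) auto
  have "emeasure (mix_law \<beta> (Suc n)) {..x} = (\<integral>\<^sup>+s. indicator {..x} s \<partial>mix_law \<beta> (Suc n))"
    by (simp del: mix_law.simps)
  also have "\<dots> = (\<integral>\<^sup>+t\<in>{0<..1}. (\<integral>\<^sup>+s. indicator {..x} (t powr (1 / c) * s) \<partial>mix_law \<beta> n) \<partial>lborel)"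
    unfolding c_def by (rule nn_integral_mix_law_Suc) simp
  also have "\<dots> = (\<integral>\<^sup>+t. indicator {0<..q} t + ennreal (f t) * indicator {q..1} t \<partial>lborel)"
    using AE_lborel_singleton[of q]
  proof (intro nn_integral_cong_AE, elim eventually_mono)
    fix t assume "t \<noteq> q"
    then consider "t \<le> 0" | "0 < t" "t < q" | "q < t" "t \<le> 1" | "1 < t" by linarith
    then show "(\<integral>\<^sup>+s. indicator {..x} (t powr (1 / c) * s) \<partial>mix_law \<beta> n) * indicator {0<..1} t =
        indicator {0<..q} t + ennreal (f t) * indicator {q..1} t"
      using q by cases (simp_all add: inner1 inner2)
  qed
  also have "\<dots> = (\<integral>\<^sup>+t. indicator {0<..q} t \<partial>lborel) + (\<integral>\<^sup>+t. ennreal (f t) * indicator {q..1} t \<partial>lborel)"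
    by (intro nn_integral_add) (auto simp: f_def)
  also have "(\<integral>\<^sup>+t. ennreal (f t) * indicator {q..1} t \<partial>lborel) = ennreal (F 1 - F q)"
    using q deriv f_nonneg by (intro nn_integral_FTC_Icc) (auto simp: f_def)
  also have "(\<integral>\<^sup>+t. indicator {0<..q} t \<partial>(lborel :: real measure)) = ennreal q"
    using q by simp
  finally have "emeasure (mix_law \<beta> (Suc n)) {..x} = ennreal (q + (F 1 - F q))"
    using F_mono q by simp
  then have "measure (mix_law \<beta> (Suc n)) {..x} = q + (F 1 - F q)"
    using F_mono q by (simp add: measure_def del: mix_law.simps)
  also have "\<dots> = (\<Sum>j=1..n. C_coeff \<beta> j n * (c / (c - \<beta> j) * x powr \<beta> j)) +
      (1 + (\<Sum>j=1..n. C_coeff \<beta> j n * (c / (\<beta> j - c)))) * x powr c"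
  proof -
    have "F q = (\<Sum>j=1..n. C_coeff \<beta> j n * (c / (c - \<beta> j))) * x powr c"
      unfolding F_def q_def sum_distrib_right
    proof (intro sum.cong refl)
      fix j
      have "x powr \<beta> j * (x powr c) powr ((c - \<beta> j) / c) = x powr c"
        using x c0 by (simp add: powr_powr flip: powr_add)
      then show "C_coeff \<beta> j n * (x powr \<beta> j * (c / (c - \<beta> j) * (x powr c) powr ((c - \<beta> j) / c))) =
          C_coeff \<beta> j n * (c / (c - \<beta> j)) * x powr c"
        by (simp only: mult.assoc mult.left_commute[of "x powr \<beta> j"])
    qed
    moreover have "(\<Sum>j=1..n. C_coeff \<beta> j n * (c / (\<beta> j - c))) = - (\<Sum>j=1..n. C_coeff \<beta> j n * (c / (c - \<beta> j)))"
      unfolding sum_negf[symmetric]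
    proof (intro sum.cong refl)
      fix j
      have "c / (\<beta> j - c) = - (c / (c - \<beta> j))" by (metis minus_diff_eq minus_divide_right)
      then show "C_coeff \<beta> j n * (c / (\<beta> j - c)) = - (C_coeff \<beta> j n * (c / (c - \<beta> j)))" by simp
    qed
    moreover have "F 1 = (\<Sum>j=1..n. C_coeff \<beta> j n * (c / (c - \<beta> j) * x powr \<beta> j))"
      unfolding F_def by (intro sum.cong refl) simp
    ultimately show ?thesis by (simp add: q_def ring_distribs)
  qed
  also have "1 + (\<Sum>j=1..n. C_coeff \<beta> j n * (c / (\<beta> j - c))) = (\<Prod>k=1..n. \<beta> k / (\<beta> k - c))"
    by (rule prod_partial_fractions[symmetric, OF inj]) (use cne in blast)
  finally show ?case
    unfolding sum_C_coeff_Suc[of \<beta> n "\<lambda>b. x powr b"] c_def .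
qed

definition mix_density :: "(nat \<Rightarrow> real) \<Rightarrow> nat \<Rightarrow> real \<Rightarrow> real" where
  "mix_density \<beta> n s = (\<Sum>j=1..n. C_coeff \<beta> j n * (\<beta> j * s powr (\<beta> j - 1)))"

lemma borel_measurable_mix_density [measurable]: "mix_density \<beta> n \<in> borel_measurable borel"
  unfolding mix_density_def by measurable

text \<open>
  The coefficients have both signs, so nonnegativity is not visible from the formula. It holds because
  \<open>mix_density\<close> is the derivative of a distribution function.
\<close>

lemma mix_density_nonneg:
  assumes "inj_on \<beta> {1..n}" "\<forall>j\<in>{1..n}. 0 < \<beta> j" "0 \<le> s" "s \<le> 1"
  shows "0 \<le> mix_density \<beta> n s"
proof -
  have inner: "0 \<le> mix_density \<beta> n s" if s: "0 < s" "s < 1" for s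
  proof -
    interpret prob_space "mix_law \<beta> n" by (rule prob_space_mix_law)
    have mono: "mono_on {0<..<1} (\<lambda>x. \<Sum>j=1..n. C_coeff \<beta> j n * x powr \<beta> j)"
    proof (rule mono_onI)
      fix x y :: real assume "x \<in> {0<..<1}" "y \<in> {0<..<1}" "x \<le> y"
      moreover from this have "prob {..x} \<le> prob {..y}" by (intro finite_measure_mono) auto
      ultimately show "(\<Sum>j=1..n. C_coeff \<beta> j n * x powr \<beta> j) \<le> (\<Sum>j=1..n. C_coeff \<beta> j n * y powr \<beta> j)"
        by (simp only: cdf_mix_law[OF assms(1,2)] greaterThanLessThan_iff)
    qed
    have "((\<lambda>x. \<Sum>j=1..n. C_coeff \<beta> j n * x powr \<beta> j) has_real_derivative mix_density \<beta> n s) (at s)"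
      unfolding mix_density_def by (intro DERIV_sum DERIV_cmult has_real_derivative_powr s)
    with mono show ?thesis
      by (rule mono_on_imp_deriv_nonneg) (use s in \<open>simp add: interior_open\<close>)
  qed
  consider "s = 0" | "0 < s" "s < 1" | "s = 1" using assms by linarith
  then show ?thesis
  proof cases
    case 1
    then show ?thesis by (simp add: mix_density_def)
  next
    case 3
    have "continuous (at 1) (mix_density \<beta> n)"
      unfolding mix_density_def by (intro continuous_intros) auto
    then have "(mix_density \<beta> n \<longlongrightarrow> mix_density \<beta> n 1) (at_left 1)"
      unfolding continuous_at by (rule filterlim_mono) (auto simp: at_within_le_at)
    moreover have "\<forall>\<^sub>F s in at_left 1. 0 \<le> mix_density \<beta> n s"
      unfolding eventually_at_left_field by (intro exI[of _ 0]) (auto intro: inner)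
    ultimately show ?thesis
      unfolding 3 by (rule tendsto_lowerbound) simp
  qed (rule inner)
qed

text \<open>
  Besides the distribution function (\<open>p = 0\<close>) this yields the truncated first moment, from which the
  vectors \<^const>\<open>b_vec\<close> arise, and the second moment. The combination of powers is integrated as a
  whole, since the individual terms need not be nonnegative.
\<close>

lemma nn_integral_mix_density_moment:
  assumes \<beta>: "inj_on \<beta> {1..n}" "\<forall>j\<in>{1..n}. 0 < \<beta> j" and r: "0 < r" "r \<le> 1" and p: "0 \<le> p"
  defines "v \<equiv> \<Sum>j=1..n. C_coeff \<beta> j n * (\<beta> j / (\<beta> j + p) * r powr (\<beta> j + p))"
  shows "(\<integral>\<^sup>+s\<in>{0<..r}. ennreal (s powr p * mix_density \<beta> n s) \<partial>lborel) = ennreal v" and "0 \<le> v"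
proof -
  let ?g = "\<lambda>s. s powr p * mix_density \<beta> n s"
  let ?f = "\<lambda>s. if s \<in> {0..r} then ?g s else 0"
  have nonneg: "0 \<le> ?f s" for s using mix_density_nonneg[OF \<beta>, of s] r by simp
  have g: "?g s = (\<Sum>j=1..n. C_coeff \<beta> j n * (\<beta> j * s powr (\<beta> j + p - 1)))" if "0 \<le> s" for s
    unfolding mix_density_def sum_distrib_left
  proof (intro sum.cong refl)
    fix j
    have "s powr p * s powr (\<beta> j - 1) = s powr (\<beta> j + p - 1)" by (simp add: algebra_simps flip: powr_add)
    then show "s powr p * (C_coeff \<beta> j n * (\<beta> j * s powr (\<beta> j - 1))) = C_coeff \<beta> j n * (\<beta> j * s powr (\<beta> j + p - 1))"
      by (metis mult.left_commute)
  qed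
  have "((\<lambda>s. \<Sum>j=1..n. C_coeff \<beta> j n * (\<beta> j * s powr (\<beta> j + p - 1))) has_integral v) {0..r}"
    unfolding v_def
  proof (intro has_integral_sum has_integral_mult_right)
    fix j assume j: "j \<in> {1..n}"
    have "((\<lambda>s. s powr (\<beta> j + p - 1)) has_integral r powr (\<beta> j + p - 1 + 1) / (\<beta> j + p - 1 + 1)) {0..r}"
      using bspec[OF \<beta>(2) j] p r by (intro has_integral_powr_from_0) auto
    then have "((\<lambda>s. \<beta> j * s powr (\<beta> j + p - 1)) has_integral \<beta> j * (r powr (\<beta> j + p) / (\<beta> j + p))) {0..r}"
      by (intro has_integral_mult_right) simp
    then show "((\<lambda>s. \<beta> j * s powr (\<beta> j + p - 1)) has_integral \<beta> j / (\<beta> j + p) * r powr (\<beta> j + p)) {0..r}"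
      by simp
  qed auto
  then have "(?g has_integral v) {0..r}"
    by (rule has_integral_eq[rotated]) (simp add: g)
  then have int: "(?f has_integral v) UNIV"
    by (simp only: has_integral_restrict_UNIV)
  then show "0 \<le> v" by (rule has_integral_nonneg) (rule nonneg)
  have "(\<integral>\<^sup>+s. ennreal (?f s) \<partial>lborel) = ennreal v"
    by (rule nn_integral_has_integral_lborel[OF _ nonneg int]) simp
  moreover have "ennreal (?f s) = ennreal (?g s) * indicator {0<..r} s" for s
    by (cases "s = 0") (auto simp: mix_density_def)
  ultimately show "(\<integral>\<^sup>+s\<in>{0<..r}. ennreal (?g s) \<partial>lborel) = ennreal v"
    by simp
qed

lemma mix_law_density:
  assumes \<beta>: "inj_on \<beta> {1..n}" "\<forall>j\<in>{1..n}. 0 < \<beta> j" and n: "1 \<le> n"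
  shows "mix_law \<beta> n = density lborel (\<lambda>s. ennreal (mix_density \<beta> n s) * indicator {0<..1} s)" (is "_ = ?D")
proof (rule cdf_unique')
  interpret prob_space "mix_law \<beta> n" by (rule prob_space_mix_law)
  show "finite_borel_measure (mix_law \<beta> n)"
    by (intro finite_borel_measure.intro finite_measure_axioms finite_borel_measure_axioms.intro) simp
  have D: "emeasure ?D {..r} = ennreal (\<Sum>j=1..n. C_coeff \<beta> j n * r powr \<beta> j)"
    "0 \<le> (\<Sum>j=1..n. C_coeff \<beta> j n * r powr \<beta> j)" if r: "0 < r" "r \<le> 1" for r
  proof -
    have "emeasure ?D {..r} = (\<integral>\<^sup>+s\<in>{0<..r}. ennreal (s powr 0 * mix_density \<beta> n s) \<partial>lborel)"
      using r by (subst emeasure_density) (auto intro!: nn_integral_cong simp: indicator_def)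
    moreover have "\<beta> j / (\<beta> j + 0) = 1" if "j \<in> {1..n}" for j using bspec[OF \<beta>(2) that] by simp
    ultimately show "emeasure ?D {..r} = ennreal (\<Sum>j=1..n. C_coeff \<beta> j n * r powr \<beta> j)"
      "0 \<le> (\<Sum>j=1..n. C_coeff \<beta> j n * r powr \<beta> j)"
      using nn_integral_mix_density_moment[OF \<beta> r order_refl] by simp_all
  qed
  have total: "emeasure ?D {..r} = 1" if "1 \<le> r" for r
  proof -
    have "emeasure ?D {..r} = emeasure ?D {..1}"
      using that by (subst (1 2) emeasure_density) (auto intro!: nn_integral_cong simp: indicator_def)
    then show ?thesis using D(1)[of 1] sum_C_coeff[OF \<beta>(1)] n by simp
  qed
  have "emeasure ?D UNIV = emeasure ?D {..1}"
    by (subst (1 2) emeasure_density) (auto intro!: nn_integral_cong simp: indicator_def)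
  then have "finite_measure ?D"
    using total[of 1] by (intro finite_measureI) simp
  then show "finite_borel_measure ?D"
    by (intro finite_borel_measure.intro finite_borel_measure_axioms.intro) simp_all
  show "cdf (mix_law \<beta> n) = cdf ?D"
  proof
    fix x :: real
    consider "x \<le> 0" | "0 < x" "x < 1" | "1 \<le> x" by linarith
    then show "cdf (mix_law \<beta> n) x = cdf ?D x"
      unfolding cdf_def
    proof cases
      case 1
      have "emeasure ?D {..x} =
          (\<integral>\<^sup>+s. ennreal (mix_density \<beta> n s) * indicator {0<..1} s * indicator {..x} s \<partial>lborel)"
        by (rule emeasure_density) simp_all
      also have "\<dots> = (\<integral>\<^sup>+s. 0 \<partial>(lborel :: real measure))"
        by (rule nn_integral_cong) (use 1 in \<open>simp add: indicator_def\<close>)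
      finally have "emeasure ?D {..x} = 0" by simp
      moreover have "prob {..x} = 0"
        using AE_mix_law[OF \<beta>(2)] 1 by (intro prob_eq_0[THEN iffD2]) (auto elim!: eventually_mono simp del: AE_conj_iff)
      ultimately show "measure (mix_law \<beta> n) {..x} = measure ?D {..x}"
        by (simp add: measure_def)
    next
      case 2
      then show "measure (mix_law \<beta> n) {..x} = measure ?D {..x}"
        using D[of x] unfolding cdf_mix_law[OF \<beta> 2] measure_def[of ?D] by simp
    next
      case 3
      have "prob {..x} = 1"
        using AE_mix_law[OF \<beta>(2)] 3 by (intro prob_eq_1[THEN iffD2]) (auto elim!: eventually_mono simp del: AE_conj_iff)
      then show "measure (mix_law \<beta> n) {..x} = measure ?D {..x}"
        using total[OF 3] by (simp add: measure_def)
    qed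
  qed
qed

lemma integral_mix_law_moment:
  assumes \<beta>: "inj_on \<beta> {1..n}" "\<forall>j\<in>{1..n}. 0 < \<beta> j" and n: "1 \<le> n"
    and r: "0 < r" "r \<le> 1" and p: "0 \<le> p"
  shows "(LINT s|mix_law \<beta> n. indicator {0<..r} s * s powr p) =
      (\<Sum>j=1..n. C_coeff \<beta> j n * (\<beta> j / (\<beta> j + p) * r powr (\<beta> j + p)))"
proof -
  let ?v = "\<Sum>j=1..n. C_coeff \<beta> j n * (\<beta> j / (\<beta> j + p) * r powr (\<beta> j + p))"
  have "(\<integral>\<^sup>+s. ennreal (indicator {0<..r} s * s powr p) \<partial>mix_law \<beta> n) =
      (\<integral>\<^sup>+s\<in>{0<..r}. ennreal (s powr p * mix_density \<beta> n s) \<partial>lborel)"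
    unfolding mix_law_density[OF \<beta> n] using r
    by (subst nn_integral_density) (auto intro!: nn_integral_cong simp: indicator_def ennreal_mult' mult.commute)
  then have eq: "(\<integral>\<^sup>+s. ennreal (indicator {0<..r} s * s powr p) \<partial>mix_law \<beta> n) = ennreal ?v"
    using nn_integral_mix_density_moment(1)[OF \<beta> r p] by simp
  then show "(LINT s|mix_law \<beta> n. indicator {0<..r} s * s powr p) = ?v"
    using nn_integral_mix_density_moment(2)[OF \<beta> r p] by (subst integral_eq_nn_integral) simp_all
qed

text \<open>
  As \<^const>\<open>ennreal\<close> cuts off negative numbers, the coefficients \<open>ennreal (- C j)\<close> and
  \<open>ennreal (C j)\<close> are the negative and positive parts of \<open>C j\<close>.
\<close>

lemma ennreal_signed_sum_iff:
  fixes C d :: "'i \<Rightarrow> real"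
  assumes x: "0 \<le> x" and d: "\<forall>j\<in>S. 0 \<le> d j"
  shows "ennreal x + (\<Sum>j\<in>S. ennreal (- C j) * ennreal (d j)) = (\<Sum>j\<in>S. ennreal (C j) * ennreal (d j)) \<longleftrightarrow>
    x = (\<Sum>j\<in>S. C j * d j)"
proof -
  have e: "(\<Sum>j\<in>S. ennreal (a j) * ennreal (d j)) = ennreal (\<Sum>j\<in>S. max 0 (a j) * d j)" for a
  proof -
    have "(\<Sum>j\<in>S. ennreal (a j) * ennreal (d j)) = (\<Sum>j\<in>S. ennreal (max 0 (a j) * d j))"
      using d by (intro sum.cong refl) (simp add: ennreal_mult ennreal_max_0)
    also have "\<dots> = ennreal (\<Sum>j\<in>S. max 0 (a j) * d j)"
      using d by (intro sum_ennreal) simp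
    finally show ?thesis .
  qed
  have nonneg: "0 \<le> (\<Sum>j\<in>S. max 0 (a j) * d j)" for a
    using d by (intro sum_nonneg) simp
  have "(\<Sum>j\<in>S. C j * d j) = (\<Sum>j\<in>S. max 0 (C j) * d j) - (\<Sum>j\<in>S. max 0 (- C j) * d j)"
    unfolding sum_subtractf[symmetric] by (intro sum.cong refl) (simp add: max_def)
  then show ?thesis
    unfolding e using x nonneg by (simp add: ennreal_inj flip: ennreal_plus) linarith
qed

text \<open>
  The identity between the finite densities holds pointwise, and integrating it against \<open>g\<close> needs no
  cancellation of possibly infinite terms.
\<close>

lemma nn_integral_mix_law_signed:
  assumes \<beta>: "inj_on \<beta> {1..n}" "\<forall>j\<in>{1..n}. 0 < \<beta> j" and n: "1 \<le> n"
    and [measurable]: "g \<in> borel_measurable borel"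
  shows "(\<integral>\<^sup>+s. g s \<partial>mix_law \<beta> n) +
      (\<Sum>j=1..n. ennreal (- C_coeff \<beta> j n) * (\<integral>\<^sup>+s. g s \<partial>mix_law (\<lambda>_. \<beta> j) 1)) =
      (\<Sum>j=1..n. ennreal (C_coeff \<beta> j n) * (\<integral>\<^sup>+s. g s \<partial>mix_law (\<lambda>_. \<beta> j) 1))"
proof -
  let ?C = "\<lambda>j. C_coeff \<beta> j n" and ?d = "\<lambda>j s. \<beta> j * s powr (\<beta> j - 1)"
  have single: "(\<integral>\<^sup>+s. g s \<partial>mix_law (\<lambda>_. \<beta> j) 1) = (\<integral>\<^sup>+s\<in>{0<..1}. ennreal (?d j s) * g s \<partial>lborel)"
    if j: "j \<in> {1..n}" for j
  proof -
    have "mix_law (\<lambda>_. \<beta> j) 1 = density lborel (\<lambda>s. ennreal (mix_density (\<lambda>_. \<beta> j) 1 s) * indicator {0<..1} s)"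
      using bspec[OF \<beta>(2) j] by (intro mix_law_density) auto
    moreover have "mix_density (\<lambda>_. \<beta> j) 1 s = ?d j s" for s
      by (simp add: mix_density_def C_coeff_def)
    ultimately show ?thesis
      by (simp add: nn_integral_density mult_ac del: mix_law.simps One_nat_def)
  qed
  have "ennreal (mix_density \<beta> n s) + (\<Sum>j=1..n. ennreal (- ?C j) * ennreal (?d j s)) =
      (\<Sum>j=1..n. ennreal (?C j) * ennreal (?d j s))" if s: "0 < s" "s \<le> 1" for s
  proof (rule ennreal_signed_sum_iff[THEN iffD2])
    show "0 \<le> mix_density \<beta> n s" using mix_density_nonneg[OF \<beta>] that by simp
    show "\<forall>j\<in>{1..n}. 0 \<le> ?d j s" using \<beta>(2) by (auto intro!: mult_nonneg_nonneg simp: less_imp_le)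
  qed (simp add: mix_density_def)
  note pointwise = this
  have "(\<integral>\<^sup>+s. g s \<partial>mix_law \<beta> n) + (\<Sum>j=1..n. ennreal (- ?C j) * (\<integral>\<^sup>+s. g s \<partial>mix_law (\<lambda>_. \<beta> j) 1)) =
      (\<integral>\<^sup>+s. ennreal (mix_density \<beta> n s) * indicator {0<..1} s * g s \<partial>lborel) +
      (\<Sum>j=1..n. \<integral>\<^sup>+s. ennreal (- ?C j) * (ennreal (?d j s) * g s * indicator {0<..1} s) \<partial>lborel)"
    unfolding mix_law_density[OF \<beta> n]
    by (intro arg_cong2[where f = "(+)"] sum.cong refl)
      (simp_all add: nn_integral_density single nn_integral_cmult del: mix_law.simps One_nat_def)
  also have "\<dots> = (\<integral>\<^sup>+s. ennreal (mix_density \<beta> n s) * indicator {0<..1} s * g s +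
      (\<Sum>j=1..n. ennreal (- ?C j) * (ennreal (?d j s) * g s * indicator {0<..1} s)) \<partial>lborel)"
    by (simp add: nn_integral_add nn_integral_sum)
  also have "\<dots> = (\<integral>\<^sup>+s. (\<Sum>j=1..n. ennreal (?C j) * (ennreal (?d j s) * g s * indicator {0<..1} s)) \<partial>lborel)"
  proof (intro nn_integral_cong)
    fix s :: real
    show "ennreal (mix_density \<beta> n s) * indicator {0<..1} s * g s +
        (\<Sum>j=1..n. ennreal (- ?C j) * (ennreal (?d j s) * g s * indicator {0<..1} s)) =
        (\<Sum>j=1..n. ennreal (?C j) * (ennreal (?d j s) * g s * indicator {0<..1} s))"
    proof (cases "0 < s \<and> s \<le> 1")
      case True
      then have "ennreal (mix_density \<beta> n s) * indicator {0<..1} s * g s +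
          (\<Sum>j=1..n. ennreal (- ?C j) * (ennreal (?d j s) * g s * indicator {0<..1} s)) =
          (ennreal (mix_density \<beta> n s) + (\<Sum>j=1..n. ennreal (- ?C j) * ennreal (?d j s))) * g s"
        by (simp add: distrib_left distrib_right sum_distrib_left sum_distrib_right mult_ac)
      also have "\<dots> = (\<Sum>j=1..n. ennreal (?C j) * ennreal (?d j s)) * g s"
        using True by (simp only: pointwise)
      finally show ?thesis using True by (simp add: sum_distrib_left sum_distrib_right mult_ac)
    qed simp
  qed
  also have "\<dots> = (\<Sum>j=1..n. ennreal (?C j) * (\<integral>\<^sup>+s. g s \<partial>mix_law (\<lambda>_. \<beta> j) 1))"
    by (subst nn_integral_sum, simp, intro sum.cong refl) (simp add: single nn_integral_cmult del: mix_law.simps One_nat_def)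
  finally show ?thesis .
qed

section \<open>Mixtures of L\'evy exponents\<close>

lemma sigma_finite_levy_spectral_measure:
  assumes M: "levy_spectral_measure M"
  shows "sigma_finite_measure M"
proof
  let ?f = "\<lambda>x. min 1 ((norm x)\<^sup>2) :: real"
  let ?A = "\<lambda>k. {x \<in> space M. 1 / real (Suc k) \<le> ?f x}"
  have meas: "?A k \<in> sets M" for k
  proof -
    have [measurable]: "?f \<in> borel_measurable M" by (rule measurable_levy_spectral_measure[OF M]) simp
    show ?thesis by measurable
  qed
  have fin: "emeasure M (?A k) < \<infinity>" for k
  proof -
    have "emeasure M (?A k) = (\<integral>\<^sup>+x. indicator (?A k) x \<partial>M)" using meas by simp
    also have "\<dots> \<le> (\<integral>\<^sup>+x. ennreal (real (Suc k) * ?f x) \<partial>M)"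
    proof (intro nn_integral_mono)
      fix x
      have "1 \<le> real (Suc k) * ?f x" if "x \<in> ?A k"
        using that by (simp only: mem_Collect_eq pos_divide_le_eq of_nat_0_less_iff zero_less_Suc mult.commute)
      then have "1 \<le> ennreal (real (Suc k) * ?f x)" if "x \<in> ?A k"
        using that ennreal_leI[of 1 "real (Suc k) * ?f x"] unfolding ennreal_1 by blast
      then show "indicator (?A k) x \<le> ennreal (real (Suc k) * ?f x)"
      proof (cases "x \<in> ?A k")
        case False
        then have "indicator (?A k) x = (0 :: ennreal)" by (rule indicator_simps(2))
        then show ?thesis by (simp only: zero_le)
      qed (simp only: indicator_simps(1))
    qed
    also have "\<dots> = ennreal (LINT x|M. real (Suc k) * ?f x)"
      using integrable_min_levy_spectral_measure[OF M]
      by (intro nn_integral_eq_integral) auto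
    finally show ?thesis by (simp add: order_le_less_trans)
  qed
  have "(\<Union>k. ?A k) = space M"
  proof safe
    fix x assume x: "x \<in> space M"
    then have "0 < ?f x" by (simp add: space_levy_spectral_measure[OF M])
    then obtain k where "1 / real (Suc k) < ?f x"
      using reals_Archimedean[of "?f x"] by (auto simp: inverse_eq_divide)
    then show "x \<in> (\<Union>k. ?A k)" using x less_imp_le by blast
  qed
  then show "\<exists>A. countable A \<and> A \<subseteq> sets M \<and> \<Union> A = space M \<and> (\<forall>a\<in>A. emeasure M a \<noteq> \<infinity>)"
    using meas fin by (intro exI[of _ "range ?A"]) (auto simp: less_top[symmetric])
qed

text \<open>
  At \<open>s = 0\<close> both sides are 0: the image in the definition of \<^const>\<open>dilation\<close> is then contained in
  \<open>{0}\<close>, which is not a set of \<open>M\<close>. Thus measurability in \<open>s\<close> can be settled on the whole line.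
\<close>

lemma dilation_eq_emeasure_vimage:
  assumes M: "levy_spectral_measure M" and A: "A \<in> sets borel" "0 \<notin> A"
  shows "dilation s M A = emeasure M {x \<in> space M. s *\<^sub>R x \<in> A}"
proof (cases "s = 0")
  case True
  have "(\<lambda>x. inverse s *\<^sub>R x) ` A \<subseteq> {0}" using True by auto
  moreover have "emeasure M {0} = 0"
    by (rule emeasure_notin_sets) (use sets.sets_into_space[of "{0}" M] space_levy_spectral_measure[OF M] in auto)
  ultimately have "dilation s M A = 0"
    unfolding dilation_def by (metis emeasure_empty subset_singletonD)
  moreover have "{x \<in> space M. s *\<^sub>R x \<in> A} = {}" using True A by auto
  ultimately show ?thesis by (simp only: emeasure_empty)
next
  case False
  have "(\<lambda>x. inverse s *\<^sub>R x) ` A = {x \<in> space M. s *\<^sub>R x \<in> A}"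
  proof (intro set_eqI iffI)
    fix x assume "x \<in> {x \<in> space M. s *\<^sub>R x \<in> A}"
    then show "x \<in> (\<lambda>x. inverse s *\<^sub>R x) ` A"
      using False by (intro image_eqI[of _ _ "s *\<^sub>R x"]) auto
  qed (use False A in \<open>auto simp: space_levy_spectral_measure[OF M]\<close>)
  then show ?thesis by (simp add: dilation_def)
qed

lemma measurable_dilation:
  assumes M: "levy_spectral_measure M" and A [measurable]: "A \<in> sets borel" and A0: "0 \<notin> A"
  shows "(\<lambda>s. dilation s M A) \<in> borel_measurable borel"
proof -
  interpret M: sigma_finite_measure M by (rule sigma_finite_levy_spectral_measure[OF M])
  have [measurable]: "snd \<in> borel_measurable ((borel :: real measure) \<Otimes>\<^sub>M M)"
    by (rule measurable_compose[OF measurable_snd measurable_levy_spectral_measure[OF M]]) simp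
  let ?Q = "{p \<in> space (borel \<Otimes>\<^sub>M M). fst p *\<^sub>R snd p \<in> A}"
  have "(\<lambda>s. emeasure M (Pair s -` ?Q)) \<in> borel_measurable (borel :: real measure)"
    by (rule M.measurable_emeasure_Pair) measurable
  moreover have "Pair s -` ?Q = {x \<in> space M. s *\<^sub>R x \<in> A}" for s
    by (auto simp: space_pair_measure)
  ultimately show ?thesis by (simp add: dilation_eq_emeasure_vimage[OF M A A0])
qed

text \<open>
  The image of \<open>\<kappa> \<otimes> M\<close> under \<open>(s,x) \<mapsto> s x\<close>. For \<open>s = 0\<close>, a \<open>\<kappa>\<close>-null event in the applications, the
  point \<open>x\<close> is left in place, so that the map takes values in the punctured space, the carrier of \<open>M\<close>.
\<close>

definition mix_levy :: "real measure \<Rightarrow> 'a::euclidean_space measure \<Rightarrow> 'a measure" where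
  "mix_levy \<kappa> M = distr (\<kappa> \<Otimes>\<^sub>M M) M (\<lambda>(s, x). if s = 0 then x else s *\<^sub>R x)"

context
  fixes \<kappa> :: "real measure" and M :: "'a::euclidean_space measure"
  assumes \<kappa>: "prob_space \<kappa>" and sets_\<kappa>: "sets \<kappa> = sets borel" and AE_\<kappa>: "AE s in \<kappa>. 0 < s \<and> s \<le> 1"
    and M: "levy_spectral_measure M"
begin

interpretation \<kappa>: prob_space \<kappa> by (rule \<kappa>)
interpretation M: sigma_finite_measure M by (rule sigma_finite_levy_spectral_measure[OF M])
interpretation P: pair_sigma_finite \<kappa> M
  by (simp add: pair_sigma_finite_def M.sigma_finite_measure_axioms \<kappa>.sigma_finite_measure_axioms)

declare sets_\<kappa> [measurable_cong]

lemma space_mixing: "space \<kappa> = UNIV"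
  using sets_eq_imp_space_eq[OF sets_\<kappa>] by simp

lemma snd_measurable_levy [measurable]: "snd \<in> borel_measurable (\<kappa> \<Otimes>\<^sub>M M)"
  by (rule measurable_compose[OF measurable_snd measurable_levy_spectral_measure[OF M]]) simp

lemma scale_measurable: "(\<lambda>(s, x). if s = 0 then x else s *\<^sub>R x) \<in> \<kappa> \<Otimes>\<^sub>M M \<rightarrow>\<^sub>M M"
proof -
  have "(\<lambda>(s, x). if s = 0 then x else s *\<^sub>R x) \<in> \<kappa> \<Otimes>\<^sub>M M \<rightarrow>\<^sub>M restrict_space borel (UNIV - {0})"
  proof (rule measurable_restrict_space2)
    show "(\<lambda>(s, x). if s = 0 then x else s *\<^sub>R x) \<in> space (\<kappa> \<Otimes>\<^sub>M M) \<rightarrow> UNIV - {0}"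
      by (auto simp: space_pair_measure space_levy_spectral_measure[OF M] split: if_splits)
    show "(\<lambda>(s, x). if s = 0 then x else s *\<^sub>R x) \<in> borel_measurable (\<kappa> \<Otimes>\<^sub>M M)"
      unfolding case_prod_beta by measurable
  qed
  then show ?thesis
    using measurable_cong_sets[OF refl sets_levy_spectral_measure[OF M]] by blast
qed

lemma AE_pair_mixing: "AE p in \<kappa> \<Otimes>\<^sub>M M. 0 < fst p \<and> fst p \<le> 1"
proof (rule P.AE_pair_measure)
  show "AE s in \<kappa>. AE x in M. 0 < fst (s, x) \<and> fst (s, x) \<le> 1"
    using AE_\<kappa> by (rule eventually_mono) simp
qed measurable

lemma levy_spectral_measure_mix_levy: "levy_spectral_measure (mix_levy \<kappa> M)"
  unfolding levy_spectral_measure_def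
proof
  show "sets (mix_levy \<kappa> M) = sets (restrict_space borel (UNIV - {0}))"
    by (simp add: mix_levy_def sets_levy_spectral_measure[OF M])
  let ?f = "\<lambda>x. ennreal (min 1 ((norm x)\<^sup>2))"
  have f [measurable]: "?f \<in> borel_measurable M"
    by (rule measurable_levy_spectral_measure[OF M]) simp
  have "(\<integral>\<^sup>+x. ?f x \<partial>mix_levy \<kappa> M) = (\<integral>\<^sup>+p. ?f (case p of (s, x) \<Rightarrow> if s = 0 then x else s *\<^sub>R x) \<partial>(\<kappa> \<Otimes>\<^sub>M M))"
    unfolding mix_levy_def by (rule nn_integral_distr[OF scale_measurable]) (simp add: f)
  also have "\<dots> \<le> (\<integral>\<^sup>+p. ?f (snd p) \<partial>(\<kappa> \<Otimes>\<^sub>M M))"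
  proof (rule nn_integral_mono_AE, rule eventually_mono[OF AE_pair_mixing])
    fix p :: "real \<times> 'a" assume p: "0 < fst p \<and> fst p \<le> 1"
    have "fst p * norm (snd p) \<le> 1 * norm (snd p)"
      using p by (intro mult_right_mono) auto
    then have "norm (fst p *\<^sub>R snd p) \<le> norm (snd p)" using p by simp
    then have "(norm (fst p *\<^sub>R snd p))\<^sup>2 \<le> (norm (snd p))\<^sup>2" by (intro power_mono) auto
    then show "?f (case p of (s, x) \<Rightarrow> if s = 0 then x else s *\<^sub>R x) \<le> ?f (snd p)"
      using p unfolding case_prod_beta by (intro ennreal_leI min.mono) auto
  qed
  also have "\<dots> = (\<integral>\<^sup>+s. (\<integral>\<^sup>+x. ?f x \<partial>M) \<partial>\<kappa>)"
    by (subst M.nn_integral_fst[symmetric]) auto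
  also have "\<dots> < \<infinity>"
    using M by (simp add: \<kappa>.emeasure_space_1 levy_spectral_measure_def)
  finally show "(\<integral>\<^sup>+x. ?f x \<partial>mix_levy \<kappa> M) < \<infinity>" .
qed

lemma emeasure_mix_levy:
  assumes A [measurable]: "A \<in> sets borel" and A0: "0 \<notin> A"
  shows "emeasure (mix_levy \<kappa> M) A = (\<integral>\<^sup>+s. dilation s M A \<partial>\<kappa>)"
proof -
  have AM: "A \<in> sets M"
    using A A0 by (auto simp: sets_levy_spectral_measure[OF M] sets_restrict_space_iff)
  let ?T = "\<lambda>(s, x). if s = 0 then x else s *\<^sub>R x"
  let ?Q = "?T -` A \<inter> space (\<kappa> \<Otimes>\<^sub>M M)"
  have "emeasure (mix_levy \<kappa> M) A = emeasure (\<kappa> \<Otimes>\<^sub>M M) ?Q"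
    unfolding mix_levy_def by (rule emeasure_distr[OF scale_measurable AM])
  also have "\<dots> = (\<integral>\<^sup>+s. emeasure M (Pair s -` ?Q) \<partial>\<kappa>)"
    by (rule M.emeasure_pair_measure_alt) (rule measurable_sets[OF scale_measurable AM])
  also have "\<dots> = (\<integral>\<^sup>+s. dilation s M A \<partial>\<kappa>)"
  proof (rule nn_integral_cong_AE, rule eventually_mono[OF AE_\<kappa>])
    fix s :: real assume "0 < s \<and> s \<le> 1"
    then have "Pair s -` ?Q = {x \<in> space M. s *\<^sub>R x \<in> A}"
      by (auto simp: space_pair_measure space_mixing)
    then show "emeasure M (Pair s -` ?Q) = dilation s M A"
      by (simp add: dilation_eq_emeasure_vimage[OF M A A0])
  qed
  finally show ?thesis .
qed

lemma integrable_pair_dominated: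
  fixes f :: "real \<times> 'a \<Rightarrow> 'z::{banach, second_countable_topology}"
  assumes [measurable]: "f \<in> borel_measurable (\<kappa> \<Otimes>\<^sub>M M)"
    and bound: "\<And>s x. 0 < s \<Longrightarrow> s \<le> 1 \<Longrightarrow> norm (f (s, x)) \<le> K * min 1 ((norm x)\<^sup>2)"
  shows "integrable (\<kappa> \<Otimes>\<^sub>M M) f"
proof (rule Bochner_Integration.integrable_bound)
  have i: "integrable M (\<lambda>x. K * min 1 ((norm x)\<^sup>2))"
    using integrable_min_levy_spectral_measure[OF M] by simp
  have m: "(\<lambda>p. K * min 1 ((norm (snd p))\<^sup>2)) \<in> borel_measurable (\<kappa> \<Otimes>\<^sub>M M)"
    by measurable
  show "integrable (\<kappa> \<Otimes>\<^sub>M M) (\<lambda>p. K * min 1 ((norm (snd p))\<^sup>2))"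
    using i m by (intro P.Fubini_integrable) (simp_all add: case_prod_beta)
  show "AE p in \<kappa> \<Otimes>\<^sub>M M. norm (f p) \<le> norm (K * min 1 ((norm (snd p))\<^sup>2))"
  proof (rule eventually_mono[OF AE_pair_mixing])
    fix p :: "real \<times> 'a" assume "0 < fst p \<and> fst p \<le> 1"
    then show "norm (f p) \<le> norm (K * min 1 ((norm (snd p))\<^sup>2))"
      using bound[of "fst p" "snd p"] by (simp add: order_trans[OF _ abs_ge_self])
  qed
qed measurable

text \<open>
  Fubini's theorem, together with a change of compensator. The compensator of \<open>\<Phi> (s y)\<close> is cut off at
  \<open>\<bar>x\<bar> \<le> 1\<close>, whereas that of the dilated measure is cut off at \<open>\<bar>s x\<bar> \<le> 1\<close>. For \<open>0 < s \<le> 1\<close> the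
  difference is \<open>s x\<close> on \<open>1 < \<bar>x\<bar> \<le> 1/s\<close>, and its average is the correction of the shift.
\<close>

lemma levy_exponent_mixture:
  assumes R: "linear R"
  shows "(LINT s|\<kappa>. levy_exponent a R M (s *\<^sub>R y)) =
    levy_exponent ((LINT s|\<kappa>. s) *\<^sub>R a +
        (LINT x:{x. 1 < norm x}|M. (LINT s|\<kappa>. indicator {0<..1 / norm x} s * s) *\<^sub>R x))
      (\<lambda>x. (LINT s|\<kappa>. s\<^sup>2) *\<^sub>R R x) (mix_levy \<kappa> M) y"
proof -
  define G where "G = (\<lambda>p :: real \<times> 'a. indicator {p. 0 < fst p \<and> 1 < norm (snd p) \<and> fst p * norm (snd p) \<le> 1} p *\<^sub>R (fst p *\<^sub>R snd p))"
  let ?\<psi>1 = "\<lambda>p :: real \<times> 'a. levy_integrand (fst p *\<^sub>R y) (snd p)"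
  let ?\<psi>2 = "\<lambda>p :: real \<times> 'a. levy_integrand y (fst p *\<^sub>R snd p)"
  have G_bound: "norm (G (s, x)) \<le> 1 * min 1 ((norm x)\<^sup>2)" if "0 < s" for s x
  proof (cases "1 < norm x \<and> s * norm x \<le> 1")
    case True
    then have "1 < (norm x)\<^sup>2" by (simp add: one_less_power)
    with True that show ?thesis by (simp add: G_def)
  qed (auto simp: G_def)
  have G_meas [measurable]: "G \<in> borel_measurable (\<kappa> \<Otimes>\<^sub>M M)"
    unfolding G_def by measurable
  have iG: "integrable (\<kappa> \<Otimes>\<^sub>M M) G"
    by (rule integrable_pair_dominated[OF G_meas G_bound])
  have i1: "integrable (\<kappa> \<Otimes>\<^sub>M M) ?\<psi>1"
  proof (rule integrable_pair_dominated)
    fix s :: real and x :: 'a assume s: "0 < s" "s \<le> 1"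
    then have "(norm (s *\<^sub>R y))\<^sup>2 \<le> (norm y)\<^sup>2"
      by (intro power_mono) (auto intro: mult_left_le_one_le)
    then have "(2 + (norm (s *\<^sub>R y))\<^sup>2) * min 1 ((norm x)\<^sup>2) \<le> (2 + (norm y)\<^sup>2) * min 1 ((norm x)\<^sup>2)"
      by (intro mult_right_mono) auto
    then show "norm (?\<psi>1 (s, x)) \<le> (2 + (norm y)\<^sup>2) * min 1 ((norm x)\<^sup>2)"
      using norm_levy_integrand_le[of "s *\<^sub>R y" x] by simp
  qed measurable
  have i2: "integrable (\<kappa> \<Otimes>\<^sub>M M) ?\<psi>2"
  proof (rule integrable_pair_dominated)
    fix s :: real and x :: 'a assume s: "0 < s" "s \<le> 1"
    then have "(norm (s *\<^sub>R x))\<^sup>2 \<le> (norm x)\<^sup>2"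
      by (intro power_mono) (auto intro: mult_left_le_one_le)
    then have "(2 + (norm y)\<^sup>2) * min 1 ((norm (s *\<^sub>R x))\<^sup>2) \<le> (2 + (norm y)\<^sup>2) * min 1 ((norm x)\<^sup>2)"
      by (intro mult_left_mono min.mono) auto
    then show "norm (?\<psi>2 (s, x)) \<le> (2 + (norm y)\<^sup>2) * min 1 ((norm x)\<^sup>2)"
      using norm_levy_integrand_le[of y "s *\<^sub>R x"] by simp
  qed measurable
  \<comment> \<open>Dilating a jump into the unit ball changes its compensator; \<open>G\<close> collects these changes.\<close>
  have split: "?\<psi>1 p = ?\<psi>2 p + \<i> * of_real (y \<bullet> G p)" if "0 < fst p \<and> fst p \<le> 1" for p
  proof -
    have "fst p * norm (snd p) \<le> 1" if "norm (snd p) \<le> 1"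
      using that \<open>0 < fst p \<and> fst p \<le> 1\<close> by (simp add: mult_le_one)
    then show ?thesis
      using that by (auto simp: levy_integrand_def G_def indicator_def)
  qed
  have inner: "(CLINT p|(\<kappa> \<Otimes>\<^sub>M M). ?\<psi>1 p) =
      (CLINT x|mix_levy \<kappa> M. levy_integrand y x) + \<i> * of_real (y \<bullet> (LINT p|(\<kappa> \<Otimes>\<^sub>M M). G p))"
  proof -
    have "(CLINT p|(\<kappa> \<Otimes>\<^sub>M M). ?\<psi>1 p) = (CLINT p|(\<kappa> \<Otimes>\<^sub>M M). ?\<psi>2 p + \<i> * of_real (y \<bullet> G p))"
      by (rule integral_cong_AE) (measurable, rule eventually_mono[OF AE_pair_mixing split])
    also have "\<dots> = (CLINT p|(\<kappa> \<Otimes>\<^sub>M M). ?\<psi>2 p) + \<i> * of_real (y \<bullet> (LINT p|(\<kappa> \<Otimes>\<^sub>M M). G p))"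
      using iG by (subst Bochner_Integration.integral_add[OF i2]) auto
    also have "(CLINT p|(\<kappa> \<Otimes>\<^sub>M M). ?\<psi>2 p) = (CLINT p|(\<kappa> \<Otimes>\<^sub>M M). levy_integrand y (case p of (s, x) \<Rightarrow> if s = 0 then x else s *\<^sub>R x))"
    proof (rule integral_cong_AE)
      show "AE p in \<kappa> \<Otimes>\<^sub>M M. ?\<psi>2 p = levy_integrand y (case p of (s, x) \<Rightarrow> if s = 0 then x else s *\<^sub>R x)"
        by (rule eventually_mono[OF AE_pair_mixing]) (auto simp: case_prod_beta)
      show "(\<lambda>p. levy_integrand y (case p of (s, x) \<Rightarrow> if s = 0 then x else s *\<^sub>R x)) \<in> borel_measurable (\<kappa> \<Otimes>\<^sub>M M)"
        unfolding case_prod_beta by measurable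
    qed measurable
    also have "\<dots> = (CLINT x|mix_levy \<kappa> M. levy_integrand y x)"
      unfolding mix_levy_def
      by (rule integral_distr[OF scale_measurable, symmetric])
        (rule measurable_levy_spectral_measure[OF M], measurable)
    finally show ?thesis .
  qed
  have shift: "(LINT p|(\<kappa> \<Otimes>\<^sub>M M). G p) =
      (LINT x:{x. 1 < norm x}|M. (LINT s|\<kappa>. indicator {0<..1 / norm x} s * s) *\<^sub>R x)"
  proof -
    have "(LINT p|(\<kappa> \<Otimes>\<^sub>M M). G p) = (LINT x|M. (LINT s|\<kappa>. G (s, x)))"
      using P.integral_snd[of "\<lambda>s x. G (s, x)"] iG by simp
    also have "\<dots> = (LINT x:{x. 1 < norm x}|M. (LINT s|\<kappa>. indicator {0<..1 / norm x} s * s) *\<^sub>R x)"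
      unfolding set_lebesgue_integral_def
    proof (intro Bochner_Integration.integral_cong refl)
      fix x :: 'a
      have "G (s, x) = (indicator {0<..1 / norm x} s * s) *\<^sub>R (indicator {x. 1 < norm x} x *\<^sub>R x)" for s
      proof (cases "1 < norm x")
        case True
        then have "0 < norm x" by linarith
        then have "s \<le> 1 / norm x \<longleftrightarrow> s * norm x \<le> 1" by (rule pos_le_divide_eq)
        with True show ?thesis by (auto simp: G_def indicator_def)
      qed (simp add: G_def)
      moreover have "integrable \<kappa> (\<lambda>s. indicator {0<..1 / norm x} s * s)"
      proof (rule \<kappa>.integrable_const_bound)
        show "AE s in \<kappa>. norm (indicator {0<..1 / norm x} s * s) \<le> 1"
          by (rule eventually_mono[OF AE_\<kappa>]) (simp add: indicator_def)
      qed measurable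
      ultimately show "(LINT s|\<kappa>. G (s, x)) =
          indicator {x. 1 < norm x} x *\<^sub>R ((LINT s|\<kappa>. indicator {0<..1 / norm x} s * s) *\<^sub>R x)"
        by (cases "1 < norm x") (simp_all add: integral_scaleR_left)
    qed
    finally show ?thesis .
  qed
  have s_int: "integrable \<kappa> (\<lambda>s. s)" "integrable \<kappa> (\<lambda>s. s\<^sup>2)"
    by (intro \<kappa>.integrable_const_bound[where B = 1] eventually_mono[OF AE_\<kappa>];
        simp add: power_le_one measurable_cong_sets[OF sets_\<kappa> refl])+
  have "(LINT s|\<kappa>. levy_exponent a R M (s *\<^sub>R y)) =
      (CLINT s|\<kappa>. \<i> * of_real (y \<bullet> a) * of_real s - of_real (y \<bullet> R y) / 2 * of_real (s\<^sup>2) +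
        (CLINT x|M. ?\<psi>1 (s, x)))"
    by (intro Bochner_Integration.integral_cong refl)
      (simp add: levy_exponent_alt linear_scale[OF R] power2_eq_square algebra_simps)
  also have "\<dots> = \<i> * of_real (y \<bullet> a) * of_real (LINT s|\<kappa>. s) - of_real (y \<bullet> R y) / 2 * of_real (LINT s|\<kappa>. s\<^sup>2) +
      (CLINT s|\<kappa>. (CLINT x|M. ?\<psi>1 (s, x)))"
  proof -
    have j: "integrable \<kappa> (\<lambda>s. \<i> * of_real (y \<bullet> a) * of_real s)"
      "integrable \<kappa> (\<lambda>s. of_real (y \<bullet> R y) / 2 * of_real (s\<^sup>2) :: complex)"
      by (intro integrable_mult_right integrable_of_real s_int)+
    have k: "integrable \<kappa> (\<lambda>s. CLINT x|M. ?\<psi>1 (s, x))"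
      by (rule P.integrable_fst'[OF i1])
    show ?thesis
      by (subst Bochner_Integration.integral_add[OF Bochner_Integration.integrable_diff[OF j] k],
          subst Bochner_Integration.integral_diff[OF j], unfold integral_mult_right_zero integral_complex_of_real) (rule refl)
  qed
  also have "(CLINT s|\<kappa>. (CLINT x|M. ?\<psi>1 (s, x))) = (CLINT p|(\<kappa> \<Otimes>\<^sub>M M). ?\<psi>1 p)"
    by (rule P.integral_fst'[OF i1])
  finally show ?thesis
    unfolding inner shift by (simp add: levy_exponent_alt inner_add_right algebra_simps)
qed

end

lemma spec_trans_eq_mix_law:
  assumes M: "levy_spectral_measure M" and A: "A \<in> sets borel" "0 \<notin> A"
  shows "spec_trans b M A = (\<integral>\<^sup>+s. dilation s M A \<partial>mix_law (\<lambda>_. b) 1)"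
proof -
  have "(\<integral>\<^sup>+s. dilation s M A \<partial>mix_law (\<lambda>_. b) (Suc 0)) =
      (\<integral>\<^sup>+t\<in>{0<..1}. (\<integral>\<^sup>+s. dilation (t powr (1 / b) * s) M A \<partial>mix_law (\<lambda>_. b) 0) \<partial>lborel)"
    by (rule nn_integral_mix_law_Suc[OF measurable_dilation[OF M A]])
  also have "\<dots> = spec_trans b M A"
    unfolding spec_trans_def mix_law.simps
    by (subst nn_integral_return) (auto intro!: measurable_compose[OF _ measurable_dilation[OF M A]])
  finally show ?thesis by simp
qed

lemma continuous_on_mixed_exponent:
  fixes \<Phi> :: "'a::euclidean_space \<Rightarrow> complex"
  assumes \<Phi>: "continuous_on UNIV \<Phi>" and \<beta>: "\<forall>j\<in>{1..n}. 0 < \<beta> j"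
  shows "continuous_on UNIV (\<lambda>y. LINT s|mix_law \<beta> n. \<Phi> (s *\<^sub>R y))"
  unfolding continuous_on_sequentially comp_def
proof (intro ballI allI impI, elim conjE)
  interpret prob_space "mix_law \<beta> n" by (rule prob_space_mix_law)
  have \<Phi>_meas: "(\<lambda>s. \<Phi> (s *\<^sub>R z)) \<in> borel_measurable (mix_law \<beta> n)" for z
    unfolding measurable_cong_sets[OF sets_mix_law refl]
    by (rule measurable_compose[OF _ borel_measurable_continuous_onI[OF \<Phi>]]) simp
  fix y and Y :: "nat \<Rightarrow> 'a" assume Y: "Y \<longlonglongrightarrow> y"
  then obtain B where B: "\<And>k. norm (Y k) \<le> B"
    using convergent_imp_bounded by (force simp: bounded_iff)
  have "bounded (\<Phi> ` cball 0 B)"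
    by (intro compact_imp_bounded compact_continuous_image continuous_on_subset[OF \<Phi>]) auto
  then obtain K where K: "\<And>z. norm z \<le> B \<Longrightarrow> norm (\<Phi> z) \<le> K"
    unfolding bounded_iff by force
  show "(\<lambda>k. LINT s|mix_law \<beta> n. \<Phi> (s *\<^sub>R Y k)) \<longlonglongrightarrow> (LINT s|mix_law \<beta> n. \<Phi> (s *\<^sub>R y))"
  proof (rule integral_dominated_convergence)
    show "integrable (mix_law \<beta> n) (\<lambda>_. K)" by simp
    have "isCont \<Phi> z" for z using \<Phi> by (simp add: continuous_on_eq_continuous_at)
    then show "AE s in mix_law \<beta> n. (\<lambda>k. \<Phi> (s *\<^sub>R Y k)) \<longlonglongrightarrow> \<Phi> (s *\<^sub>R y)"
      by (intro AE_I2 isCont_tendsto_compose[of _ \<Phi>] tendsto_intros Y)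
    show "AE s in mix_law \<beta> n. norm (\<Phi> (s *\<^sub>R Y k)) \<le> K" for k
    proof (rule eventually_mono[OF AE_mix_law[OF \<beta>]])
      fix s :: real assume "0 < s \<and> s \<le> 1"
      then have "norm (s *\<^sub>R Y k) \<le> norm (Y k)" by (auto intro: mult_left_le_one_le)
      then show "norm (\<Phi> (s *\<^sub>R Y k)) \<le> K" using B[of k] by (intro K) simp
    qed
  qed (rule \<Phi>_meas)+
qed

text \<open>
  The induction carries a continuous logarithm of the characteristic function: averaging over dilations
  preserves continuity and the value 0 at the origin, which the next random integral asks for.
\<close>

lemma iter_rand_int_law_char:
  fixes \<nu> \<mu> :: "'a::euclidean_space measure"
  assumes "iter_rand_int_law TYPE('w) \<beta> n \<nu> \<mu>" and "\<forall>j\<in>{1..n}. 0 < \<beta> j"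
    and \<Phi>: "continuous_on UNIV \<Phi>" "\<Phi> 0 = 0" "\<And>y. char_fun \<nu> y = exp (\<Phi> y)"
  shows "char_fun \<mu> y = exp (LINT s|mix_law \<beta> n. \<Phi> (s *\<^sub>R y)) \<and> (1 \<le> n \<longrightarrow> infinitely_divisible \<mu>)"
  using assms(1,2)
proof (induction n arbitrary: \<mu> y)
  case 0
  have [measurable]: "\<Phi> \<in> borel_measurable borel" using \<Phi>(1) by (rule borel_measurable_continuous_onI)
  show ?case using 0 \<Phi> by (simp add: integral_return)
next
  case (Suc n)
  have [measurable]: "\<Phi> \<in> borel_measurable borel" using \<Phi>(1) by (rule borel_measurable_continuous_onI)
  obtain \<mu>' where \<mu>': "iter_rand_int_law TYPE('w) \<beta> n \<nu> \<mu>'" "rand_int_law TYPE('w) (\<beta> (Suc n)) \<mu>' \<mu>"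
    using Suc.prems by auto
  have \<beta>: "\<forall>j\<in>{1..n}. 0 < \<beta> j" "0 < \<beta> (Suc n)" using Suc.prems(2) by auto
  let ?\<Psi> = "\<lambda>y. LINT s|mix_law \<beta> n. \<Phi> (s *\<^sub>R y)"
  note step = rand_int_law_char[OF \<mu>'(2) \<beta>(2), of ?\<Psi>]
  have \<Psi>: "continuous_on UNIV ?\<Psi>" "?\<Psi> 0 = 0" "char_fun \<mu>' y = exp (?\<Psi> y)" for y
    using continuous_on_mixed_exponent[OF \<Phi>(1) \<beta>(1)] Suc.IH[OF \<mu>'(1) \<beta>(1)] \<Phi>(2) by auto
  have "bounded (\<Phi> ` (\<lambda>s. s *\<^sub>R y) ` {0..1::real})"
    by (intro compact_imp_bounded compact_continuous_image continuous_on_subset[OF \<Phi>(1)] continuous_intros) auto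
  then obtain K where K: "\<And>s. 0 < s \<Longrightarrow> s \<le> 1 \<Longrightarrow> norm (\<Phi> (s *\<^sub>R y)) \<le> K"
    unfolding bounded_iff by force
  have "(LINT s|mix_law \<beta> (Suc n). \<Phi> (s *\<^sub>R y)) = (LINT t:{0<..1}|lborel. ?\<Psi> (t powr (1 / \<beta> (Suc n)) *\<^sub>R y))"
    by (subst integral_mix_law_Suc[OF _ K Suc.prems(2)]) (simp_all add: mult.commute del: mix_law.simps)
  then show ?case
    using step[OF \<Psi>] by (simp del: mix_law.simps)
qed

section \<open>The triple of the iterated random integral\<close>

lemma set_integrable_b_vec:
  assumes M: "levy_spectral_measure M" and p: "0 < p"
  shows "set_integrable M {x. 1 < norm x} (\<lambda>x. (norm x powr (- 1 - p)) *\<^sub>R x)"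
  unfolding set_integrable_def
proof (rule integrable_dominated_levy[OF M])
  fix x :: 'a
  show "norm (indicator {x. 1 < norm x} x *\<^sub>R (norm x powr (- 1 - p)) *\<^sub>R x) \<le> 1 * min 1 ((norm x)\<^sup>2)"
  proof (cases "1 < norm x")
    case True
    then have "x \<noteq> 0" by auto
    have "norm x powr (- 1 - p) * norm x = norm x powr (- 1 - p) * norm x powr 1" by simp
    also have "\<dots> = norm x powr (- p)" by (simp only: powr_add[symmetric]) simp
    also have "\<dots> \<le> norm x powr 0" using True p by (intro powr_mono) auto
    finally show ?thesis using True \<open>x \<noteq> 0\<close> one_less_power[OF True, of 2] by simp
  qed simp
qed measurable

text \<open>
  The general mixture formula for \<open>\<kappa> = mix_law \<beta> n\<close>. The truncated first moment of \<open>\<kappa>\<close> at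
  \<open>r = 1/\<bar>x\<bar>\<close> contributes the powers \<open>r powr (\<beta>\<^sub>j + 1) = \<bar>x\<bar> powr (- 1 - \<beta>\<^sub>j)\<close>, which are the weights in
  \<^const>\<open>b_vec\<close>.
\<close>

lemma has_triple_iterated:
  fixes \<nu> \<mu> :: "'a::euclidean_space measure"
  assumes n: "1 \<le> n" and \<beta>: "inj_on \<beta> {1..n}" "\<forall>j\<in>{1..n}. 0 < \<beta> j"
    and \<nu>: "has_triple \<nu> a R M" and \<mu>: "iter_rand_int_law TYPE('w) \<beta> n \<nu> \<mu>"
  shows "has_triple \<mu>
      ((\<Prod>j=1..n. \<beta> j / (\<beta> j + 1)) *\<^sub>R a + (\<Sum>j=1..n. C_coeff \<beta> j n *\<^sub>R (\<beta> j / (\<beta> j + 1)) *\<^sub>R b_vec M (\<beta> j)))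
      (\<lambda>x. (\<Prod>j=1..n. \<beta> j / (\<beta> j + 2)) *\<^sub>R R x) (mix_levy (mix_law \<beta> n) M)"
proof -
  let ?\<kappa> = "mix_law \<beta> n"
  have M: "levy_spectral_measure M" and R: "covariance_operator R" "linear R"
    using \<nu> by (auto simp: has_triple_def covariance_operator_def)
  interpret prob_space ?\<kappa> by (rule prob_space_mix_law)
  note AE = AE_mix_law[OF \<beta>(2)]
  have trunc: "(LINT s|?\<kappa>. indicator {0<..r} s * s) = (\<Sum>j=1..n. C_coeff \<beta> j n * (\<beta> j / (\<beta> j + 1) * r powr (\<beta> j + 1)))"
    if "0 < r" "r \<le> 1" for r
  proof -
    have "(LINT s|?\<kappa>. indicator {0<..r} s * s) = (LINT s|?\<kappa>. indicator {0<..r} s * s powr 1)"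
      by (intro Bochner_Integration.integral_cong refl) (auto simp: indicator_def)
    then show ?thesis using integral_mix_law_moment[OF \<beta> n that, of 1] by simp
  qed
  have first: "(LINT s|?\<kappa>. s) = (\<Prod>j=1..n. \<beta> j / (\<beta> j + 1))"
  proof -
    have "(LINT s|?\<kappa>. s) = (LINT s|?\<kappa>. indicator {0<..1} s * s)"
    proof (rule integral_cong_AE)
      show "AE s in ?\<kappa>. s = indicator {0<..1} s * s"
        by (rule eventually_mono[OF AE]) simp
    qed (simp_all add: measurable_cong_sets[OF sets_mix_law refl])
    also have "\<dots> = (\<Sum>j=1..n. C_coeff \<beta> j n * (\<beta> j / (\<beta> j + 1)))"
      using trunc[of 1] by simp
    also have "\<dots> = (\<Prod>j=1..n. \<beta> j / (\<beta> j + 1))"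
      by (rule sum_C_coeff_moment[OF \<beta>(1) n \<beta>(2)]) simp
    finally show ?thesis .
  qed
  have second: "(LINT s|?\<kappa>. s\<^sup>2) = (\<Prod>j=1..n. \<beta> j / (\<beta> j + 2))"
  proof -
    have "(LINT s|?\<kappa>. s\<^sup>2) = (LINT s|?\<kappa>. indicator {0<..1} s * s powr 2)"
    proof (rule integral_cong_AE)
      show "AE s in ?\<kappa>. s\<^sup>2 = indicator {0<..1} s * s powr 2"
        by (rule eventually_mono[OF AE]) (simp add: powr_numeral)
    qed (simp_all add: measurable_cong_sets[OF sets_mix_law refl])
    also have "\<dots> = (\<Sum>j=1..n. C_coeff \<beta> j n * (\<beta> j / (\<beta> j + 2)))"
      using integral_mix_law_moment[OF \<beta> n, of 1 2] by simp
    also have "\<dots> = (\<Prod>j=1..n. \<beta> j / (\<beta> j + 2))"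
      by (rule sum_C_coeff_moment[OF \<beta>(1) n \<beta>(2)]) simp
    finally show ?thesis .
  qed
  have shift: "(LINT x:{x. 1 < norm x}|M. (LINT s|?\<kappa>. indicator {0<..1 / norm x} s * s) *\<^sub>R x) =
      (\<Sum>j=1..n. C_coeff \<beta> j n *\<^sub>R (\<beta> j / (\<beta> j + 1)) *\<^sub>R b_vec M (\<beta> j))"
  proof -
    let ?h = "\<lambda>j x. indicator {x. 1 < norm x} x *\<^sub>R (norm x powr (- 1 - \<beta> j)) *\<^sub>R (x :: 'a)"
    have "indicator {x. 1 < norm x} x *\<^sub>R (LINT s|?\<kappa>. indicator {0<..1 / norm x} s * s) *\<^sub>R x =
        (\<Sum>j=1..n. (C_coeff \<beta> j n * (\<beta> j / (\<beta> j + 1))) *\<^sub>R ?h j x)" for x :: 'a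
    proof (cases "1 < norm x")
      case True
      have "(1 / norm x) powr (\<beta> j + 1) = norm x powr (- 1 - \<beta> j)" for j
      proof -
        have e: "- 1 - \<beta> j = - (\<beta> j + 1)" by simp
        show ?thesis using True by (simp only: e powr_minus_divide) (simp add: powr_divide)
      qed
      moreover have "0 < norm x" using True by linarith
      then have "(LINT s|?\<kappa>. indicator {0<..1 / norm x} s * s) =
          (\<Sum>j=1..n. C_coeff \<beta> j n * (\<beta> j / (\<beta> j + 1) * (1 / norm x) powr (\<beta> j + 1)))"
        using True by (intro trunc) (simp_all only: divide_le_eq_1_pos zero_less_divide_1_iff less_imp_le)
      ultimately show ?thesis
        using True by (simp add: scaleR_sum_left mult.assoc)
    qed simp
    then have "(LINT x:{x. 1 < norm x}|M. (LINT s|?\<kappa>. indicator {0<..1 / norm x} s * s) *\<^sub>R x) =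
        (LINT x|M. (\<Sum>j=1..n. (C_coeff \<beta> j n * (\<beta> j / (\<beta> j + 1))) *\<^sub>R ?h j x))"
      by (simp only: set_lebesgue_integral_def)
    also have "\<dots> = (\<Sum>j=1..n. LINT x|M. (C_coeff \<beta> j n * (\<beta> j / (\<beta> j + 1))) *\<^sub>R ?h j x)"
    proof (rule Bochner_Integration.integral_sum)
      fix j assume "j \<in> {1..n}"
      then have "0 < \<beta> j" using \<beta>(2) by blast
      then show "integrable M (\<lambda>x. (C_coeff \<beta> j n * (\<beta> j / (\<beta> j + 1))) *\<^sub>R ?h j x)"
        using set_integrable_b_vec[OF M, of "\<beta> j"] unfolding set_integrable_def
        by (intro integrable_scaleR_right) auto
    qed
    also have "\<dots> = (\<Sum>j=1..n. (C_coeff \<beta> j n * (\<beta> j / (\<beta> j + 1))) *\<^sub>R b_vec M (\<beta> j))"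
      by (simp only: integral_scaleR_right b_vec_def set_lebesgue_integral_def)
    finally show ?thesis by (simp only: scaleR_scaleR)
  qed
  have cont: "continuous_on UNIV (levy_exponent a R M)"
    by (rule continuous_on_levy_exponent[OF M R(2)])
  note ch = iter_rand_int_law_char[OF \<mu> \<beta>(2) cont levy_exponent_zero]
  have "0 \<le> (\<Prod>j=1..n. \<beta> j / (\<beta> j + 2))"
    using \<beta>(2) by (intro prod_nonneg) (auto intro!: divide_nonneg_nonneg simp: less_imp_le add_nonneg_nonneg)
  then have "covariance_operator (\<lambda>x. (\<Prod>j=1..n. \<beta> j / (\<beta> j + 2)) *\<^sub>R R x)"
    using R by (auto simp: covariance_operator_def intro: linear_compose_scale_right)
  then show ?thesis
    unfolding has_triple_def
    using ch \<nu> n levy_spectral_measure_mix_levy[OF prob_space_mix_law sets_mix_law AE M]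
      levy_exponent_mixture[OF prob_space_mix_law sets_mix_law AE M R(2), of a, unfolded first second shift]
    by (simp add: has_triple_def)
qed

theorem theorem2:
  fixes \<beta> :: "nat \<Rightarrow> real" and n :: nat
    and a :: "'a::euclidean_space" and R :: "'a \<Rightarrow> 'a" and M \<nu> \<mu> :: "'a measure"
  assumes "n \<ge> 1"
    and "\<forall>j\<in>{1..n}. \<beta> j > 0"
    and "inj_on \<beta> {1..n}"
    and "has_triple \<nu> a R M"
    and "iter_rand_int_law TYPE('w) \<beta> n \<nu> \<mu>"
  shows "(\<exists>a' R' M'. has_triple \<mu> a' R' M') \<and>
    (\<forall>a' R' M'. has_triple \<mu> a' R' M' \<longrightarrow>
      a' = (\<Prod>j=1..n. \<beta> j / (\<beta> j + 1)) *\<^sub>R a +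
           (\<Sum>j=1..n. (\<Prod>k\<in>{1..n} - {j}. \<beta> k / (\<beta> k - \<beta> j)) *\<^sub>R
              ((\<beta> j / (\<beta> j + 1)) *\<^sub>R b_vec M (\<beta> j))) \<and>
      a' = (\<Sum>j=1..n. C_coeff \<beta> j n *\<^sub>R shift_trans (\<beta> j) a M) \<and>
      R' = (\<lambda>x. (\<Prod>j=1..n. \<beta> j / (\<beta> j + 2)) *\<^sub>R R x) \<and>
      R' = (\<lambda>x. \<Sum>j=1..n. C_coeff \<beta> j n *\<^sub>R cov_trans (\<beta> j) R x) \<and>
      (\<forall>A\<in>sets borel. 0 \<notin> A \<longrightarrow>
        emeasure M' A =
          iter_integral n (\<lambda>t. dilation (\<Prod>j=1..n. t j powr (1 / \<beta> j)) M A) \<and>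
        \<comment> \<open>the signed sum, for sets on which its terms are finite\<close>
        ((\<forall>j\<in>{1..n}. spec_trans (\<beta> j) M A < \<infinity>) \<longrightarrow>
          emeasure M' A < \<infinity> \<and>
          measure M' A = (\<Sum>j=1..n. C_coeff \<beta> j n * enn2real (spec_trans (\<beta> j) M A))) \<and>
        \<comment> \<open>the same for all sets, with the terms with negative coefficients moved to the left
            (\<open>ennreal\<close> of a negative number is 0)\<close>
        emeasure M' A + (\<Sum>j=1..n. ennreal (- C_coeff \<beta> j n) * spec_trans (\<beta> j) M A) =
          (\<Sum>j=1..n. ennreal (C_coeff \<beta> j n) * spec_trans (\<beta> j) M A)))"
proof -
  let ?C = "\<lambda>j. C_coeff \<beta> j n"
  define a0 where "a0 = (\<Prod>j=1..n. \<beta> j / (\<beta> j + 1)) *\<^sub>R a + (\<Sum>j=1..n. ?C j *\<^sub>R (\<beta> j / (\<beta> j + 1)) *\<^sub>R b_vec M (\<beta> j))"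
  define R0 where "R0 = (\<lambda>x. (\<Prod>j=1..n. \<beta> j / (\<beta> j + 2)) *\<^sub>R R x)"
  define M0 where "M0 = mix_levy (mix_law \<beta> n) M"
  have triple: "has_triple \<mu> a0 R0 M0"
    unfolding a0_def R0_def M0_def by (rule has_triple_iterated[OF assms(1,3,2,4,5)])
  have M: "levy_spectral_measure M" using assms(4) by (simp add: has_triple_def)
  have moment: "(\<Prod>j=1..n. \<beta> j / (\<beta> j + p)) = (\<Sum>j=1..n. ?C j * (\<beta> j / (\<beta> j + p)))" if "0 \<le> p" for p
    by (rule sum_C_coeff_moment[OF assms(3,1,2) that, symmetric])
  have a0: "a0 = (\<Sum>j=1..n. ?C j *\<^sub>R shift_trans (\<beta> j) a M)"
    unfolding a0_def moment[OF zero_le_one] shift_trans_def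
    by (simp add: scaleR_add_right sum.distrib scaleR_sum_left)
  have R0: "R0 = (\<lambda>x. \<Sum>j=1..n. ?C j *\<^sub>R cov_trans (\<beta> j) R x)"
    unfolding R0_def moment[OF zero_le_numeral] cov_trans_def by (simp add: scaleR_sum_left)
  have spec: "emeasure M0 A = iter_integral n (\<lambda>t. dilation (\<Prod>j=1..n. t j powr (1 / \<beta> j)) M A) \<and>
      ((\<forall>j\<in>{1..n}. spec_trans (\<beta> j) M A < \<infinity>) \<longrightarrow>
          emeasure M0 A < \<infinity> \<and> measure M0 A = (\<Sum>j=1..n. ?C j * enn2real (spec_trans (\<beta> j) M A))) \<and>
      emeasure M0 A + (\<Sum>j=1..n. ennreal (- ?C j) * spec_trans (\<beta> j) M A) =
          (\<Sum>j=1..n. ennreal (?C j) * spec_trans (\<beta> j) M A)"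
    if A: "A \<in> sets borel" "0 \<notin> A" for A
  proof (intro conjI impI)
    note meas = measurable_dilation[OF M A]
    have M0: "emeasure M0 A = (\<integral>\<^sup>+s. dilation s M A \<partial>mix_law \<beta> n)"
      unfolding M0_def by (rule emeasure_mix_levy[OF prob_space_mix_law sets_mix_law AE_mix_law[OF assms(2)] M A])
    then show "emeasure M0 A = iter_integral n (\<lambda>t. dilation (\<Prod>j=1..n. t j powr (1 / \<beta> j)) M A)"
      by (simp only: iter_integral_mix_law[OF meas])
    show signed: "emeasure M0 A + (\<Sum>j=1..n. ennreal (- ?C j) * spec_trans (\<beta> j) M A) =
        (\<Sum>j=1..n. ennreal (?C j) * spec_trans (\<beta> j) M A)"
      unfolding M0 spec_trans_eq_mix_law[OF M A] by (rule nn_integral_mix_law_signed[OF assms(3,2,1) meas])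
    assume fin: "\<forall>j\<in>{1..n}. spec_trans (\<beta> j) M A < \<infinity>"
    have "emeasure M0 A \<le> (\<Sum>j=1..n. ennreal (?C j) * spec_trans (\<beta> j) M A)"
      unfolding signed[symmetric] by simp
    also have "\<dots> < \<infinity>"
      using fin by (simp add: ennreal_mult_less_top)
    finally show M0_fin: "emeasure M0 A < \<infinity>" .
    have "ennreal (measure M0 A) + (\<Sum>j=1..n. ennreal (- ?C j) * ennreal (enn2real (spec_trans (\<beta> j) M A))) =
        (\<Sum>j=1..n. ennreal (?C j) * ennreal (enn2real (spec_trans (\<beta> j) M A)))"
      using signed fin M0_fin by (simp add: measure_def)
    then show "measure M0 A = (\<Sum>j=1..n. ?C j * enn2real (spec_trans (\<beta> j) M A))"
      by (subst (asm) ennreal_signed_sum_iff) simp_all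
  qed
  show ?thesis
  proof (intro conjI allI impI)
    show "\<exists>a' R' M'. has_triple \<mu> a' R' M'" using triple by blast
    fix a' R' M' assume "has_triple \<mu> a' R' M'"
    note eq = has_triple_unique[OF this triple]
    show "a' = (\<Prod>j=1..n. \<beta> j / (\<beta> j + 1)) *\<^sub>R a +
           (\<Sum>j=1..n. (\<Prod>k\<in>{1..n} - {j}. \<beta> k / (\<beta> k - \<beta> j)) *\<^sub>R
              ((\<beta> j / (\<beta> j + 1)) *\<^sub>R b_vec M (\<beta> j)))"
      unfolding eq a0_def C_coeff_def ..
    show "a' = (\<Sum>j=1..n. ?C j *\<^sub>R shift_trans (\<beta> j) a M)" unfolding eq by (rule a0)
    show "R' = (\<lambda>x. (\<Prod>j=1..n. \<beta> j / (\<beta> j + 2)) *\<^sub>R R x)" unfolding eq by (rule R0_def)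
    show "R' = (\<lambda>x. \<Sum>j=1..n. ?C j *\<^sub>R cov_trans (\<beta> j) R x)" unfolding eq by (rule R0)
  qed (use spec has_triple_unique(3)[OF _ triple] in blast)
qed

end
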